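(* Let $0<q<1$, let $f:[0,\infty)\times\mathbb{R}^d\times\mathbb{R}^d\to\mathbb{R}^d$ and $g:[0,\infty)\times\mathbb{R}^d\times\mathbb{R}^d\to\mathbb{R}^{d\times m}$ satisfy $f(t,0,0)=0$ and $g(t,0,0)=0$ for all $t\ge 0$, and consider the stochastic pantograph differential equation $$dx(t)=f(t,x(t),x(qt))\,dt+g(t,x(t),x(qt))\,dB(t),\quad t\ge 0,\qquad x(0)=x_0,\quad E|x_0|^2<\infty .$$ Suppose there are real numbers $a$ and $b>0$, $c>0$, $d_0>0$ such that for all $t\ge 0$ and all $x,y,x_1,x_2,y_1,y_2\in\mathbb{R}^d$: $$\langle x_1-x_2,\,f(t,x_1,y)-f(t,x_2,y)\rangle\le a|x_1-x_2|^2,\qquad |f(t,x,y_1)-f(t,x,y_2)|\le b|y_1-y_2|,$$ $$|g(t,x_1,y)-g(t,x_2,y)|\le c|x_1-x_2|,\qquad |g(t,x,y_1)-g(t,x,y_2)|\le d_0|y_1-y_2| .$$ If $a+b+c^2+d_0^2<0$, then the zero solution of the equation is mean-square polynomially stable; that is, there exists a constant $\alpha<0$ such that for every initial value $x_0$ with $E|x_0|^2<\infty$, the solution $x(t)$ with $x(0)=x_0$ satisfies $$\limsup_{t\to\infty}\frac{\log E|x(t)|^2}{\log t}\le\alpha .$$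
   Context: $(\Omega,\mathcal{F},P)$ is a complete probability space with a filtration $\{\mathcal{F}_t\}_{t\ge0}$ satisfying the usual conditions, and $B$ is an $m$-dimensional Brownian motion with respect to this filtration. $|\cdot|$ is the Euclidean norm on vectors and the trace norm $|A|=\sqrt{\operatorname{trace}(A^TA)}$ on matrices; $\langle x,y\rangle=x^Ty$. A solution is a continuous $\{\mathcal{F}_t\}$-adapted $\mathbb{R}^d$-valued process $x$ (so $x_0$ is $\mathcal{F}_0$-measurable) satisfying, almost surely for all $t\ge 0$, $x(t)=x_0+\int_0^t f(s,x(s),x(qs))\,ds+\int_0^t g(s,x(s),x(qs))\,dB(s)$, with these (Itô) integrals well defined. Convention: $\log 0=-\infty$. *)

theory Defs
  imports "HOL-Probability.Probability"
begin

text \<open>The library norm on \<^typ>\<open>real^'m^'d\<close> is the trace norm.\<close>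

lemma norm_matrix_eq_trace_norm:
  fixes A :: "real^'m^'d"
  shows "norm A = sqrt (trace (transpose A ** A))"
proof -
  have "(norm A)\<^sup>2 = (\<Sum>i\<in>UNIV. \<Sum>j\<in>UNIV. (A $ i $ j)\<^sup>2)"
    unfolding power2_norm_eq_inner inner_vec_def by (simp add: power2_eq_square)
  also have "\<dots> = (\<Sum>j\<in>UNIV. \<Sum>i\<in>UNIV. (A $ i $ j)\<^sup>2)"
    by (rule sum.swap)
  also have "\<dots> = trace (transpose A ** A)"
    by (simp add: trace_def transpose_def matrix_matrix_mult_def power2_eq_square)
  finally show ?thesis
    by (metis norm_ge_zero real_sqrt_abs abs_of_nonneg)
qed

text \<open>
  Time is \<^term>\<open>{0::real..}\<close>; processes and filtrations are functions on the reals of which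
  only the values at nonnegative times matter. Of each \<^term>\<open>F t\<close> only the sigma-algebra is
  used. \<^term>\<open>max 0 t\<close> extends the filtration to negative times so that the library locale
  applies.
\<close>

definition usual_filtration :: "'a measure \<Rightarrow> (real \<Rightarrow> 'a measure) \<Rightarrow> bool" where
  "usual_filtration M F \<longleftrightarrow>
     filtration (space M) (\<lambda>t. F (max 0 t)) \<and>
     (\<forall>t\<ge>0. subalgebra M (F t)) \<and>
     null_sets M \<subseteq> sets (F 0) \<and>
     (\<forall>t\<ge>0. sets (F t) = (\<Inter>u\<in>{t<..}. sets (F u)))"

definition adapted :: "(real \<Rightarrow> 'a measure) \<Rightarrow> (real \<Rightarrow> 'a \<Rightarrow> 'b::topological_space) \<Rightarrow> bool" where
  "adapted F X \<longleftrightarrow> (\<forall>t\<ge>0. X t \<in> borel_measurable (F t))"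

text \<open>As usual, path continuity is only required almost surely.\<close>

definition continuous_process :: "'a measure \<Rightarrow> (real \<Rightarrow> 'a \<Rightarrow> 'b::topological_space) \<Rightarrow> bool" where
  "continuous_process M X \<longleftrightarrow> (AE \<omega> in M. continuous_on {0..} (\<lambda>t. X t \<omega>))"

definition brownian_motion ::
    "'a measure \<Rightarrow> (real \<Rightarrow> 'a measure) \<Rightarrow> (real \<Rightarrow> 'a \<Rightarrow> real^'m) \<Rightarrow> bool" where
  "brownian_motion M F B \<longleftrightarrow>
     adapted F B \<and> continuous_process M B \<and> (AE \<omega> in M. B 0 \<omega> = 0) \<and>
     (\<forall>s\<ge>0. \<forall>t>s.
        prob_space.indep_set M (sets (F s))
          {(\<lambda>\<omega>. B t \<omega> - B s \<omega>) -` A \<inter> space M | A. A \<in> sets borel} \<and>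
        prob_space.indep_vars M (\<lambda>_. borel) (\<lambda>i \<omega>. (B t \<omega> - B s \<omega>) $ i) UNIV \<and>
        (\<forall>i. distributed M lborel (\<lambda>\<omega>. (B t \<omega> - B s \<omega>) $ i) (normal_density 0 (sqrt (t - s)))))"

text \<open>
  A simple integrand with \<^term>\<open>k\<close> steps is \<open>\<xi> i\<close> on the interval from \<open>\<tau> i\<close> (exclusive) to
  \<open>\<tau> (i + 1)\<close> (inclusive), for \<open>i < k\<close>, where \<open>\<xi> i\<close> is bounded and measurable with respect
  to the sigma-algebra at the left end point.
\<close>

definition simple_integrand ::
    "'a measure \<Rightarrow> (real \<Rightarrow> 'a measure) \<Rightarrow> nat \<Rightarrow> (nat \<Rightarrow> real) \<Rightarrow> (nat \<Rightarrow> 'a \<Rightarrow> real^'m^'d) \<Rightarrow> bool" where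
  "simple_integrand M F k \<tau> \<xi> \<longleftrightarrow>
     0 \<le> \<tau> 0 \<and> (\<forall>i<k. \<tau> i < \<tau> (Suc i)) \<and>
     (\<forall>i<k. \<xi> i \<in> borel_measurable (F (\<tau> i)) \<and> (\<exists>K. \<forall>\<omega>\<in>space M. norm (\<xi> i \<omega>) \<le> K))"

definition simple_process ::
    "nat \<Rightarrow> (nat \<Rightarrow> real) \<Rightarrow> (nat \<Rightarrow> 'a \<Rightarrow> real^'m^'d) \<Rightarrow> real \<Rightarrow> 'a \<Rightarrow> real^'m^'d" where
  "simple_process k \<tau> \<xi> t \<omega> = (\<Sum>i<k. if \<tau> i < t \<and> t \<le> \<tau> (Suc i) then \<xi> i \<omega> else 0)"

definition simple_ito_integral ::
    "(real \<Rightarrow> 'a \<Rightarrow> real^'m) \<Rightarrow> nat \<Rightarrow> (nat \<Rightarrow> real) \<Rightarrow> (nat \<Rightarrow> 'a \<Rightarrow> real^'m^'d) \<Rightarrow> real \<Rightarrow> 'a \<Rightarrow> real^'d" where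
  "simple_ito_integral B k \<tau> \<xi> t \<omega> =
     (\<Sum>i<k. \<xi> i \<omega> *v (B (min t (\<tau> (Suc i))) \<omega> - B (min t (\<tau> i)) \<omega>))"

text \<open>
  The integrands: measurable adapted processes whose paths are almost surely square integrable
  on bounded intervals.
\<close>

definition ito_integrand ::
    "'a measure \<Rightarrow> (real \<Rightarrow> 'a measure) \<Rightarrow> (real \<Rightarrow> 'a \<Rightarrow> real^'m^'d) \<Rightarrow> bool" where
  "ito_integrand M F H \<longleftrightarrow>
     (\<lambda>(s, \<omega>). H s \<omega>) \<in> borel_measurable (restrict_space borel {0..} \<Otimes>\<^sub>M M) \<and>
     adapted F H \<and>
     (AE \<omega> in M. \<forall>T\<ge>0. (\<integral>\<^sup>+s\<in>{0..T}. ennreal ((norm (H s \<omega>))\<^sup>2) \<partial>lborel) < \<infinity>)"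

text \<open>
  \<open>I\<close> is the continuous process \<open>\<integral>\<^sub>0\<^sup>t H dB\<close>: for some simple \<open>\<Phi>\<^sub>n\<close> with
  \<open>\<integral>\<^sub>0\<^sup>T |\<Phi>\<^sub>n - H|\<^sup>2 ds \<longlongrightarrow> 0\<close> in probability for every \<open>T\<close>, the integrals of \<open>\<Phi>\<^sub>n\<close> converge to
  \<open>I\<close> in probability, uniformly on every \<open>[0, T]\<close>. Every \<^const>\<open>ito_integrand\<close> admits such
  \<open>\<Phi>\<^sub>n\<close>, and \<open>I\<close> does not depend on their choice up to indistinguishability; so this is a relation
  determining \<open>I\<close> up to indistinguishability.
\<close>

definition has_ito_integral ::
    "'a measure \<Rightarrow> (real \<Rightarrow> 'a measure) \<Rightarrow> (real \<Rightarrow> 'a \<Rightarrow> real^'m) \<Rightarrow>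
     (real \<Rightarrow> 'a \<Rightarrow> real^'m^'d) \<Rightarrow> (real \<Rightarrow> 'a \<Rightarrow> real^'d) \<Rightarrow> bool" where
  "has_ito_integral M F B H I \<longleftrightarrow>
     ito_integrand M F H \<and> adapted F I \<and> continuous_process M I \<and>
     (\<exists>k \<tau> \<xi>.
        (\<forall>n. simple_integrand M F (k n) (\<tau> n) (\<xi> n)) \<and>
        (\<forall>T\<ge>0. \<forall>\<epsilon>>0.
           (\<lambda>n::nat. measure M {\<omega>\<in>space M.
              (\<integral>\<^sup>+s\<in>{0..T}. ennreal ((norm (simple_process (k n) (\<tau> n) (\<xi> n) s \<omega> - H s \<omega>))\<^sup>2) \<partial>lborel)
                > ennreal \<epsilon>}) \<longlonglongrightarrow> 0 \<and>
           (\<lambda>n. measure M {\<omega>\<in>space M.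
              \<exists>t\<in>{0..T}. norm (simple_ito_integral B (k n) (\<tau> n) (\<xi> n) t \<omega> - I t \<omega>) > \<epsilon>}) \<longlonglongrightarrow> 0))"

definition spde_solution ::
    "'a measure \<Rightarrow> (real \<Rightarrow> 'a measure) \<Rightarrow> (real \<Rightarrow> 'a \<Rightarrow> real^'m) \<Rightarrow> real \<Rightarrow>
     (real \<Rightarrow> real^'d \<Rightarrow> real^'d \<Rightarrow> real^'d) \<Rightarrow> (real \<Rightarrow> real^'d \<Rightarrow> real^'d \<Rightarrow> real^'m^'d) \<Rightarrow>
     ('a \<Rightarrow> real^'d) \<Rightarrow> (real \<Rightarrow> 'a \<Rightarrow> real^'d) \<Rightarrow> bool" where
  "spde_solution M F B q f g x0 x \<longleftrightarrow>
     adapted F x \<and> continuous_process M x \<and>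
     (\<exists>I. has_ito_integral M F B (\<lambda>s \<omega>. g s (x s \<omega>) (x (q * s) \<omega>)) I \<and>
        (AE \<omega> in M. \<forall>t\<ge>0.
           set_integrable lebesgue {0..t} (\<lambda>s. f s (x s \<omega>) (x (q * s) \<omega>)) \<and>
           x t \<omega> = x0 \<omega> + (LINT s:{0..t}|lebesgue. f s (x s \<omega>) (x (q * s) \<omega>)) + I t \<omega>))"

definition ln_ext :: "ennreal \<Rightarrow> ereal" where
  "ln_ext u = (if u = 0 then -\<infinity> else if u = \<infinity> then \<infinity> else ereal (ln (enn2real u)))"

text \<open>
  The second moments are taken in \<^typ>\<open>ennreal\<close>, so an infinite moment counts as \<open>\<infinity>\<close>.
\<close>

definition mean_square_polynomially_stable ::
    "'a measure \<Rightarrow> (real \<Rightarrow> 'a measure) \<Rightarrow> (real \<Rightarrow> 'a \<Rightarrow> real^'m) \<Rightarrow> real \<Rightarrow>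
     (real \<Rightarrow> real^'d \<Rightarrow> real^'d \<Rightarrow> real^'d) \<Rightarrow> (real \<Rightarrow> real^'d \<Rightarrow> real^'d \<Rightarrow> real^'m^'d) \<Rightarrow> bool" where
  "mean_square_polynomially_stable M F B q f g \<longleftrightarrow>
     (\<exists>\<alpha><0. \<forall>x0 x.
        x0 \<in> borel_measurable (F 0) \<longrightarrow>
        (\<integral>\<^sup>+\<omega>. ennreal ((norm (x0 \<omega>))\<^sup>2) \<partial>M) < \<infinity> \<longrightarrow>
        spde_solution M F B q f g x0 x \<longrightarrow>
        Limsup at_top (\<lambda>t::real. ln_ext (\<integral>\<^sup>+\<omega>. ennreal ((norm (x t \<omega>))\<^sup>2) \<partial>M) / ereal (ln t))
          \<le> ereal \<alpha>)"

end

theory Submission imports Defs begin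

text \<open>
  Ito's formula and stopping times are avoided. Write the solution as \<open>X = A + I\<close> with \<open>A\<close> of
  finite variation and replace \<open>I\<close> by the integral \<open>J\<close> of a simple process \<open>\<Phi>\<close>; put
  \<open>Y = A + J\<close>. On a grid, the weights \<open>\<rho> = max 0 (1 - C / R)\<close>, where \<open>C\<close> adds up the
  variation of \<open>A\<close>, the energy of \<open>\<Phi>\<close> and the running maximum of \<open>|Y|\<close> so far, are adapted
  and decreasing. So the increment of \<open>\<rho> |Y|\<^sup>2\<close> is at most
  \<open>\<rho>\<^sub>i\<^sub>+\<^sub>1 2\<langle>Y\<^sub>i\<^sub>+\<^sub>1, \<Delta>A\<rangle> + \<rho>\<^sub>i (2\<langle>Y\<^sub>i, \<Delta>J\<rangle> + |\<Delta>J|\<^sup>2)\<close>, where the martingale term has mean zero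
  and the last term is given by the Ito isometry. All terms are bounded in terms of \<open>R\<close>, so one may
  let the grid and \<open>\<Phi>\<close> converge along an almost surely convergent subsequence. As the weights
  decrease, the delayed term only gets larger when it is weighted at its own time, and
  \<open>m t = E (\<rho> |X t|\<^sup>2)\<close> satisfies \<open>m t \<le> m s + \<integral>\<^sub>s\<^sup>t (- \<kappa> m r + \<mu> m (q r)) dr\<close> with \<open>\<mu> < \<kappa>\<close>.
  Comparison with \<open>K (1 + t)\<^sup>\<alpha>\<close>, where \<open>\<alpha> < 0\<close> and \<open>- \<kappa> + \<mu> q\<^sup>\<alpha> < \<alpha>\<close>, gives a bound
  independent of \<open>R\<close>, and Fatou's lemma removes the truncation.
\<close>

section \<open>Increments of Brownian motion\<close>

text \<open>The truncation is forced: no moment of \<open>X t\<close> is known to be finite at the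
  outset, and drift and squared integrand are only integrable along almost every path. Stopping
  would multiply by an indicator, which may jump when the grids converge; a weight that is a
  continuous function of a cost converges with the cost. The cost holds what the estimates must
  control: the maximum bounds \<open>Y\<close>, the variation bounds the drift sum, the energy
  bounds the isometry terms.

  The two kinds of increment are treated asymmetrically. A drift increment is paired with the new
  value, so its square has a favourable sign and is dropped. A martingale increment must be paired
  with the old value and the old weight, which are known when it starts. Simple
  \<open>\<Phi>\<close> are used because their moments reduce to Gaussian ones.

  The constants come from \<open>2 |x| |y| \<le> |x|^2 + |y|^2\<close> and
  \<open>(u + v)^2 \<le> 2 u^2 + 2 v^2\<close>: they give
  \<open>\<kappa> = - (2 a + b + 2 c^2)\<close> and \<open>\<mu> = b + 2 d^2\<close> (with
  \<open>d\<close> for the last Lipschitz constant), so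
  \<open>\<kappa> - \<mu> = - 2 (a + b + c^2 + d^2)\<close>. The exponent \<alpha> depends on
  \<kappa>, \<mu> and \<open>q\<close> only, hence serves all initial values.\<close>

locale brownian_setup = prob_space M for M :: "'a measure" +
  fixes F :: "real \<Rightarrow> 'a measure" and B :: "real \<Rightarrow> 'a \<Rightarrow> real^'m"
  assumes complete: "complete_measure M"
    and usual: "usual_filtration M F"
    and brownian: "brownian_motion M F B"
begin

lemma subalgebra_F: "0 \<le> t \<Longrightarrow> subalgebra M (F t)"
  using usual by (auto simp: usual_filtration_def)

lemma space_F [simp]: "0 \<le> t \<Longrightarrow> space (F t) = space M"
  using subalgebra_F by (auto simp: subalgebra_def)

lemma sets_F_mono: "0 \<le> s \<Longrightarrow> s \<le> t \<Longrightarrow> sets (F s) \<subseteq> sets (F t)"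
  using usual filtration.sets_F_mono[of "space M" "\<lambda>t. F (max 0 t)" s t]
  by (auto simp: usual_filtration_def max_def)

lemma measurable_F_mono:
  "f \<in> borel_measurable (F s) \<Longrightarrow> 0 \<le> s \<Longrightarrow> s \<le> t \<Longrightarrow> f \<in> borel_measurable (F t)"
  using sets_F_mono[of s t] by (auto simp: measurable_def)

lemma measurable_F_M:
  "f \<in> borel_measurable (F s) \<Longrightarrow> 0 \<le> s \<Longrightarrow> f \<in> borel_measurable M"
  using measurable_from_subalg[OF subalgebra_F] by blast

lemma measurable_B: "0 \<le> s \<Longrightarrow> B s \<in> borel_measurable (F s)"
  using brownian by (auto simp: brownian_motion_def adapted_def)

lemma measurable_B_M: "0 \<le> s \<Longrightarrow> B s \<in> borel_measurable M"
  using measurable_B measurable_F_M by blast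

text \<open>Independence is inherited by smaller families: \<open>h\<close> generates a part of
  \<open>F s\<close>, and a Borel function of the increment generates a part of the preimage family
  that \<open>brownian_motion\<close> makes independent of \<open>F s\<close>.\<close>

lemma indep_var_increment:
  fixes h :: "'a \<Rightarrow> real" and \<phi> :: "real^'m \<Rightarrow> real"
  assumes st: "0 \<le> s" "s < t" and h: "h \<in> borel_measurable (F s)" and \<phi>: "\<phi> \<in> borel_measurable borel"
  shows "indep_var borel h borel (\<lambda>\<omega>. \<phi> (B t \<omega> - B s \<omega>))"
proof -
  let ?I = "{(\<lambda>\<omega>. B t \<omega> - B s \<omega>) -` A \<inter> space M | A. A \<in> sets borel}"
  have indep: "indep_set (sets (F s)) ?I"
    using brownian st by (auto simp: brownian_motion_def)
  have [measurable]: "h \<in> borel_measurable M" "B s \<in> borel_measurable M" "B t \<in> borel_measurable M"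
    using measurable_F_M h st measurable_B_M by auto
  have 1: "sigma_sets (space M) {h -` A \<inter> space M |A. A \<in> sets borel} \<subseteq> sets (F s)"
  proof -
    have "{h -` A \<inter> space M |A. A \<in> sets borel} \<subseteq> sets (F s)"
      using measurable_sets[OF h] st by auto
    then show ?thesis using sets.sigma_sets_subset[of _ "F s"] st by auto
  qed
  have 2: "sigma_sets (space M) {(\<lambda>\<omega>. \<phi> (B t \<omega> - B s \<omega>)) -` A \<inter> space M |A. A \<in> sets borel} \<subseteq> ?I"
  proof -
    \<comment> \<open>The family \<open>?I\<close> is itself a sigma-algebra, being a preimage
      algebra, so closing a subfamily under sigma-operations stays inside it.\<close>
    have eq: "sets (vimage_algebra (space M) (\<lambda>\<omega>. B t \<omega> - B s \<omega>) borel) = ?I"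
      by (rule sets_vimage_algebra2) auto
    have "{(\<lambda>\<omega>. \<phi> (B t \<omega> - B s \<omega>)) -` A \<inter> space M |A. A \<in> sets borel} \<subseteq> ?I"
    proof safe
      fix A :: "real set" assume "A \<in> sets borel"
      then have "\<phi> -` A \<in> sets borel" using measurable_sets[OF \<phi>, of A] by simp
      then show "\<exists>A'. (\<lambda>\<omega>. \<phi> (B t \<omega> - B s \<omega>)) -` A \<inter> space M =
          (\<lambda>\<omega>. B t \<omega> - B s \<omega>) -` A' \<inter> space M \<and> A' \<in> sets borel"
        by (intro exI[of _ "\<phi> -` A"]) auto
    qed
    then show ?thesis
      unfolding eq[symmetric]
      using sets.sigma_sets_subset[of _ "vimage_algebra (space M) (\<lambda>\<omega>. B t \<omega> - B s \<omega>) borel"] by simp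
  qed
  have "indep_set (sigma_sets (space M) {h -` A \<inter> space M |A. A \<in> sets borel})
     (sigma_sets (space M) {(\<lambda>\<omega>. \<phi> (B t \<omega> - B s \<omega>)) -` A \<inter> space M |A. A \<in> sets borel})"
    using indep 1 2 unfolding indep_set_def
    by (rule_tac indep_sets_mono_sets[of _ UNIV]) (auto split: bool.split)
  then show ?thesis
    unfolding indep_var_eq using \<phi> by auto
qed

lemma increment_moments:
  assumes st: "0 \<le> s" "s < t"
  shows "integrable M (\<lambda>\<omega>. (B t \<omega> - B s \<omega>) $ k)"
    and "expectation (\<lambda>\<omega>. (B t \<omega> - B s \<omega>) $ k) = 0"
    and "integrable M (\<lambda>\<omega>. (B t \<omega> - B s \<omega>) $ k * (B t \<omega> - B s \<omega>) $ l)"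
    and "expectation (\<lambda>\<omega>. (B t \<omega> - B s \<omega>) $ k * (B t \<omega> - B s \<omega>) $ l) = (if k = l then t - s else 0)"
proof -
  let ?D = "\<lambda>k \<omega>. (B t \<omega> - B s \<omega>) $ k"
  have dist: "distributed M lborel (?D k) (normal_density 0 (sqrt (t - s)))" for k
    using brownian st by (auto simp: brownian_motion_def)
  have ind: "indep_vars (\<lambda>_. borel) ?D UNIV"
    using brownian st by (auto simp: brownian_motion_def)
  have pos: "sqrt (t - s) > 0" using st by simp
  show i1: "integrable M (?D k)" for k
    using distributed_integrable[OF dist[of k], of "\<lambda>x. x"] integrable_normal_moment_nz_1[OF pos]
    by simp
  show e1: "expectation (?D k) = 0" for k
    using normal_distributed_expectation[OF pos dist[of k]] by simp
  have i2: "integrable M (\<lambda>\<omega>. (?D k \<omega>)\<^sup>2)" for k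
    using distributed_integrable[OF dist[of k], of "\<lambda>x. x^2"] integrable_normal_moment[OF pos, of 0 2]
    by simp
  have e2: "expectation (\<lambda>\<omega>. (?D k \<omega>)\<^sup>2) = t - s" for k
    using normal_distributed_variance[OF pos dist[of k]] st e1[of k] by simp
  \<comment> \<open>Pairwise independence is read off the library fact about one variable against a
    sum of others, with the sum over the single index \<open>l\<close>.\<close>
  have iv: "indep_var borel (?D k) borel (?D l)" if "k \<noteq> l" for k l
    using indep_vars_sum[of "{l}" k ?D] indep_vars_subset[OF ind, of "{k,l}"] that by simp
  show "integrable M (\<lambda>\<omega>. ?D k \<omega> * ?D l \<omega>)"
    using i2[of k] indep_var_integrable[OF iv i1 i1, of k l]
    by (cases "k = l") (auto simp: power2_eq_square)
  show "expectation (\<lambda>\<omega>. ?D k \<omega> * ?D l \<omega>) = (if k = l then t - s else 0)"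
    using e2[of k] indep_var_lebesgue_integral[OF iv i1 i1, of k l] e1
    by (cases "k = l") (auto simp: power2_eq_square)
qed

text \<open>The martingale property and the Ito isometry on one interval, in coordinates. All
  expectations of simple integrals below are finite sums of these products, with \<open>h\<close>
  collecting every factor known at time \<open>s\<close>.\<close>

lemma expectation_times_increment:
  assumes st: "0 \<le> s" "s < t" and h: "h \<in> borel_measurable (F s)" "integrable M h"
  shows "integrable M (\<lambda>\<omega>. h \<omega> * (B t \<omega> - B s \<omega>) $ k)"
    and "expectation (\<lambda>\<omega>. h \<omega> * (B t \<omega> - B s \<omega>) $ k) = 0"
    and "integrable M (\<lambda>\<omega>. h \<omega> * ((B t \<omega> - B s \<omega>) $ k * (B t \<omega> - B s \<omega>) $ l))"
    and "expectation (\<lambda>\<omega>. h \<omega> * ((B t \<omega> - B s \<omega>) $ k * (B t \<omega> - B s \<omega>) $ l))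
           = expectation h * (if k = l then t - s else 0)"
proof -
  have m1: "(\<lambda>v::real^'m. v $ k) \<in> borel_measurable borel" by simp
  have m2: "(\<lambda>v::real^'m. v $ k * v $ l) \<in> borel_measurable borel" by simp
  note 1 = indep_var_increment[OF st h(1) m1] and 2 = indep_var_increment[OF st h(1) m2]
  note m = increment_moments[OF st]
  show "integrable M (\<lambda>\<omega>. h \<omega> * (B t \<omega> - B s \<omega>) $ k)"
    by (rule indep_var_integrable[OF 1 h(2) m(1)])
  show "expectation (\<lambda>\<omega>. h \<omega> * (B t \<omega> - B s \<omega>) $ k) = 0"
    using indep_var_lebesgue_integral[OF 1 h(2) m(1)] m(2)[of k] by simp
  show "integrable M (\<lambda>\<omega>. h \<omega> * ((B t \<omega> - B s \<omega>) $ k * (B t \<omega> - B s \<omega>) $ l))"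
    by (rule indep_var_integrable[OF 2 h(2) m(3)])
  show "expectation (\<lambda>\<omega>. h \<omega> * ((B t \<omega> - B s \<omega>) $ k * (B t \<omega> - B s \<omega>) $ l))
           = expectation h * (if k = l then t - s else 0)"
    using indep_var_lebesgue_integral[OF 2 h(2) m(3)] m(4)[of k l] by simp
qed

end

section \<open>Simple integrals\<close>

text \<open>Projecting the step times onto \<open>[s, t]\<close> lets an increment over
  \<open>[s, t]\<close> keep all \<open>k\<close> summands, with those of steps outside collapsing
  to zero. Thus \<open>s\<close> and \<open>t\<close> need not be step times.\<close>

definition clip_time :: "real \<Rightarrow> real \<Rightarrow> real \<Rightarrow> real" where
  "clip_time s t u = max s (min t u)"

text \<open>The last claim secures adaptedness: a step that meets \<open>[s, t]\<close> in a
  nondegenerate interval starts no later than its projected left end, so its value is already known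
  there.\<close>

lemma clip_time_simps:
  assumes "s \<le> t"
  shows "s \<le> clip_time s t u" "clip_time s t u \<le> t" "u \<le> v \<Longrightarrow> clip_time s t u \<le> clip_time s t v"
    "clip_time s t u < clip_time s t v \<Longrightarrow> u \<le> clip_time s t u"
  using assms by (auto simp: clip_time_def min_def max_def split: if_splits)

text \<open>The time integral of the squared norm of the simple process over \<open>[s, t]\<close>,
  written as a finite sum so that measurability and bounds are immediate;
  \<open>simple_energy_eq_integral\<close> gives the integral form.\<close>

definition simple_energy ::
    "nat \<Rightarrow> (nat \<Rightarrow> real) \<Rightarrow> (nat \<Rightarrow> 'a \<Rightarrow> real^'m^'d) \<Rightarrow> real \<Rightarrow> real \<Rightarrow> 'a \<Rightarrow> real" where
  "simple_energy k \<tau> \<xi> s t \<omega> =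
     (\<Sum>i<k. (norm (\<xi> i \<omega>))\<^sup>2 * (clip_time s t (\<tau> (Suc i)) - clip_time s t (\<tau> i)))"

text \<open>Up to the constant \<open>B s\<close>, stopping a step time at \<open>t\<close> is
  stopping it at \<open>s\<close> plus moving along its projection to \<open>[s, t]\<close>. The
  constants cancel between the two ends of a step.\<close>

lemma simple_ito_integral_diff:
  assumes "s \<le> t"
  shows "simple_ito_integral B k \<tau> \<xi> t \<omega> - simple_ito_integral B k \<tau> \<xi> s \<omega> =
    (\<Sum>i<k. \<xi> i \<omega> *v (B (clip_time s t (\<tau> (Suc i))) \<omega> - B (clip_time s t (\<tau> i)) \<omega>))"
proof -
  have *: "B (min t u) \<omega> = B (clip_time s t u) \<omega> - B s \<omega> + B (min s u) \<omega>" for u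
    using assms by (auto simp: clip_time_def min_def max_def)
  have "B (min t u) \<omega> - B (min t v) \<omega> - (B (min s u) \<omega> - B (min s v) \<omega>) =
      B (clip_time s t u) \<omega> - B (clip_time s t v) \<omega>" for u v
    unfolding *[of u] *[of v] by simp
  then show ?thesis
    unfolding simple_ito_integral_def
    by (simp flip: sum_subtractf matrix_vector_mult_diff_distrib)
qed

lemma inner_matrix_vector_expand:
  fixes A :: "real^'m^'d"
  shows "y \<bullet> (A *v x) = (\<Sum>r\<in>UNIV. \<Sum>k\<in>UNIV. (y $ r * A $ r $ k) * x $ k)"
  by (simp add: inner_vec_def matrix_vector_mult_def sum_distrib_left mult.assoc)

lemma norm_matrix_vector_power2_expand:
  fixes A :: "real^'m^'d"
  shows "(norm (A *v x))\<^sup>2 =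
    (\<Sum>r\<in>UNIV. \<Sum>k\<in>UNIV. \<Sum>l\<in>UNIV. (A $ r $ k * A $ r $ l) * (x $ k * x $ l))"
  unfolding power2_norm_eq_inner inner_vec_def matrix_vector_mult_def
  by (simp add: sum_product mult.assoc mult.left_commute)

lemma norm_matrix_power2_expand:
  fixes A :: "real^'m^'d"
  shows "(norm A)\<^sup>2 = (\<Sum>r\<in>UNIV. \<Sum>k\<in>UNIV. A $ r $ k * A $ r $ k)"
  unfolding power2_norm_eq_inner inner_vec_def by simp

lemma abs_matrix_component_le: "\<bar>(A :: real^'m^'d) $ r $ k\<bar> \<le> norm A"
  using order_trans[OF component_le_norm_cart[of "A $ r" k] Finite_Cartesian_Product.norm_nth_le[of A r]]
  by simp

context brownian_setup
begin

lemma integrable_bounded_mult: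
  fixes f g :: "'a \<Rightarrow> real"
  assumes "integrable M f" "g \<in> borel_measurable M" "\<And>\<omega>. \<omega> \<in> space M \<Longrightarrow> \<bar>g \<omega>\<bar> \<le> K"
  shows "integrable M (\<lambda>\<omega>. g \<omega> * f \<omega>)"
proof (rule Bochner_Integration.integrable_bound[of _ "\<lambda>\<omega>. K * f \<omega>"])
  show "AE \<omega> in M. norm (g \<omega> * f \<omega>) \<le> norm (K * f \<omega>)"
  proof (rule AE_I2)
    fix \<omega> assume "\<omega> \<in> space M"
    then have "\<bar>g \<omega>\<bar> \<le> \<bar>K\<bar>" using assms(3) by fastforce
    then show "norm (g \<omega> * f \<omega>) \<le> norm (K * f \<omega>)"
      by (simp add: abs_mult mult_right_mono)
  qed
qed (use assms in auto)

lemma integrable_bounded: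
  fixes g :: "'a \<Rightarrow> real"
  assumes "g \<in> borel_measurable M" "\<And>\<omega>. \<omega> \<in> space M \<Longrightarrow> \<bar>g \<omega>\<bar> \<le> K"
  shows "integrable M g"
  using integrable_bounded_mult[of "\<lambda>_. 1" g K] assms by simp

text \<open>Measurability of \<xi> at \<open>u\<close> is required only for \<open>u < v\<close>: a
  step that has collapsed under projection may carry a value known only later, and its increment is
  zero. The weight \<zeta> in the isometry is there for the cutoff, the vector \<eta> for the cutoff
  times the current value.\<close>

lemma matrix_increment:
  fixes \<xi> :: "'a \<Rightarrow> real^'m^'d" and u v :: real and \<eta> :: "'a \<Rightarrow> real^'d" and \<zeta> :: "'a \<Rightarrow> real"
  assumes uv: "0 \<le> u" "u \<le> v"
    and \<xi>: "u < v \<Longrightarrow> \<xi> \<in> borel_measurable (F u)" "\<And>\<omega>. \<omega> \<in> space M \<Longrightarrow> norm (\<xi> \<omega>) \<le> K"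
    and \<eta>: "\<eta> \<in> borel_measurable (F u)" "integrable M (\<lambda>\<omega>. norm (\<eta> \<omega>))"
    and \<zeta>: "\<zeta> \<in> borel_measurable (F u)" "\<And>\<omega>. \<omega> \<in> space M \<Longrightarrow> \<bar>\<zeta> \<omega>\<bar> \<le> L"
  defines "D \<equiv> \<lambda>\<omega>. \<xi> \<omega> *v (B v \<omega> - B u \<omega>)"
  shows "D \<in> borel_measurable (F v)"
    and "integrable M (\<lambda>\<omega>. \<eta> \<omega> \<bullet> D \<omega>)" and "expectation (\<lambda>\<omega>. \<eta> \<omega> \<bullet> D \<omega>) = 0"
    and "integrable M (\<lambda>\<omega>. (norm (D \<omega>))\<^sup>2)"
    and "expectation (\<lambda>\<omega>. \<zeta> \<omega> * (norm (D \<omega>))\<^sup>2) = expectation (\<lambda>\<omega>. \<zeta> \<omega> * ((norm (\<xi> \<omega>))\<^sup>2 * (v - u)))"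
proof -
  have "D \<in> borel_measurable (F v) \<and>
    (integrable M (\<lambda>\<omega>. \<eta> \<omega> \<bullet> D \<omega>) \<and> expectation (\<lambda>\<omega>. \<eta> \<omega> \<bullet> D \<omega>) = 0) \<and>
    integrable M (\<lambda>\<omega>. (norm (D \<omega>))\<^sup>2) \<and>
    expectation (\<lambda>\<omega>. \<zeta> \<omega> * (norm (D \<omega>))\<^sup>2) = expectation (\<lambda>\<omega>. \<zeta> \<omega> * ((norm (\<xi> \<omega>))\<^sup>2 * (v - u)))"
  proof (cases "u < v")
    case False
    then have "D = (\<lambda>\<omega>. 0)" "v = u" using uv by (auto simp: D_def)
    then show ?thesis by simp
  next
    case True
    note m\<xi> = \<xi>(1)[OF True]
    have K: "\<bar>\<xi> \<omega> $ r $ k\<bar> \<le> K" if "\<omega> \<in> space M" for \<omega> r k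
      using abs_matrix_component_le \<xi>(2)[OF that] order_trans by blast
    have [measurable]: "\<xi> \<in> borel_measurable (F u)" "\<eta> \<in> borel_measurable (F u)" "\<zeta> \<in> borel_measurable (F u)"
      by (fact m\<xi> \<eta>(1) \<zeta>(1))+
    have [measurable]: "\<xi> \<in> borel_measurable M" "\<eta> \<in> borel_measurable M" "\<zeta> \<in> borel_measurable M"
      by (fact measurable_F_M[OF m\<xi> uv(1)] measurable_F_M[OF \<eta>(1) uv(1)] measurable_F_M[OF \<zeta>(1) uv(1)])+
    have c1: "(\<lambda>A::real^'m^'d. A $ r $ k) \<in> borel_measurable borel" for r k
      by (intro borel_measurable_continuous_onI continuous_intros)
    have c2: "(\<lambda>y::real^'d. y $ r) \<in> borel_measurable borel" for r
      by (intro borel_measurable_continuous_onI continuous_intros)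
    note [measurable] = measurable_compose[OF _ c1] measurable_compose[OF _ c2]
    have f1: "D \<in> borel_measurable (F v)"
    proof -
      have [measurable]: "\<xi> \<in> borel_measurable (F v)" "B u \<in> borel_measurable (F v)" "B v \<in> borel_measurable (F v)"
        by (fact measurable_F_mono[OF m\<xi> uv] measurable_F_mono[OF measurable_B[OF uv(1)] uv]
              measurable_B[OF order_trans[OF uv]])+
      have "continuous_on UNIV (\<lambda>p :: (real^'m^'d) \<times> (real^'m). fst p *v snd p)"
        unfolding matrix_vector_mult_def by (intro continuous_intros)
      then have c3: "(\<lambda>p :: (real^'m^'d) \<times> (real^'m). fst p *v snd p) \<in> borel_measurable borel"
        by (rule borel_measurable_continuous_onI)
      have "(\<lambda>\<omega>. (\<xi> \<omega>, B v \<omega> - B u \<omega>)) \<in> borel_measurable (F v)"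
        by measurable
      from measurable_compose[OF this c3] show ?thesis by (simp add: D_def)
    qed
    have int1: "integrable M (\<lambda>\<omega>. \<eta> \<omega> $ r * \<xi> \<omega> $ r $ k)" for r k
    proof -
      have "integrable M (\<lambda>\<omega>. \<eta> \<omega> $ r)"
        by (rule Bochner_Integration.integrable_bound[OF \<eta>(2)]) (auto simp: component_le_norm_cart)
      from integrable_bounded_mult[OF this, of "\<lambda>\<omega>. \<xi> \<omega> $ r $ k" K] K
      show ?thesis by (simp add: mult.commute)
    qed
    have f2: "integrable M (\<lambda>\<omega>. \<eta> \<omega> \<bullet> D \<omega>) \<and> expectation (\<lambda>\<omega>. \<eta> \<omega> \<bullet> D \<omega>) = 0"
    proof -
      note e = expectation_times_increment(1,2)[OF uv(1) True _ int1]
      have m: "(\<lambda>\<omega>. \<eta> \<omega> $ r * \<xi> \<omega> $ r $ k) \<in> borel_measurable (F u)" for r k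
        by measurable
      show ?thesis
        unfolding D_def inner_matrix_vector_expand
        by (simp add: Bochner_Integration.integral_sum Bochner_Integration.integrable_sum e[OF m]
              del: vector_minus_component)
    qed
    have int2: "integrable M (\<lambda>\<omega>. \<xi> \<omega> $ r $ k * \<xi> \<omega> $ r $ l)" for r k l
    proof (rule integrable_bounded[where K = "K * K"])
      fix \<omega> assume "\<omega> \<in> space M"
      then show "\<bar>\<xi> \<omega> $ r $ k * \<xi> \<omega> $ r $ l\<bar> \<le> K * K"
        unfolding abs_mult by (intro mult_mono K order_trans[OF abs_ge_zero K])  auto
    qed auto
    have int3: "integrable M (\<lambda>\<omega>. \<zeta> \<omega> * (\<xi> \<omega> $ r $ k * \<xi> \<omega> $ r $ l))" for r k l
      using integrable_bounded_mult[OF int2 _ \<zeta>(2)] by auto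
    have m2: "(\<lambda>\<omega>. \<xi> \<omega> $ r $ k * \<xi> \<omega> $ r $ l) \<in> borel_measurable (F u)" for r k l
      by measurable
    have m3: "(\<lambda>\<omega>. \<zeta> \<omega> * (\<xi> \<omega> $ r $ k * \<xi> \<omega> $ r $ l)) \<in> borel_measurable (F u)" for r k l
      by measurable
    note e2 = expectation_times_increment(3,4)[OF uv(1) True m2 int2]
    note e3 = expectation_times_increment(3,4)[OF uv(1) True m3 int3]
    have f3: "integrable M (\<lambda>\<omega>. (norm (D \<omega>))\<^sup>2)"
      unfolding D_def norm_matrix_vector_power2_expand
      by (intro Bochner_Integration.integrable_sum e2)
    have "expectation (\<lambda>\<omega>. \<zeta> \<omega> * (norm (D \<omega>))\<^sup>2) =
       expectation (\<lambda>\<omega>. \<Sum>r\<in>UNIV. \<Sum>k\<in>UNIV. \<Sum>l\<in>UNIV.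
         (\<zeta> \<omega> * (\<xi> \<omega> $ r $ k * \<xi> \<omega> $ r $ l)) * ((B v \<omega> - B u \<omega>) $ k * (B v \<omega> - B u \<omega>) $ l))"
      unfolding D_def norm_matrix_vector_power2_expand
      by (simp only: sum_distrib_left mult.assoc)
    also have "\<dots> = (\<Sum>r\<in>UNIV. \<Sum>k\<in>UNIV. \<Sum>l\<in>UNIV.
        expectation (\<lambda>\<omega>. (\<zeta> \<omega> * (\<xi> \<omega> $ r $ k * \<xi> \<omega> $ r $ l)) * ((B v \<omega> - B u \<omega>) $ k * (B v \<omega> - B u \<omega>) $ l)))"
      by (simp add: Bochner_Integration.integral_sum Bochner_Integration.integrable_sum e3(1)
            del: vector_minus_component)
    also have "\<dots> = (\<Sum>r\<in>UNIV. \<Sum>k\<in>UNIV. expectation (\<lambda>\<omega>. \<zeta> \<omega> * (\<xi> \<omega> $ r $ k * \<xi> \<omega> $ r $ k)) * (v - u))"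
      unfolding e3(2) by (simp add: if_distrib cong: if_cong)
    also have "\<dots> = (\<Sum>r\<in>UNIV. \<Sum>k\<in>UNIV. expectation (\<lambda>\<omega>. \<zeta> \<omega> * (\<xi> \<omega> $ r $ k * \<xi> \<omega> $ r $ k) * (v - u)))"
      by simp
    also have "\<dots> = expectation (\<lambda>\<omega>. \<Sum>r\<in>UNIV. \<Sum>k\<in>UNIV. \<zeta> \<omega> * (\<xi> \<omega> $ r $ k * \<xi> \<omega> $ r $ k) * (v - u))"
      by (simp add: Bochner_Integration.integral_sum Bochner_Integration.integrable_sum int3
          del: integral_mult_left_zero)
    also have "\<dots> = expectation (\<lambda>\<omega>. \<zeta> \<omega> * ((norm (\<xi> \<omega>))\<^sup>2 * (v - u)))"
      unfolding norm_matrix_power2_expand by (simp only: sum_distrib_left sum_distrib_right mult.assoc)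
    finally have f4: "expectation (\<lambda>\<omega>. \<zeta> \<omega> * (norm (D \<omega>))\<^sup>2) =
        expectation (\<lambda>\<omega>. \<zeta> \<omega> * ((norm (\<xi> \<omega>))\<^sup>2 * (v - u)))" .
    show ?thesis using f1 f2 f3 f4 by blast
  qed
  then show "D \<in> borel_measurable (F v)"
    and "integrable M (\<lambda>\<omega>. \<eta> \<omega> \<bullet> D \<omega>)" and "expectation (\<lambda>\<omega>. \<eta> \<omega> \<bullet> D \<omega>) = 0"
    and "integrable M (\<lambda>\<omega>. (norm (D \<omega>))\<^sup>2)"
    and "expectation (\<lambda>\<omega>. \<zeta> \<omega> * (norm (D \<omega>))\<^sup>2) = expectation (\<lambda>\<omega>. \<zeta> \<omega> * ((norm (\<xi> \<omega>))\<^sup>2 * (v - u)))"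
    by auto
qed


text \<open>Orthogonality of the steps: expanding the square of the sum leaves only the diagonal,
  because an earlier step is known when a later one begins. The weight \<zeta> is known at
  \<open>s\<close> and passes through unchanged.\<close>

lemma simple_ito_increment:
  fixes \<xi> :: "nat \<Rightarrow> 'a \<Rightarrow> real^'m^'d" and \<eta> :: "'a \<Rightarrow> real^'d" and \<zeta> :: "'a \<Rightarrow> real"
  assumes si: "simple_integrand M F k \<tau> \<xi>" and st: "0 \<le> s" "s \<le> t"
    and \<eta>: "\<eta> \<in> borel_measurable (F s)" "integrable M (\<lambda>\<omega>. norm (\<eta> \<omega>))"
    and \<zeta>: "\<zeta> \<in> borel_measurable (F s)" "\<And>\<omega>. \<omega> \<in> space M \<Longrightarrow> \<bar>\<zeta> \<omega>\<bar> \<le> L"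
  defines "J \<equiv> \<lambda>\<omega>. simple_ito_integral B k \<tau> \<xi> t \<omega> - simple_ito_integral B k \<tau> \<xi> s \<omega>"
  shows "J \<in> borel_measurable (F t)"
    and "integrable M (\<lambda>\<omega>. \<eta> \<omega> \<bullet> J \<omega>)" and "expectation (\<lambda>\<omega>. \<eta> \<omega> \<bullet> J \<omega>) = 0"
    and "integrable M (\<lambda>\<omega>. (norm (J \<omega>))\<^sup>2)"
    and "expectation (\<lambda>\<omega>. \<zeta> \<omega> * (norm (J \<omega>))\<^sup>2) = expectation (\<lambda>\<omega>. \<zeta> \<omega> * simple_energy k \<tau> \<xi> s t \<omega>)"
    and "simple_energy k \<tau> \<xi> s t \<in> borel_measurable (F t)"
proof -
  define u where "u i = clip_time s t (\<tau> i)" for i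
  define D where "D i \<omega> = \<xi> i \<omega> *v (B (u (Suc i)) \<omega> - B (u i) \<omega>)" for i \<omega>
  have J: "J = (\<lambda>\<omega>. \<Sum>i<k. D i \<omega>)"
    unfolding J_def simple_ito_integral_diff[OF st(2)] D_def u_def ..
  have \<tau>: "0 \<le> \<tau> 0" "\<And>i. i < k \<Longrightarrow> \<tau> i < \<tau> (Suc i)"
    and \<xi>: "\<And>i. i < k \<Longrightarrow> \<xi> i \<in> borel_measurable (F (\<tau> i))"
    "\<exists>K. \<forall>i<k. \<forall>\<omega>\<in>space M. norm (\<xi> i \<omega>) \<le> K i"
    using si unfolding simple_integrand_def by metis+
  obtain K where K: "\<And>i \<omega>. i < k \<Longrightarrow> \<omega> \<in> space M \<Longrightarrow> norm (\<xi> i \<omega>) \<le> K i" using \<xi>(2) by blast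
  have \<tau>0: "0 \<le> \<tau> i" if "i \<le> k" for i
    using that
  proof (induction i)
    case (Suc i)
    then show ?case using \<tau>(2)[of i] by simp
  qed (use \<tau>(1) in simp)
  have su: "s \<le> u i" "u i \<le> t" for i using clip_time_simps[OF st(2)] by (auto simp: u_def)
  have u0: "0 \<le> u i" for i using su st by (meson order_trans)
  have usuc: "u i \<le> u (Suc i)" if "i < k" for i
    using \<tau>(2)[OF that] clip_time_simps(3)[OF st(2)] by (simp add: u_def)
  have umono: "u i \<le> u j" if "i \<le> j" "j \<le> k" for i j
    using that
  proof (induction j rule: dec_induct)
    case (step n)
    then show ?case using usuc[of n] by simp
  qed simp
  have m\<xi>: "\<xi> i \<in> borel_measurable (F (u i))" if "i < k" "u i < u (Suc i)" for i
    using measurable_F_mono[OF \<xi>(1)[OF that(1)] \<tau>0] that clip_time_simps(4)[OF st(2)] by (simp add: u_def)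
  have \<eta>M: "\<eta> \<in> borel_measurable (F (u i))" and \<zeta>M: "\<zeta> \<in> borel_measurable (F (u i))" for i
    using measurable_F_mono[OF \<eta>(1) st(1) su(1)] measurable_F_mono[OF \<zeta>(1) st(1) su(1)] by auto
  note inc = matrix_increment[OF u0 usuc m\<xi> K _ _ \<zeta>M \<zeta>(2)]
  have inc1: "D i \<in> borel_measurable (F (u (Suc i)))" if "i < k" for i
    unfolding D_def by (rule inc(1)[OF that that _ that _ \<eta>M \<eta>(2)])
  have inc4: "integrable M (\<lambda>\<omega>. (norm (D i \<omega>))\<^sup>2)" 
    and inc5: "expectation (\<lambda>\<omega>. \<zeta> \<omega> * (norm (D i \<omega>))\<^sup>2) =
      expectation (\<lambda>\<omega>. \<zeta> \<omega> * ((norm (\<xi> i \<omega>))\<^sup>2 * (u (Suc i) - u i)))" if "i < k" for i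
    unfolding D_def using inc(4,5)[OF that that _ that _ \<eta>M \<eta>(2)] by blast+
  have inc23: "integrable M (\<lambda>\<omega>. \<eta>' \<omega> \<bullet> D i \<omega>)" "expectation (\<lambda>\<omega>. \<eta>' \<omega> \<bullet> D i \<omega>) = 0"
    if "i < k" "\<eta>' \<in> borel_measurable (F (u i))" "integrable M (\<lambda>\<omega>. norm (\<eta>' \<omega>))" for i \<eta>'
    unfolding D_def using inc(2,3)[OF that(1,1) _ that(1) _ that(2,3)] by blast+
  show mJ: "J \<in> borel_measurable (F t)"
    unfolding J using measurable_F_mono[OF inc1 u0 su(2)] by auto
  show "integrable M (\<lambda>\<omega>. \<eta> \<omega> \<bullet> J \<omega>)" "expectation (\<lambda>\<omega>. \<eta> \<omega> \<bullet> J \<omega>) = 0"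
    unfolding J inner_sum_right using inc23[OF _ \<eta>M \<eta>(2)]
    by (auto simp: Bochner_Integration.integral_sum)
  have mD: "D i \<in> borel_measurable M" if "i < k" for i
    using measurable_F_M[OF inc1[OF that] u0] .
  have iD: "integrable M (\<lambda>\<omega>. norm (D i \<omega>))" if "i < k" for i
  proof (rule Bochner_Integration.integrable_bound)
    show "integrable M (\<lambda>\<omega>. 1 + (norm (D i \<omega>))\<^sup>2)" using inc4[OF that] by simp
    have "norm (D i \<omega>) \<le> 1 + (norm (D i \<omega>))\<^sup>2" for \<omega>
      using sum_squares_bound[of 1 "norm (D i \<omega>)"] by (simp add: power2_eq_square) (smt (verit) norm_ge_zero)
    then show "AE \<omega> in M. norm (norm (D i \<omega>)) \<le> norm (1 + (norm (D i \<omega>))\<^sup>2)" by simp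
  qed (use mD[OF that] in auto)
  \<comment> \<open>For \<open>i < j\<close> the vector \<open>\<zeta>' D i\<close> is known at
    \<open>u j\<close> and integrable, so it is an admissible \<eta> for step \<open>j\<close>. The
    weight is kept generic because \<open>\<zeta>' = 1\<close> yields integrability of the square
    and \<open>\<zeta>' = \<zeta>\<close> the isometry.\<close>
  have cross: "integrable M (\<lambda>\<omega>. \<zeta>' \<omega> * (D i \<omega> \<bullet> D j \<omega>))"
    "expectation (\<lambda>\<omega>. \<zeta>' \<omega> * (D i \<omega> \<bullet> D j \<omega>)) = 0"
    if "i < j" "j < k" and \<zeta>': "\<zeta>' \<in> borel_measurable (F s)" "\<And>\<omega>. \<omega> \<in> space M \<Longrightarrow> \<bar>\<zeta>' \<omega>\<bar> \<le> L'" for i j \<zeta>' L'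
  proof -
    have "i < k" using that by simp
    have 1: "(\<lambda>\<omega>. \<zeta>' \<omega> *\<^sub>R D i \<omega>) \<in> borel_measurable (F (u j))"
      using measurable_F_mono[OF inc1[OF \<open>i < k\<close>] u0 umono, of j] that
        measurable_F_mono[OF \<zeta>'(1) st(1) su(1), of j] by auto
    have 2: "integrable M (\<lambda>\<omega>. norm (\<zeta>' \<omega> *\<^sub>R D i \<omega>))"
      using integrable_bounded_mult[OF iD[OF \<open>i < k\<close>], of "\<lambda>\<omega>. \<bar>\<zeta>' \<omega>\<bar>" L']
        measurable_F_M[OF \<zeta>'(1) st(1)] \<zeta>'(2) by auto
    show "integrable M (\<lambda>\<omega>. \<zeta>' \<omega> * (D i \<omega> \<bullet> D j \<omega>))"
      "expectation (\<lambda>\<omega>. \<zeta>' \<omega> * (D i \<omega> \<bullet> D j \<omega>)) = 0"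
      using inc23[OF that(2) 1 2] by auto
  qed
  have int: "integrable M (\<lambda>\<omega>. \<zeta>' \<omega> * (D i \<omega> \<bullet> D j \<omega>))"
    if "i < k" "j < k" and \<zeta>': "\<zeta>' \<in> borel_measurable (F s)" "\<And>\<omega>. \<omega> \<in> space M \<Longrightarrow> \<bar>\<zeta>' \<omega>\<bar> \<le> L'" for i j \<zeta>' L'
  proof -
    consider "i < j" | "j < i" | "i = j" by linarith
    then show ?thesis
    proof cases
      case 1 show ?thesis using cross(1)[OF 1 that(2) \<zeta>'] .
    next
      case 2 show ?thesis using cross(1)[OF 2 that(1) \<zeta>'] by (simp add: inner_commute)
    next
      case 3 show ?thesis
        using integrable_bounded_mult[OF inc4[OF that(1)] measurable_F_M[OF \<zeta>'(1) st(1)] \<zeta>'(2)] 3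
        by (simp add: power2_norm_eq_inner)
    qed
  qed
  have ev: "expectation (\<lambda>\<omega>. \<zeta> \<omega> * (D i \<omega> \<bullet> D j \<omega>)) =
      (if j = i then expectation (\<lambda>\<omega>. \<zeta> \<omega> * ((norm (\<xi> i \<omega>))\<^sup>2 * (u (Suc i) - u i))) else 0)"
    if "i < k" "j < k" for i j
  proof -
    consider "i < j" | "j < i" | "i = j" by linarith
    then show ?thesis
    proof cases
      case 1 then show ?thesis using cross(2)[OF 1 that(2) \<zeta>] by simp
    next
      case 2 then show ?thesis using cross(2)[OF 2 that(1) \<zeta>] by (simp add: inner_commute)
    next
      case 3 then show ?thesis using inc5[OF that(1)] by (simp add: power2_norm_eq_inner)
    qed
  qed
  have sq: "(norm (J \<omega>))\<^sup>2 = (\<Sum>i<k. \<Sum>j<k. D i \<omega> \<bullet> D j \<omega>)" for \<omega>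
    unfolding J power2_norm_eq_inner inner_sum_left inner_sum_right by (rule sum.swap)
  show "integrable M (\<lambda>\<omega>. (norm (J \<omega>))\<^sup>2)"
    unfolding sq using int[of _ _ "\<lambda>_. 1" 1] by (auto intro!: Bochner_Integration.integrable_sum)
  have mx: "\<xi> i \<in> borel_measurable M" if "i < k" for i
    using measurable_F_M[OF \<xi>(1)[OF that] \<tau>0] that by simp
  have ixi: "integrable M (\<lambda>\<omega>. \<zeta> \<omega> * ((norm (\<xi> i \<omega>))\<^sup>2 * (u (Suc i) - u i)))" if "i < k" for i
  proof -
    have "integrable M (\<lambda>\<omega>. (norm (\<xi> i \<omega>))\<^sup>2)"
      using K[OF that] mx[OF that] by (intro integrable_bounded[where K = "(K i)\<^sup>2"]) (auto simp: power_mono)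
    then show ?thesis
      using integrable_bounded_mult[OF _ measurable_F_M[OF \<zeta>(1) st(1)] \<zeta>(2)] by auto
  qed
  have "expectation (\<lambda>\<omega>. \<zeta> \<omega> * (norm (J \<omega>))\<^sup>2) =
      (\<Sum>i<k. \<Sum>j<k. expectation (\<lambda>\<omega>. \<zeta> \<omega> * (D i \<omega> \<bullet> D j \<omega>)))"
  proof -
    have 1: "integrable M (\<lambda>\<omega>. \<Sum>j<k. \<zeta> \<omega> * (D i \<omega> \<bullet> D j \<omega>))" if "i < k" for i
      using int[OF that _ \<zeta>] by (intro Bochner_Integration.integrable_sum) auto
    have 2: "expectation (\<lambda>\<omega>. \<Sum>j<k. \<zeta> \<omega> * (D i \<omega> \<bullet> D j \<omega>)) =
        (\<Sum>j<k. expectation (\<lambda>\<omega>. \<zeta> \<omega> * (D i \<omega> \<bullet> D j \<omega>)))" if "i < k" for i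
      using int[OF that _ \<zeta>] by (intro Bochner_Integration.integral_sum) auto
    show ?thesis
      unfolding sq sum_distrib_left using 1 2 by (subst Bochner_Integration.integral_sum) auto
  qed
  also have "\<dots> = (\<Sum>i<k. expectation (\<lambda>\<omega>. \<zeta> \<omega> * ((norm (\<xi> i \<omega>))\<^sup>2 * (u (Suc i) - u i))))"
    by (intro sum.cong refl) (simp add: ev)
  also have "\<dots> = expectation (\<lambda>\<omega>. \<zeta> \<omega> * simple_energy k \<tau> \<xi> s t \<omega>)"
    unfolding simple_energy_def sum_distrib_left u_def[symmetric] using ixi
    by (simp add: Bochner_Integration.integral_sum)
  finally show "expectation (\<lambda>\<omega>. \<zeta> \<omega> * (norm (J \<omega>))\<^sup>2) =
    expectation (\<lambda>\<omega>. \<zeta> \<omega> * simple_energy k \<tau> \<xi> s t \<omega>)" .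
  show "simple_energy k \<tau> \<xi> s t \<in> borel_measurable (F t)"
    unfolding simple_energy_def u_def[symmetric]
  proof (intro borel_measurable_sum)
    fix i assume i: "i \<in> {..<k}"
    show "(\<lambda>\<omega>. (norm (\<xi> i \<omega>))\<^sup>2 * (u (Suc i) - u i)) \<in> borel_measurable (F t)"
    proof (cases "u i < u (Suc i)")
      case True
      then show ?thesis using measurable_F_mono[OF m\<xi> u0 su(2), of i] i by auto
    next
      case False
      then show ?thesis using usuc[of i] i by simp
    qed
  qed
qed

end

section \<open>The discrete energy inequality\<close>

text \<open>A linear ramp instead of an indicator: it is continuous, so it commutes with limits of
  the cost even where the limit cost equals \<open>R\<close>. It is decreasing, vanishes from
  \<open>R\<close> on, and tends to 1 as \<open>R\<close> grows.\<close>

definition cutoff :: "real \<Rightarrow> real \<Rightarrow> real" where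
  "cutoff R u = max 0 (1 - u / R)"

lemma cutoff_nonneg: "0 \<le> cutoff R u"
  by (simp add: cutoff_def)

lemma cutoff_le_one: "0 < R \<Longrightarrow> 0 \<le> u \<Longrightarrow> cutoff R u \<le> 1"
  by (simp add: cutoff_def)

lemma cutoff_antimono: "0 < R \<Longrightarrow> u \<le> v \<Longrightarrow> cutoff R v \<le> cutoff R u"
  by (auto simp: cutoff_def divide_right_mono intro: max.coboundedI2)

lemma cutoff_eq_0: "0 < R \<Longrightarrow> R \<le> u \<Longrightarrow> cutoff R u = 0"
  by (simp add: cutoff_def)

text \<open>Since the weight is zero beyond \<open>R\<close>, the factor \<open>v\<close> has to be
  controlled only while \<open>u \<le> R\<close>. Most bounds in terms of \<open>R\<close> come from
  here.\<close>

lemma cutoff_times_le: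
  assumes "0 < R" "0 \<le> u" "0 \<le> v" "u \<le> R \<Longrightarrow> v \<le> K" "0 \<le> K"
  shows "cutoff R u * v \<le> K"
proof (cases "u \<le> R")
  case True
  have "cutoff R u * v \<le> 1 * v" using assms cutoff_le_one by (intro mult_right_mono) auto
  then show ?thesis using assms(4) True by simp
qed (use assms cutoff_eq_0[of R u] in auto)

lemma continuous_cutoff: "continuous_on UNIV (cutoff R)"
  unfolding cutoff_def divide_inverse by (intro continuous_intros)

lemma tendsto_cutoff: "(f \<longlongrightarrow> u) G \<Longrightarrow> ((\<lambda>x. cutoff R (f x)) \<longlongrightarrow> cutoff R u) G"
  unfolding cutoff_def divide_inverse by (intro tendsto_intros)

lemma borel_measurable_cutoff [measurable]: "cutoff R \<in> borel_measurable borel"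
  using borel_measurable_continuous_onI[OF continuous_cutoff] .

text \<open>The sums stop at \<open>j < i\<close>, hence involve only what has happened by grid time
  \<open>i\<close>: the last terms are the variation and the energy of the cell that ends there.
  This makes the weight at \<open>i\<close> adapted.\<close>

definition grid_cost ::
    "(nat \<Rightarrow> 'v::real_normed_vector) \<Rightarrow> (nat \<Rightarrow> 'v) \<Rightarrow> (nat \<Rightarrow> real) \<Rightarrow> nat \<Rightarrow> real" where
  "grid_cost Y A Q i =
     (\<Sum>j<i. norm (A (Suc j) - A j)) + (\<Sum>j<i. Q j) + Max ((\<lambda>j. norm (Y j)) ` {..i})"

lemma grid_cost_ge:
  assumes "\<And>j. 0 \<le> Q j"
  shows "norm (Y i) \<le> grid_cost Y A Q i" "(\<Sum>j<i. norm (A (Suc j) - A j)) \<le> grid_cost Y A Q i"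
    "(\<Sum>j<i. Q j) \<le> grid_cost Y A Q i" "0 \<le> grid_cost Y A Q i"
proof -
  have 1: "norm (Y i) \<le> Max ((\<lambda>j. norm (Y j)) ` {..i})" by (rule Max_ge) auto
  have 2: "0 \<le> (\<Sum>j<i. norm (A (Suc j) - A j))" "0 \<le> (\<Sum>j<i. Q j)"
    using assms by (auto intro: sum_nonneg)
  show "norm (Y i) \<le> grid_cost Y A Q i" "(\<Sum>j<i. norm (A (Suc j) - A j)) \<le> grid_cost Y A Q i"
    "(\<Sum>j<i. Q j) \<le> grid_cost Y A Q i" "0 \<le> grid_cost Y A Q i"
    using 1 2 order_trans[OF norm_ge_zero 1] unfolding grid_cost_def by linarith+
qed

lemma grid_cost_mono:
  assumes "\<And>j. 0 \<le> Q j" "i \<le> k"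
  shows "grid_cost Y A Q i \<le> grid_cost Y A Q k"
  unfolding grid_cost_def
  by (intro add_mono sum_mono2 Max_mono) (use assms in auto)

lemma (in prob_space) borel_measurable_grid_cost:
  assumes "\<And>j. j \<le> i \<Longrightarrow> (\<lambda>\<omega>. Y j \<omega>) \<in> borel_measurable N" "\<And>j. j \<le> i \<Longrightarrow> (\<lambda>\<omega>. A j \<omega>) \<in> borel_measurable N"
    "\<And>j. j < i \<Longrightarrow> (\<lambda>\<omega>. Q j \<omega>) \<in> borel_measurable N"
  shows "(\<lambda>\<omega>. grid_cost (\<lambda>j. Y j \<omega>) (\<lambda>j. A j \<omega> :: 'v::{real_normed_vector, second_countable_topology}) (\<lambda>j. Q j \<omega>) i) \<in> borel_measurable N"
  unfolding grid_cost_def using assms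
  by (intro borel_measurable_add borel_measurable_sum borel_measurable_Max
      borel_measurable_norm borel_measurable_diff) auto

lemma simple_energy_nonneg:
  assumes "s \<le> t" "\<And>i. i < k \<Longrightarrow> \<tau> i < \<tau> (Suc i)"
  shows "0 \<le> simple_energy k \<tau> \<xi> s t \<omega>"
  unfolding simple_energy_def
  by (intro sum_nonneg mult_nonneg_nonneg)
    (use assms clip_time_simps(3)[OF assms(1)] in \<open>auto simp: less_imp_le\<close>)

lemma simple_ito_integral_0:
  assumes "\<And>i. i \<le> k \<Longrightarrow> 0 \<le> \<tau> i"
  shows "simple_ito_integral B k \<tau> \<xi> 0 \<omega> = 0"
  unfolding simple_ito_integral_def using assms by (intro sum.neutral) (auto simp: min_def)

lemma norm_add_power2_eq:
  "(norm (x + y))\<^sup>2 = (norm x)\<^sup>2 + 2 * (x \<bullet> y) + (norm y)\<^sup>2"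
  by (simp add: power2_norm_eq_inner algebra_simps inner_commute)

text \<open>The two sides differ by \<open>(norm y)\<^sup>2\<close>. Pairing the increment with the
  new value instead of the old one thus absorbs its square, and no estimate for the sum of squared
  drift increments is ever required.\<close>

lemma norm_add_power2_le:
  "(norm (x + y))\<^sup>2 \<le> (norm x)\<^sup>2 + 2 * ((x + y) \<bullet> y)"
  by (simp add: power2_norm_eq_inner algebra_simps inner_commute)

context brownian_setup
begin

lemma simple_integrand_times_nonneg:
  assumes "simple_integrand M F N \<tau> \<xi>" "i \<le> N"
  shows "0 \<le> \<tau> i"
  using assms(2)
proof (induction i)
  case (Suc i)
  then have "\<tau> i < \<tau> (Suc i)" using assms(1) by (simp add: simple_integrand_def)
  with Suc show ?case by simp
qed (use assms in \<open>simp add: simple_integrand_def\<close>)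

lemma measurable_simple_ito_integral:
  assumes "simple_integrand M F N \<tau> \<xi>" "0 \<le> t"
  shows "simple_ito_integral B N \<tau> \<xi> t \<in> borel_measurable (F t)"
proof -
  have "simple_ito_integral B N \<tau> \<xi> 0 = (\<lambda>\<omega>. 0)"
    by (intro ext simple_ito_integral_0 simple_integrand_times_nonneg[OF assms(1)])
  then show ?thesis
    using simple_ito_increment(1)[OF assms(1) order_refl assms(2), of "\<lambda>_. 0" "\<lambda>_. 0" 0] by simp
qed

lemma simple_energy_bounded:
  assumes "simple_integrand M F N \<tau> \<xi>" "s \<le> t"
  shows "\<exists>K. \<forall>\<omega>\<in>space M. \<bar>simple_energy N \<tau> \<xi> s t \<omega>\<bar> \<le> K"
proof -
  have "\<exists>K. \<forall>i<N. \<forall>\<omega>\<in>space M. norm (\<xi> i \<omega>) \<le> K i"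
    using assms unfolding simple_integrand_def by metis
  then obtain K where K: "\<And>i \<omega>. i < N \<Longrightarrow> \<omega> \<in> space M \<Longrightarrow> norm (\<xi> i \<omega>) \<le> K i" by blast
  have "\<bar>simple_energy N \<tau> \<xi> s t \<omega>\<bar> \<le> (\<Sum>i<N. (K i)\<^sup>2 * \<bar>clip_time s t (\<tau> (Suc i)) - clip_time s t (\<tau> i)\<bar>)"
    if "\<omega> \<in> space M" for \<omega>
    unfolding simple_energy_def
    by (rule order_trans[OF sum_abs], intro sum_mono)
      (auto simp: abs_mult intro!: mult_right_mono power_mono K[OF _ that])
  then show ?thesis by blast
qed

text \<open>A step of the simple process may begin inside a cell, so \<open>Q i\<close> is known
  only at the right end of cell \<open>i\<close>. The weight at \<open>i\<close> uses
  \<open>Q j\<close> for \<open>j < i\<close> only and is therefore known at its own grid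
  time.\<close>

lemma measurable_discrete_energy:
  fixes A :: "nat \<Rightarrow> 'a \<Rightarrow> real^'d" and \<xi> :: "nat \<Rightarrow> 'a \<Rightarrow> real^'m^'d" and R :: real
  assumes si: "simple_integrand M F N \<tau> \<xi>" and \<delta>: "0 < \<delta>"
    and A: "\<And>i. A i \<in> borel_measurable (F (real i * \<delta>))"
  defines "Y \<equiv> \<lambda>i \<omega>. A i \<omega> + simple_ito_integral B N \<tau> \<xi> (real i * \<delta>) \<omega>"
    and "Q \<equiv> \<lambda>i \<omega>. simple_energy N \<tau> \<xi> (real i * \<delta>) (real (Suc i) * \<delta>) \<omega>"
  defines "\<rho> \<equiv> \<lambda>i \<omega>. cutoff R (grid_cost (\<lambda>j. Y j \<omega>) (\<lambda>j. A j \<omega>) (\<lambda>j. Q j \<omega>) i)"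
  shows "Y i \<in> borel_measurable (F (real i * \<delta>))" "Q i \<in> borel_measurable (F (real (Suc i) * \<delta>))"
    and "\<rho> i \<in> borel_measurable (F (real i * \<delta>))"
proof -
  define t where "t i = real i * \<delta>" for i
  have t: "0 \<le> t i" "t i \<le> t (Suc i)" for i using \<delta> by (auto simp: t_def)
  have tm: "t i \<le> t j" if "i \<le> j" for i j using \<delta> that by (auto simp: t_def)
  have mA: "A i \<in> borel_measurable (F (t i))" for i using A by (simp add: t_def)
  have mY: "Y i \<in> borel_measurable (F (t i))" for i
    using mA measurable_simple_ito_integral[OF si t(1)] unfolding Y_def t_def by simp
  have mQ: "Q i \<in> borel_measurable (F (t (Suc i)))" for i
    using simple_ito_increment(6)[OF si t, of "\<lambda>_. 0" i "\<lambda>_. 0" 0] unfolding Q_def t_def by simp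
  have "(\<lambda>\<omega>. grid_cost (\<lambda>j. Y j \<omega>) (\<lambda>j. A j \<omega>) (\<lambda>j. Q j \<omega>) i) \<in> borel_measurable (F (t i))"
    using measurable_F_mono[OF mY t(1) tm] measurable_F_mono[OF mA t(1) tm] measurable_F_mono[OF mQ t(1) tm]
    by (intro borel_measurable_grid_cost) auto
  from measurable_compose[OF this borel_measurable_cutoff]
  show "Y i \<in> borel_measurable (F (real i * \<delta>))" "Q i \<in> borel_measurable (F (real (Suc i) * \<delta>))"
    and "\<rho> i \<in> borel_measurable (F (real i * \<delta>))"
    using mY mQ by (simp_all add: \<rho>_def t_def)
qed

text \<open>The step from \<open>i\<close> to \<open>Suc i\<close> first adds the martingale
  increment, then the drift increment. The weight is raised from \<open>\<rho> (Suc i)\<close> to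
  \<open>\<rho> i\<close> only in front of a square, where this is allowed; the drift product has no
  sign and keeps \<open>\<rho> (Suc i)\<close>, which is also the weight under which its factors are
  bounded.\<close>

lemma discrete_energy_inequality:
  fixes A :: "nat \<Rightarrow> 'a \<Rightarrow> real^'d" and \<xi> :: "nat \<Rightarrow> 'a \<Rightarrow> real^'m^'d"
  assumes si: "simple_integrand M F N \<tau> \<xi>" and \<delta>: "0 < \<delta>" and R: "0 < R" and kl: "k \<le> l"
    and A: "\<And>i. A i \<in> borel_measurable (F (real i * \<delta>))"
  defines "Y \<equiv> \<lambda>i \<omega>. A i \<omega> + simple_ito_integral B N \<tau> \<xi> (real i * \<delta>) \<omega>"
    and "Q \<equiv> \<lambda>i \<omega>. simple_energy N \<tau> \<xi> (real i * \<delta>) (real (Suc i) * \<delta>) \<omega>"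
  defines "\<rho> \<equiv> \<lambda>i \<omega>. cutoff R (grid_cost (\<lambda>j. Y j \<omega>) (\<lambda>j. A j \<omega>) (\<lambda>j. Q j \<omega>) i)"
  shows "expectation (\<lambda>\<omega>. \<rho> l \<omega> * (norm (Y l \<omega>))\<^sup>2) \<le> expectation (\<lambda>\<omega>. \<rho> k \<omega> * (norm (Y k \<omega>))\<^sup>2) +
    expectation (\<lambda>\<omega>. (\<Sum>i=k..<l. \<rho> (Suc i) \<omega> * (2 * (Y (Suc i) \<omega> \<bullet> (A (Suc i) \<omega> - A i \<omega>)))) +
       (\<Sum>i=k..<l. \<rho> i \<omega> * Q i \<omega>))"
proof -
  define t where "t i = real i * \<delta>" for i
  define C where "C i \<omega> = grid_cost (\<lambda>j. Y j \<omega>) (\<lambda>j. A j \<omega>) (\<lambda>j. Q j \<omega>) i" for i \<omega>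
  have t: "0 \<le> t i" "t i \<le> t (Suc i)" for i using \<delta> by (auto simp: t_def)
  have Q0: "0 \<le> Q i \<omega>" for i \<omega>
    unfolding Q_def using t(2)[of i] si
    by (intro simple_energy_nonneg) (auto simp: t_def simple_integrand_def)
  have mA: "A i \<in> borel_measurable (F (t i))" for i using A by (simp add: t_def)
  have mY: "Y i \<in> borel_measurable (F (t i))" for i
    unfolding Y_def t_def by (rule measurable_discrete_energy(1)[OF si \<delta> A])
  have mQ: "Q i \<in> borel_measurable (F (t (Suc i)))" for i
    unfolding Q_def t_def by (rule measurable_discrete_energy(2)[OF si \<delta> A])
  have m\<rho>: "\<rho> i \<in> borel_measurable (F (t i))" for i
    unfolding \<rho>_def Y_def Q_def t_def by (rule measurable_discrete_energy(3)[OF si \<delta> A])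
  have \<rho>C: "\<rho> i \<omega> = cutoff R (C i \<omega>)" for i \<omega> by (simp add: \<rho>_def C_def)
  have C0: "0 \<le> C i \<omega>" "norm (Y i \<omega>) \<le> C i \<omega>" "(\<Sum>j<i. norm (A (Suc j) \<omega> - A j \<omega>)) \<le> C i \<omega>" for i \<omega>
    using grid_cost_ge[where Q = "\<lambda>j. Q j \<omega>" and Y = "\<lambda>j. Y j \<omega>" and A = "\<lambda>j. A j \<omega>" and i = i] Q0 by (auto simp: C_def)
  have Cm: "C i \<omega> \<le> C (Suc i) \<omega>" for i \<omega>
    unfolding C_def by (intro grid_cost_mono Q0) simp
  have \<rho>0: "0 \<le> \<rho> i \<omega>" "\<bar>\<rho> i \<omega>\<bar> \<le> 1" "\<rho> (Suc i) \<omega> \<le> \<rho> i \<omega>" for i \<omega>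
    using cutoff_nonneg[of R "C i \<omega>"] cutoff_le_one[OF R C0(1)] cutoff_antimono[OF R Cm]
    by (auto simp: \<rho>C)
  note M = measurable_F_M[OF _ t(1)]
  note [measurable] = M[OF mA] M[OF mY] M[OF mQ] M[OF m\<rho>]
  define D where "D i \<omega> = A (Suc i) \<omega> - A i \<omega>" for i \<omega>
  define J where "J i \<omega> = simple_ito_integral B N \<tau> \<xi> (t (Suc i)) \<omega> - simple_ito_integral B N \<tau> \<xi> (t i) \<omega>" for i \<omega>
  have YJ: "Y (Suc i) \<omega> = Y i \<omega> + J i \<omega> + D i \<omega>" for i \<omega>
    by (simp add: Y_def J_def D_def t_def)
  \<comment> \<open>The cost at \<open>Suc i\<close> already contains the variation of cell
    \<open>i\<close>, so the drift increment is at most \<open>R\<close> wherever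
    \<open>\<rho> (Suc i)\<close> is nonzero.\<close>
  have Dle: "norm (D i \<omega>) \<le> C (Suc i) \<omega>" for i \<omega>
  proof -
    have "norm (D i \<omega>) \<le> (\<Sum>j<Suc i. norm (A (Suc j) \<omega> - A j \<omega>))"
      by (simp add: D_def sum_nonneg)
    then show ?thesis using C0(3)[of \<omega> "Suc i"] by linarith
  qed
  have [measurable]: "D i \<in> borel_measurable M" for i unfolding D_def by measurable
  have i1: "integrable M (\<lambda>\<omega>. \<rho> i \<omega> * (norm (Y i \<omega>))\<^sup>2)" for i
  proof (rule integrable_bounded[where K = "R\<^sup>2"])
    fix \<omega>
    have "\<rho> i \<omega> * (norm (Y i \<omega>))\<^sup>2 \<le> R\<^sup>2"
      unfolding \<rho>C using R C0(1,2)[of i \<omega>] by (intro cutoff_times_le) (auto intro!: power_mono)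
    then show "\<bar>\<rho> i \<omega> * (norm (Y i \<omega>))\<^sup>2\<bar> \<le> R\<^sup>2" using \<rho>0(1)[of i \<omega>] by simp
  qed auto
  have i2: "integrable M (\<lambda>\<omega>. \<rho> (Suc i) \<omega> * (2 * (Y (Suc i) \<omega> \<bullet> D i \<omega>)))" for i
  proof (rule integrable_bounded[where K = "2 * (R * R)"])
    fix \<omega>
    have "\<rho> (Suc i) \<omega> * \<bar>2 * (Y (Suc i) \<omega> \<bullet> D i \<omega>)\<bar> \<le> 2 * (R * R)"
      unfolding \<rho>C
    proof (intro cutoff_times_le)
      assume "C (Suc i) \<omega> \<le> R"
      then have "norm (Y (Suc i) \<omega>) * norm (D i \<omega>) \<le> R * R"
        using C0(1,2)[of "Suc i" \<omega>] Dle[of i \<omega>] by (intro mult_mono) auto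
      then show "\<bar>2 * (Y (Suc i) \<omega> \<bullet> D i \<omega>)\<bar> \<le> 2 * (R * R)"
        using Cauchy_Schwarz_ineq2[of "Y (Suc i) \<omega>" "D i \<omega>"] by (simp add: abs_mult)
    qed (use R C0 in auto)
    then show "\<bar>\<rho> (Suc i) \<omega> * (2 * (Y (Suc i) \<omega> \<bullet> D i \<omega>))\<bar> \<le> 2 * (R * R)"
      using \<rho>0(1)[of "Suc i" \<omega>] by (simp add: abs_mult)
  qed auto
  \<comment> \<open>The bound on \<open>Q i\<close> depends on the simple integrand, which is enough
    for integrability. A bound uniform in the approximation is obtained later in
    \<open>energy_increment_bounded\<close>.\<close>
  have i3: "integrable M (\<lambda>\<omega>. \<rho> i \<omega> * Q i \<omega>)" for i
  proof -
    obtain K where K: "\<And>\<omega>. \<omega> \<in> space M \<Longrightarrow> \<bar>Q i \<omega>\<bar> \<le> K"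
      using simple_energy_bounded[OF si t(2)[of i]] unfolding Q_def t_def by blast
    show ?thesis by (rule integrable_bounded_mult[OF integrable_bounded[OF _ K] _ \<rho>0(2)]) simp_all
  qed
  \<comment> \<open>This product is the \<eta> paired with the martingale increment. Truncation
    makes it bounded although \<open>Y i\<close> carries no moment bound.\<close>
  have norm\<rho>Y: "norm (\<rho> i \<omega> *\<^sub>R Y i \<omega>) \<le> R" for i \<omega>
    unfolding \<rho>C norm_scaleR abs_of_nonneg[OF cutoff_nonneg]
    using R C0(1,2)[of i \<omega>] by (intro cutoff_times_le) auto
  have \<eta>: "(\<lambda>\<omega>. \<rho> i \<omega> *\<^sub>R Y i \<omega>) \<in> borel_measurable (F (t i))" for i
    using m\<rho> mY by simp
  have \<eta>i: "integrable M (\<lambda>\<omega>. norm (\<rho> i \<omega> *\<^sub>R Y i \<omega>))" for i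
    by (rule integrable_bounded[where K = R]) (use norm\<rho>Y in auto)
  note inc = simple_ito_increment[OF si t \<eta> \<eta>i m\<rho> \<rho>0(2), folded J_def]
  have one_step: "expectation (\<lambda>\<omega>. \<rho> (Suc i) \<omega> * (norm (Y (Suc i) \<omega>))\<^sup>2) \<le> expectation (\<lambda>\<omega>. \<rho> i \<omega> * (norm (Y i \<omega>))\<^sup>2) +
    expectation (\<lambda>\<omega>. \<rho> (Suc i) \<omega> * (2 * (Y (Suc i) \<omega> \<bullet> D i \<omega>)) + \<rho> i \<omega> * Q i \<omega>)" for i
  proof -
    have i4: "integrable M (\<lambda>\<omega>. \<rho> i \<omega> * (2 * (Y i \<omega> \<bullet> J i \<omega>)))"
      and e4: "expectation (\<lambda>\<omega>. \<rho> i \<omega> * (2 * (Y i \<omega> \<bullet> J i \<omega>))) = 0"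
    proof -
      have eq: "(\<lambda>\<omega>. \<rho> i \<omega> * (2 * (Y i \<omega> \<bullet> J i \<omega>))) = (\<lambda>\<omega>. 2 * ((\<rho> i \<omega> *\<^sub>R Y i \<omega>) \<bullet> J i \<omega>))" by auto
      show "integrable M (\<lambda>\<omega>. \<rho> i \<omega> * (2 * (Y i \<omega> \<bullet> J i \<omega>)))"
        "expectation (\<lambda>\<omega>. \<rho> i \<omega> * (2 * (Y i \<omega> \<bullet> J i \<omega>))) = 0"
        unfolding eq using inc(2,3)[of i] by auto
    qed
    have i5: "integrable M (\<lambda>\<omega>. \<rho> i \<omega> * (norm (J i \<omega>))\<^sup>2)"
      by (rule integrable_bounded_mult[OF inc(4) _ \<rho>0(2)]) simp
    have e5: "expectation (\<lambda>\<omega>. \<rho> i \<omega> * (norm (J i \<omega>))\<^sup>2) = expectation (\<lambda>\<omega>. \<rho> i \<omega> * Q i \<omega>)"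
      using inc(5)[of i] by (simp add: Q_def t_def)
    have le: "\<rho> (Suc i) \<omega> * (norm (Y (Suc i) \<omega>))\<^sup>2 \<le> \<rho> i \<omega> * (norm (Y i \<omega>))\<^sup>2 +
       \<rho> (Suc i) \<omega> * (2 * (Y (Suc i) \<omega> \<bullet> D i \<omega>)) + \<rho> i \<omega> * (2 * (Y i \<omega> \<bullet> J i \<omega>)) + \<rho> i \<omega> * (norm (J i \<omega>))\<^sup>2" for \<omega>
    proof -
      have "\<rho> (Suc i) \<omega> * (norm (Y (Suc i) \<omega>))\<^sup>2 \<le>
          \<rho> (Suc i) \<omega> * ((norm (Y i \<omega> + J i \<omega>))\<^sup>2 + 2 * (Y (Suc i) \<omega> \<bullet> D i \<omega>))"
        unfolding YJ by (intro mult_left_mono norm_add_power2_le \<rho>0)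
      also have "\<dots> = \<rho> (Suc i) \<omega> * (norm (Y i \<omega> + J i \<omega>))\<^sup>2 + \<rho> (Suc i) \<omega> * (2 * (Y (Suc i) \<omega> \<bullet> D i \<omega>))"
        by (simp add: algebra_simps)
      also have "\<rho> (Suc i) \<omega> * (norm (Y i \<omega> + J i \<omega>))\<^sup>2 \<le> \<rho> i \<omega> * (norm (Y i \<omega> + J i \<omega>))\<^sup>2"
        by (intro mult_right_mono \<rho>0) simp
      also have "\<dots> = \<rho> i \<omega> * (norm (Y i \<omega>))\<^sup>2 + \<rho> i \<omega> * (2 * (Y i \<omega> \<bullet> J i \<omega>)) + \<rho> i \<omega> * (norm (J i \<omega>))\<^sup>2"
        unfolding norm_add_power2_eq by (simp add: algebra_simps)
      finally show ?thesis by linarith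
    qed
    have "expectation (\<lambda>\<omega>. \<rho> (Suc i) \<omega> * (norm (Y (Suc i) \<omega>))\<^sup>2) \<le>
      expectation (\<lambda>\<omega>. \<rho> i \<omega> * (norm (Y i \<omega>))\<^sup>2 +
       \<rho> (Suc i) \<omega> * (2 * (Y (Suc i) \<omega> \<bullet> D i \<omega>)) + \<rho> i \<omega> * (2 * (Y i \<omega> \<bullet> J i \<omega>)) + \<rho> i \<omega> * (norm (J i \<omega>))\<^sup>2)"
      by (rule integral_mono) (auto intro!: i1 i2 i4 i5 le Bochner_Integration.integrable_add)
    also have "\<dots> = expectation (\<lambda>\<omega>. \<rho> i \<omega> * (norm (Y i \<omega>))\<^sup>2) +
        expectation (\<lambda>\<omega>. \<rho> (Suc i) \<omega> * (2 * (Y (Suc i) \<omega> \<bullet> D i \<omega>))) + expectation (\<lambda>\<omega>. \<rho> i \<omega> * Q i \<omega>)"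
      using i1[of i] i2[of i] i4 i5 e4 e5 by (simp del: integral_mult_right_zero)
    also have "\<dots> = expectation (\<lambda>\<omega>. \<rho> i \<omega> * (norm (Y i \<omega>))\<^sup>2) +
       expectation (\<lambda>\<omega>. \<rho> (Suc i) \<omega> * (2 * (Y (Suc i) \<omega> \<bullet> D i \<omega>)) + \<rho> i \<omega> * Q i \<omega>)"
      using i2[of i] i3[of i] by simp
    finally show ?thesis .
  qed
  have "expectation (\<lambda>\<omega>. \<rho> l \<omega> * (norm (Y l \<omega>))\<^sup>2) \<le> expectation (\<lambda>\<omega>. \<rho> k \<omega> * (norm (Y k \<omega>))\<^sup>2) +
     (\<Sum>i=k..<l. expectation (\<lambda>\<omega>. \<rho> (Suc i) \<omega> * (2 * (Y (Suc i) \<omega> \<bullet> D i \<omega>)) + \<rho> i \<omega> * Q i \<omega>))"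
    using kl
  proof (induction l rule: dec_induct)
    case (step n)
    then show ?case using step(1) one_step[of n] by simp
  qed simp
  also have "(\<Sum>i=k..<l. expectation (\<lambda>\<omega>. \<rho> (Suc i) \<omega> * (2 * (Y (Suc i) \<omega> \<bullet> D i \<omega>)) + \<rho> i \<omega> * Q i \<omega>)) =
    expectation (\<lambda>\<omega>. \<Sum>i=k..<l. \<rho> (Suc i) \<omega> * (2 * (Y (Suc i) \<omega> \<bullet> D i \<omega>)) + \<rho> i \<omega> * Q i \<omega>)"
    by (rule Bochner_Integration.integral_sum[symmetric]) (intro Bochner_Integration.integrable_add i2 i3)
  finally show ?thesis by (simp add: sum.distrib D_def)
qed

end

section \<open>Riemann sums of integrable paths\<close>

definition grid_index :: "real \<Rightarrow> real \<Rightarrow> nat" where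
  "grid_index \<delta> r = nat \<lfloor>r / \<delta>\<rfloor>"

lemma grid_index_bounds:
  assumes "0 < \<delta>" "0 \<le> r"
  shows "real (grid_index \<delta> r) * \<delta> \<le> r" "r < real (Suc (grid_index \<delta> r)) * \<delta>"
proof -
  have "real (grid_index \<delta> r) = real_of_int \<lfloor>r / \<delta>\<rfloor>" using assms by (simp add: grid_index_def)
  then have "real (grid_index \<delta> r) \<le> r / \<delta>" "r / \<delta> < real (grid_index \<delta> r) + 1" by linarith+
  then show "real (grid_index \<delta> r) * \<delta> \<le> r" "r < real (Suc (grid_index \<delta> r)) * \<delta>"
    using assms by (auto simp: field_simps)
qed

lemma grid_index_eqI:
  assumes "0 < \<delta>" "real i * \<delta> \<le> r" "r < real (Suc i) * \<delta>"
  shows "grid_index \<delta> r = i"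
proof -
  have "\<lfloor>r / \<delta>\<rfloor> = int i" using assms by (intro floor_unique) (auto simp: field_simps)
  then show ?thesis by (simp add: grid_index_def)
qed

lemma tendsto_grid_index:
  assumes "\<And>n. 0 < \<delta> n" "\<delta> \<longlonglongrightarrow> 0" "0 \<le> r"
  shows "(\<lambda>n. real (grid_index (\<delta> n) r) * \<delta> n) \<longlonglongrightarrow> r"
    and "(\<lambda>n. real (Suc (grid_index (\<delta> n) r)) * \<delta> n) \<longlonglongrightarrow> r"
proof -
  have *: "r - \<delta> n \<le> real (grid_index (\<delta> n) r) * \<delta> n" "real (grid_index (\<delta> n) r) * \<delta> n \<le> r" for n
    using grid_index_bounds[OF assms(1,3)] by (simp_all add: algebra_simps less_imp_le)
  have 0: "(\<lambda>n. r - \<delta> n) \<longlonglongrightarrow> r" using tendsto_diff[OF tendsto_const assms(2), of r] by simp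
  show 1: "(\<lambda>n. real (grid_index (\<delta> n) r) * \<delta> n) \<longlonglongrightarrow> r"
    by (rule tendsto_sandwich[OF _ _ 0 tendsto_const]) (auto intro!: always_eventually *)
  show "(\<lambda>n. real (Suc (grid_index (\<delta> n) r)) * \<delta> n) \<longlonglongrightarrow> r"
    using tendsto_add[OF 1 assms(2)] by (simp add: algebra_simps)
qed

lemma grid_index_mono: "0 < \<delta> \<Longrightarrow> s \<le> t \<Longrightarrow> grid_index \<delta> s \<le> grid_index \<delta> t"
  unfolding grid_index_def by (intro nat_mono floor_mono divide_right_mono) auto

lemma AE_lebesgue_neq: "AE r in lebesgue. r \<noteq> (a :: real)"
  by (rule AE_completion[OF AE_lborel_singleton])

text \<open>Gives convergence of indicators of intervals with moving end points at every point
  except the limiting end points, hence almost everywhere.\<close>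

lemma eventually_less_tendsto_iff:
  fixes a r :: real
  assumes x: "(x \<longlongrightarrow> a) G" and "r \<noteq> a"
  shows "eventually (\<lambda>n. r < x n \<longleftrightarrow> r < a) G"
proof (cases "r < a")
  case True
  from order_tendstoD(1)[OF x this] show ?thesis by eventually_elim (use True in simp)
next
  case False
  then have "a < r" using assms(2) by simp
  from order_tendstoD(2)[OF x this] show ?thesis by eventually_elim (use False in auto)
qed

definition cell :: "real \<Rightarrow> nat \<Rightarrow> real set" where
  "cell \<delta> i = {real i * \<delta>..<real (Suc i) * \<delta>}"

lemma grid_interval_subset:
  assumes "0 < \<delta>" "real l * \<delta> < T"
  shows "{real k * \<delta>..<real l * \<delta>} \<subseteq> {0..T}"
proof -
  have "0 \<le> real k * \<delta>" using assms by simp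
  then show ?thesis using assms(2)
    by (intro subsetI) (unfold atLeastAtMost_iff atLeastLessThan_iff, linarith)
qed

lemma cell_subset:
  assumes "0 < \<delta>" "i < l" "real l * \<delta> < T"
  shows "cell \<delta> i \<subseteq> {0..T}"
proof -
  have "real (Suc i) * \<delta> \<le> real l * \<delta>" using assms by (intro mult_right_mono) auto
  then have "real (Suc i) * \<delta> < T" using assms(3) by (rule le_less_trans)
  then show ?thesis unfolding cell_def by (intro grid_interval_subset assms)
qed

text \<open>A sum over increments of an indefinite integral equals, at every mesh, one integral
  against a step function. Limits of such sums thereby become instances of dominated
  convergence.\<close>

lemma grid_sum_eq_integral:
  fixes \<phi> :: "real \<Rightarrow> 'v::euclidean_space"
  assumes \<delta>: "0 < \<delta>" and kl: "k \<le> l" and \<phi>: "set_integrable lebesgue {real k * \<delta>..<real l * \<delta>} \<phi>"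
  shows "set_integrable lebesgue {real k * \<delta>..<real l * \<delta>} (\<lambda>r. h (grid_index \<delta> r) \<bullet> \<phi> r)"
    and "(\<Sum>i=k..<l. h i \<bullet> (LINT r:cell \<delta> i|lebesgue. \<phi> r)) =
      (LINT r:{real k * \<delta>..<real l * \<delta>}|lebesgue. h (grid_index \<delta> r) \<bullet> \<phi> r)"
proof -
  let ?P = "\<lambda>l. set_integrable lebesgue {real k * \<delta>..<real l * \<delta>} (\<lambda>r. h (grid_index \<delta> r) \<bullet> \<phi> r) \<and>
    (\<Sum>i=k..<l. h i \<bullet> (LINT r:cell \<delta> i|lebesgue. \<phi> r)) =
      (LINT r:{real k * \<delta>..<real l * \<delta>}|lebesgue. h (grid_index \<delta> r) \<bullet> \<phi> r)"
  have "?P l" using kl \<phi>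
  proof (induction l rule: dec_induct)
    case base
    show ?case by (simp add: set_lebesgue_integral_def)
  next
    case (step n)
    have le: "real k * \<delta> \<le> real n * \<delta>" "real n * \<delta> \<le> real (Suc n) * \<delta>"
      using step(1) \<delta> by (auto intro: mult_right_mono)
    have un: "{real k * \<delta>..<real (Suc n) * \<delta>} = {real k * \<delta>..<real n * \<delta>} \<union> cell \<delta> n"
      using le by (auto simp: cell_def)
    have disj: "{real k * \<delta>..<real n * \<delta>} \<inter> cell \<delta> n = {}" by (auto simp: cell_def)
    have \<phi>1: "set_integrable lebesgue {real k * \<delta>..<real n * \<delta>} \<phi>"
      by (rule set_integrable_subset[OF step(4)]) (use le in auto)
    have \<phi>2: "set_integrable lebesgue (cell \<delta> n) \<phi>"
      by (rule set_integrable_subset[OF step(4)]) (use un in \<open>auto simp: cell_def\<close>)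
    note IH = step(3)[OF \<phi>1]
    have c: "grid_index \<delta> r = n" if "r \<in> cell \<delta> n" for r
      using that \<delta> by (intro grid_index_eqI) (auto simp: cell_def)
    have i: "set_integrable lebesgue (cell \<delta> n) (\<lambda>r. h n \<bullet> \<phi> r)"
    proof -
      have "integrable lebesgue (\<lambda>r. h n \<bullet> (indicator (cell \<delta> n) r *\<^sub>R \<phi> r))"
        using \<phi>2 unfolding set_integrable_def by (rule integrable_inner_right) 
      then show ?thesis unfolding set_integrable_def by simp
    qed
    have i': "set_integrable lebesgue (cell \<delta> n) (\<lambda>r. h (grid_index \<delta> r) \<bullet> \<phi> r)"
      by (rule set_integrable_cong[THEN iffD1, OF refl _ _ i]) (use c in auto)
    have e: "h n \<bullet> (LINT r:cell \<delta> n|lebesgue. \<phi> r) = (LINT r:cell \<delta> n|lebesgue. h (grid_index \<delta> r) \<bullet> \<phi> r)"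
    proof -
      have "h n \<bullet> (LINT r:cell \<delta> n|lebesgue. \<phi> r) = (LINT r:cell \<delta> n|lebesgue. h n \<bullet> \<phi> r)"
        using integral_inner_right[of "h n" lebesgue "\<lambda>r. indicator (cell \<delta> n) r *\<^sub>R \<phi> r"] \<phi>2
        unfolding set_lebesgue_integral_def set_integrable_def by simp
      also have "\<dots> = (LINT r:cell \<delta> n|lebesgue. h (grid_index \<delta> r) \<bullet> \<phi> r)"
        by (rule set_lebesgue_integral_cong) (auto simp: c cell_def)
      finally show ?thesis .
    qed
    show ?case
      unfolding un set_integral_Un[OF disj conjunct1[OF IH] i'] using IH i' e step(1)
      by (auto intro!: set_integrable_Un simp: cell_def)
  qed
  then show "set_integrable lebesgue {real k * \<delta>..<real l * \<delta>} (\<lambda>r. h (grid_index \<delta> r) \<bullet> \<phi> r)"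
    and "(\<Sum>i=k..<l. h i \<bullet> (LINT r:cell \<delta> i|lebesgue. \<phi> r)) =
      (LINT r:{real k * \<delta>..<real l * \<delta>}|lebesgue. h (grid_index \<delta> r) \<bullet> \<phi> r)" by auto
qed

lemma borel_measurable_grid_step:
  fixes h :: "nat \<Rightarrow> 'v::euclidean_space"
  shows "(\<lambda>r. h (grid_index \<delta> r)) \<in> borel_measurable borel"
proof -
  have "grid_index \<delta> \<in> borel \<rightarrow>\<^sub>M count_space UNIV"
    unfolding grid_index_def by measurable
  then show ?thesis by (rule measurable_compose) simp
qed

lemma borel_measurable_lebesgue_indicator_atLeastLessThan [measurable]:
  "indicator {s..<t::real} \<in> borel_measurable (lebesgue :: real measure)"
  by (rule measurable_completion) simp

text \<open>Pointwise convergence of the step functions suffices, with \<open>K\<close> times the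
  norm of \<phi> as the dominating function. The margin \<open>t < T\<close> keeps the moving right
  end eventually inside the interval on which \<phi> is integrable.\<close>

lemma grid_sum_tendsto:
  fixes \<phi> h' :: "real \<Rightarrow> 'v::euclidean_space" and h :: "nat \<Rightarrow> nat \<Rightarrow> 'v"
  assumes \<delta>: "\<And>n. 0 < \<delta> n" "\<delta> \<longlonglongrightarrow> 0" and \<phi>: "set_integrable lebesgue {0..T} \<phi>"
    and s: "(\<lambda>n. real (k n) * \<delta> n) \<longlonglongrightarrow> s" and t: "(\<lambda>n. real (l n) * \<delta> n) \<longlonglongrightarrow> t"
    and kl: "\<And>n. k n \<le> l n" and st: "0 \<le> s" "s \<le> t" "t < T"
    and K: "\<And>n i. norm (h n i) \<le> K"
    and h: "\<And>r. 0 \<le> r \<Longrightarrow> r \<le> T \<Longrightarrow> (\<lambda>n. h n (grid_index (\<delta> n) r)) \<longlonglongrightarrow> h' r"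
  shows "(\<lambda>n. \<Sum>i=k n..<l n. h n i \<bullet> (LINT r:cell (\<delta> n) i|lebesgue. \<phi> r)) \<longlonglongrightarrow>
     (LINT r:{s..<t}|lebesgue. h' r \<bullet> \<phi> r)"
proof -
  define I where "I n = {real (k n) * \<delta> n..<real (l n) * \<delta> n}" for n
  define \<phi>' where "\<phi>' r = indicator {0..T} r *\<^sub>R \<phi> r" for r
  have i\<phi>': "integrable lebesgue \<phi>'" using \<phi> unfolding \<phi>'_def[abs_def] set_integrable_def .
  have m\<phi>': "\<phi>' \<in> borel_measurable lebesgue" using i\<phi>' by auto
  have mh: "(\<lambda>r. h n (grid_index (\<delta> n) r)) \<in> borel_measurable lebesgue" for n
    using measurable_completion[of _ lborel, OF borel_measurable_grid_step[of "h n" "\<delta> n", folded measurable_lborel2]] .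
  have lim0: "(\<lambda>n. h n (grid_index (\<delta> n) r) \<bullet> \<phi>' r) \<longlonglongrightarrow> h' r \<bullet> \<phi>' r" for r
    by (cases "0 \<le> r \<and> r \<le> T") (auto simp: \<phi>'_def intro!: tendsto_inner h)
  \<comment> \<open>The function \<open>h'\<close> is given only as a pointwise limit on
    \<open>[0, T]\<close>, so measurability of the product is taken over from the step
    functions.\<close>
  have mh': "(\<lambda>r. h' r \<bullet> \<phi>' r) \<in> borel_measurable lebesgue"
    by (rule borel_measurable_LIMSEQ_metric[OF _ lim0]) (intro borel_measurable_inner mh m\<phi>')
  have lim: "(\<lambda>n. LINT r|lebesgue. indicator (I n) r *\<^sub>R (h n (grid_index (\<delta> n) r) \<bullet> \<phi>' r))
     \<longlonglongrightarrow> (LINT r|lebesgue. indicator {s..<t} r *\<^sub>R (h' r \<bullet> \<phi>' r))"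
  proof (rule integral_dominated_convergence[where w = "\<lambda>r. K * norm (\<phi>' r)"])
    show "(\<lambda>r. indicator {s..<t} r *\<^sub>R (h' r \<bullet> \<phi>' r)) \<in> borel_measurable lebesgue"
      using mh' by (intro borel_measurable_scaleR) auto
    show "(\<lambda>r. indicator (I n) r *\<^sub>R (h n (grid_index (\<delta> n) r) \<bullet> \<phi>' r)) \<in> borel_measurable lebesgue" for n
      using mh m\<phi>' by (intro borel_measurable_scaleR borel_measurable_inner) (auto simp: I_def)
    show "integrable lebesgue (\<lambda>r. K * norm (\<phi>' r))" using i\<phi>' by simp
    show "AE r in lebesgue. norm (indicator (I n) r *\<^sub>R (h n (grid_index (\<delta> n) r) \<bullet> \<phi>' r)) \<le> K * norm (\<phi>' r)" for n
    proof (rule AE_I2)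
      fix r
      have K0: "0 \<le> K" using K[of 0 0] norm_ge_zero order_trans by blast
      have "\<bar>h n (grid_index (\<delta> n) r) \<bullet> \<phi>' r\<bar> \<le> K * norm (\<phi>' r)"
        by (rule order_trans[OF Cauchy_Schwarz_ineq2]) (intro mult_right_mono K norm_ge_zero)
      then show "norm (indicator (I n) r *\<^sub>R (h n (grid_index (\<delta> n) r) \<bullet> \<phi>' r)) \<le> K * norm (\<phi>' r)"
        using K0 by (auto simp: indicator_def)
    qed
    show "AE r in lebesgue. (\<lambda>n. indicator (I n) r *\<^sub>R (h n (grid_index (\<delta> n) r) \<bullet> \<phi>' r)) \<longlonglongrightarrow>
        indicator {s..<t} r *\<^sub>R (h' r \<bullet> \<phi>' r)"
    proof -
      note AE_lebesgue_neq[of s] AE_lebesgue_neq[of t]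
      then show ?thesis
      proof eventually_elim
        case (elim r)
        note a = eventually_less_tendsto_iff[OF s elim(1)] and b = eventually_less_tendsto_iff[OF t elim(2)]
        have "eventually (\<lambda>n. indicator (I n) r = (indicator {s..<t} r :: real)) sequentially"
          using a b by eventually_elim (auto simp: I_def indicator_def)
        then have "(\<lambda>n. indicator (I n) r :: real) \<longlonglongrightarrow> indicator {s..<t} r"
          by (rule tendsto_eventually)
        then show ?case by (intro tendsto_scaleR lim0)
      qed
    qed
  qed
  have ev: "eventually (\<lambda>n. real (l n) * \<delta> n < T) sequentially"
    using order_tendstoD(2)[OF t st(3)] .
  have "eventually (\<lambda>n. (LINT r|lebesgue. indicator (I n) r *\<^sub>R (h n (grid_index (\<delta> n) r) \<bullet> \<phi>' r)) =
      (\<Sum>i=k n..<l n. h n i \<bullet> (LINT r:cell (\<delta> n) i|lebesgue. \<phi> r))) sequentially"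
    using ev
  proof eventually_elim
    case (elim n)
    have sub: "I n \<subseteq> {0..T}" unfolding I_def by (intro grid_interval_subset \<delta>(1) elim)
    have "(\<Sum>i=k n..<l n. h n i \<bullet> (LINT r:cell (\<delta> n) i|lebesgue. \<phi> r)) =
        (LINT r:I n|lebesgue. h n (grid_index (\<delta> n) r) \<bullet> \<phi> r)"
      unfolding I_def using \<delta>(1) kl
      by (rule grid_sum_eq_integral(2)) (rule set_integrable_subset[OF \<phi>], use sub in \<open>auto simp: I_def\<close>)
    also have "\<dots> = (LINT r|lebesgue. indicator (I n) r *\<^sub>R (h n (grid_index (\<delta> n) r) \<bullet> \<phi>' r))"
      unfolding set_lebesgue_integral_def
      by (rule Bochner_Integration.integral_cong) (use sub in \<open>auto simp: \<phi>'_def indicator_def\<close>)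
    finally show ?case by simp
  qed
  moreover have "(LINT r|lebesgue. indicator {s..<t} r *\<^sub>R (h' r \<bullet> \<phi>' r)) = (LINT r:{s..<t}|lebesgue. h' r \<bullet> \<phi> r)"
    unfolding set_lebesgue_integral_def
    by (rule Bochner_Integration.integral_cong) (use st in \<open>auto simp: \<phi>'_def indicator_def\<close>)
  ultimately show ?thesis using Lim_transform_eventually[OF lim] by simp
qed

text \<open>An exact limit is required, not just an upper bound, because the variation stands in the
  argument of the cutoff. The upper half is the triangle inequality on each cell.\<close>

lemma grid_variation_tendsto:
  fixes \<phi> :: "real \<Rightarrow> 'v::euclidean_space"
  assumes \<delta>: "\<And>n. 0 < \<delta> n" "\<delta> \<longlonglongrightarrow> 0" and \<phi>: "set_integrable lebesgue {0..T} \<phi>"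
    and t: "(\<lambda>n. real (l n) * \<delta> n) \<longlonglongrightarrow> t" "0 \<le> t" "t < T"
  shows "(\<lambda>n. \<Sum>i<l n. norm (LINT r:cell (\<delta> n) i|lebesgue. \<phi> r)) \<longlonglongrightarrow> (LINT r:{0..<t}|lebesgue. norm (\<phi> r))"
proof -
  define \<phi>' where "\<phi>' r = indicator {0..T} r *\<^sub>R \<phi> r" for r
  define V where "V n = (\<Sum>i<l n. norm (LINT r:cell (\<delta> n) i|lebesgue. \<phi> r))" for n
  define W where "W = (LINT r:{0..<t}|lebesgue. norm (\<phi> r))"
  have n\<phi>: "set_integrable lebesgue {0..T} (\<lambda>r. norm (\<phi> r))"
    using set_integrable_norm[OF \<phi>] .
  have upper: "(\<lambda>n. \<Sum>i<l n. (LINT r:cell (\<delta> n) i|lebesgue. norm (\<phi> r))) \<longlonglongrightarrow> W"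
    using grid_sum_tendsto[OF \<delta> n\<phi> _ t(1) _ order_refl t(2,3), where k = "\<lambda>_. 0" and h = "\<lambda>_ _. 1" and K = 1 and h' = "\<lambda>_. 1"]
    by (simp add: W_def lessThan_atLeast0)
  have ev: "eventually (\<lambda>n. real (l n) * \<delta> n < T) sequentially"
    using order_tendstoD(2)[OF t(1,3)] .
  have V_le: "eventually (\<lambda>n. V n \<le> (\<Sum>i<l n. (LINT r:cell (\<delta> n) i|lebesgue. norm (\<phi> r)))) sequentially"
    using ev
  proof eventually_elim
    case (elim n)
    show ?case unfolding V_def
    proof (rule sum_mono)
      fix i assume "i \<in> {..<l n}"
      then have "set_integrable lebesgue (cell (\<delta> n) i) \<phi>"
        using cell_subset[OF \<delta>(1), of i "l n" n] elim by (intro set_integrable_subset[OF \<phi>]) (auto simp: cell_def)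
      then show "norm (LINT r:cell (\<delta> n) i|lebesgue. \<phi> r) \<le> (LINT r:cell (\<delta> n) i|lebesgue. norm (\<phi> r))"
        by (rule set_integral_norm_bound)
    qed
  qed
  have lower: "eventually (\<lambda>n. W - e < V n) sequentially" if e: "0 < e" for e
  proof -
    have "\<phi>' \<in> borel_measurable lebesgue"
      using borel_measurable_integrable[OF \<phi>[unfolded set_integrable_def]] by (simp add: \<phi>'_def[abs_def])
    \<comment> \<open>This notion of measurability is what supplies continuous functions converging
      to \<open>\<phi>'\<close> off a negligible set.\<close>
    then have "\<phi>' measurable_on UNIV" by (intro lebesgue_measurable_imp_measurable_on) auto
    then obtain N g where N: "negligible N" and g: "\<And>m. continuous_on UNIV (g m)"
      and lim: "\<And>x. x \<notin> N \<Longrightarrow> (\<lambda>m. g m x) \<longlonglongrightarrow> \<phi>' x"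
      unfolding measurable_on_def by (auto simp: )
    \<comment> \<open>By duality, the variation dominates the Riemann sums against continuous fields of norm at
      most 1; these fields \<open>u m\<close> approximate \<open>\<phi> / |\<phi>|\<close>.\<close>
    define u where "u m x = g m x /\<^sub>R max (1 / real (Suc m)) (norm (g m x))" for m x
    \<comment> \<open>The floor \<open>1 / Suc m\<close> keeps the denominator away from zero where
      \<open>g m\<close> vanishes, so \<open>u m\<close> stays continuous. It tends to zero and
      disappears wherever \<open>\<phi>'\<close> is nonzero.\<close>
    have pos: "0 < max (1 / real (Suc m)) (norm (g m x))" for m x
      by (simp add: less_max_iff_disj)
    have u1: "norm (u m x) \<le> 1" for m x
      using pos[of m x] by (simp add: u_def divide_simps)
    have cu: "continuous_on UNIV (u m)" for m
      unfolding u_def using pos[of m] by (intro continuous_intros g) (metis less_irrefl)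
    have limu: "(\<lambda>m. u m x \<bullet> \<phi>' x) \<longlonglongrightarrow> norm (\<phi>' x)" if "x \<notin> N" for x
    proof (cases "\<phi>' x = 0")
      case False
      have "(\<lambda>m. max (1 / real (Suc m)) (norm (g m x))) \<longlonglongrightarrow> max 0 (norm (\<phi>' x))"
        by (intro tendsto_max tendsto_norm lim[OF that] lim_1_over_n[THEN LIMSEQ_Suc])
      then have "(\<lambda>m. u m x) \<longlonglongrightarrow> \<phi>' x /\<^sub>R max 0 (norm (\<phi>' x))"
        unfolding u_def using False by (intro tendsto_scaleR tendsto_inverse lim[OF that]) auto
      then have "(\<lambda>m. u m x \<bullet> \<phi>' x) \<longlonglongrightarrow> (\<phi>' x /\<^sub>R max 0 (norm (\<phi>' x))) \<bullet> \<phi>' x"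
        by (intro tendsto_inner tendsto_const)
      then show ?thesis using False by (simp add: dot_square_norm power2_eq_square field_simps)
    qed simp
    have i\<phi>': "integrable lebesgue \<phi>'" using \<phi> unfolding \<phi>'_def[abs_def] set_integrable_def .
    have mu: "u m \<in> borel_measurable lebesgue" for m
      using measurable_completion[of "u m" lborel] borel_measurable_continuous_onI[OF cu] by simp
    have "(\<lambda>m. LINT x|lebesgue. indicator {0..<t} x *\<^sub>R (u m x \<bullet> \<phi>' x)) \<longlonglongrightarrow>
        (LINT x|lebesgue. indicator {0..<t} x *\<^sub>R norm (\<phi>' x))"
    proof (rule integral_dominated_convergence[where w = "\<lambda>x. norm (\<phi>' x)"])
      show "AE x in lebesgue. (\<lambda>m. indicator {0..<t} x *\<^sub>R (u m x \<bullet> \<phi>' x)) \<longlonglongrightarrow> indicator {0..<t} x *\<^sub>R norm (\<phi>' x)"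
      proof -
        have "AE x in lebesgue. x \<notin> N"
          using N by (intro AE_not_in) (simp add: negligible_iff_null_sets)
        then show ?thesis by eventually_elim (intro tendsto_scaleR tendsto_const limu)
      qed
      show "AE x in lebesgue. norm (indicator {0..<t} x *\<^sub>R (u m x \<bullet> \<phi>' x)) \<le> norm (\<phi>' x)" for m
      proof (rule AE_I2)
        fix x
        have "\<bar>u m x \<bullet> \<phi>' x\<bar> \<le> 1 * norm (\<phi>' x)"
          by (rule order_trans[OF Cauchy_Schwarz_ineq2]) (intro mult_right_mono u1 norm_ge_zero)
        then show "norm (indicator {0..<t} x *\<^sub>R (u m x \<bullet> \<phi>' x)) \<le> norm (\<phi>' x)"
          by (auto simp: indicator_def)
      qed
      show "(\<lambda>x. indicator {0..<t} x *\<^sub>R (u m x \<bullet> \<phi>' x)) \<in> borel_measurable lebesgue" for m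
        using i\<phi>' mu by (intro borel_measurable_scaleR borel_measurable_inner) auto
    qed (use i\<phi>' in \<open>auto intro!: borel_measurable_scaleR\<close>)
    moreover have "(LINT x|lebesgue. indicator {0..<t} x *\<^sub>R norm (\<phi>' x)) = W"
      unfolding set_lebesgue_integral_def W_def
      by (rule Bochner_Integration.integral_cong) (use t in \<open>auto simp: \<phi>'_def indicator_def\<close>)
    moreover have "(LINT x|lebesgue. indicator {0..<t} x *\<^sub>R (u m x \<bullet> \<phi>' x)) = (LINT x:{0..<t}|lebesgue. u m x \<bullet> \<phi> x)" for m
      unfolding set_lebesgue_integral_def
      by (rule Bochner_Integration.integral_cong) (use t in \<open>auto simp: \<phi>'_def indicator_def\<close>)
    ultimately have "(\<lambda>m. LINT x:{0..<t}|lebesgue. u m x \<bullet> \<phi> x) \<longlonglongrightarrow> W" by simp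
    from order_tendstoD(1)[OF this, of "W - e"] e
    obtain m where m: "W - e < (LINT x:{0..<t}|lebesgue. u m x \<bullet> \<phi> x)"
      by (auto simp: eventually_sequentially)
    have "(\<lambda>n. \<Sum>i=0..<l n. u m (real i * \<delta> n) \<bullet> (LINT r:cell (\<delta> n) i|lebesgue. \<phi> r)) \<longlonglongrightarrow>
        (LINT r:{0..<t}|lebesgue. u m r \<bullet> \<phi> r)"
    proof (rule grid_sum_tendsto[OF \<delta> \<phi> _ t(1) _ _ t(2,3), where K = 1])
      fix r :: real assume "0 \<le> r"
      have "isCont (u m) r" using cu[of m] by (simp add: continuous_on_eq_continuous_at)
      then show "(\<lambda>n. u m (real (grid_index (\<delta> n) r) * \<delta> n)) \<longlonglongrightarrow> u m r"
        using tendsto_grid_index(1)[OF \<delta> \<open>0 \<le> r\<close>] isCont_tendsto_compose by blast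
    qed (use u1 in auto)
    from order_tendstoD(1)[OF this m]
    show ?thesis
    proof eventually_elim
      case (elim n)
      have "(\<Sum>i=0..<l n. u m (real i * \<delta> n) \<bullet> (LINT r:cell (\<delta> n) i|lebesgue. \<phi> r)) \<le> V n"
        unfolding V_def lessThan_atLeast0
      proof (rule sum_mono)
        fix i
        show "u m (real i * \<delta> n) \<bullet> (LINT r:cell (\<delta> n) i|lebesgue. \<phi> r) \<le> norm (LINT r:cell (\<delta> n) i|lebesgue. \<phi> r)"
          using norm_cauchy_schwarz[of "u m (real i * \<delta> n)" "LINT r:cell (\<delta> n) i|lebesgue. \<phi> r"]
            mult_right_mono[OF u1[of m "real i * \<delta> n"] norm_ge_zero[of "LINT r:cell (\<delta> n) i|lebesgue. \<phi> r"]]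
          by linarith
      qed
      with elim show ?case by linarith
    qed
  qed
  show ?thesis
    unfolding V_def[symmetric] W_def[symmetric]
  proof (rule order_tendstoI)
    fix a assume "a < W"
    then show "eventually (\<lambda>n. a < V n) sequentially" using lower[of "W - a"] by simp
  next
    fix a assume "W < a"
    from order_tendstoD(2)[OF upper this] V_le
    show "eventually (\<lambda>n. V n < a) sequentially" by eventually_elim linarith
  qed
qed

section \<open>Running suprema of continuous paths and their grid versions\<close>

definition running_sup :: "(real \<Rightarrow> 'v::real_normed_vector) \<Rightarrow> real \<Rightarrow> real" where
  "running_sup X r = (SUP u\<in>{0..r}. norm (X u))"

lemma running_sup_upper:
  assumes X: "continuous_on {0..} X" and u: "0 \<le> u" "u \<le> r"
  shows "norm (X u) \<le> running_sup X r"
proof -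
  have "compact ((\<lambda>u. norm (X u)) ` {0..r})"
    by (intro compact_continuous_image continuous_intros continuous_on_subset[OF X]) auto
  then show ?thesis
    unfolding running_sup_def using u by (intro cSUP_upper bounded_imp_bdd_above compact_imp_bounded) auto
qed

lemma running_sup_least:
  assumes "0 \<le> r" "\<And>u. 0 \<le> u \<Longrightarrow> u \<le> r \<Longrightarrow> norm (X u) \<le> K"
  shows "running_sup X r \<le> K"
  unfolding running_sup_def using assms by (intro cSUP_least) auto

lemma running_sup_attained:
  assumes X: "continuous_on {0..} X" and r: "0 \<le> r"
  obtains u where "0 \<le> u" "u \<le> r" "norm (X u) = running_sup X r"
proof -
  have "continuous_on {0..r} (\<lambda>u. norm (X u))"
    by (intro continuous_intros continuous_on_subset[OF X]) auto
  from continuous_attains_sup[OF _ _ this] r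
  obtain u where u: "u \<in> {0..r}" "\<forall>v\<in>{0..r}. norm (X v) \<le> norm (X u)" by auto
  then have "norm (X u) = running_sup X r"
    using r running_sup_upper[OF X] by (intro antisym running_sup_least) auto
  with u that show ?thesis by auto
qed

lemma uniformly_continuous_initial:
  fixes X :: "real \<Rightarrow> 'v::real_normed_vector"
  assumes X: "continuous_on {0..} X" and "0 < e"
  obtains d where "0 < d" "\<And>u v. 0 \<le> u \<Longrightarrow> u \<le> T \<Longrightarrow> 0 \<le> v \<Longrightarrow> v \<le> T \<Longrightarrow> \<bar>u - v\<bar> < d \<Longrightarrow> norm (X u - X v) < e"
proof -
  have "uniformly_continuous_on {0..T} X"
    by (intro compact_uniformly_continuous continuous_on_subset[OF X]) auto
  from uniformly_continuous_onE[OF this \<open>0 < e\<close>] obtain d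
    where "0 < d" "\<And>x x'. x \<in> {0..T} \<Longrightarrow> x' \<in> {0..T} \<Longrightarrow> dist x' x < d \<Longrightarrow> dist (X x') (X x) < e"
    by blast
  then show ?thesis using that[of d] by (auto simp: dist_norm)
qed

text \<open>Between \<open>lo\<close> and \<open>hi\<close> the path exceeds its norm at
  \<open>lo\<close> by at most its modulus of continuity, and so does the running supremum.\<close>

lemma continuous_running_sup:
  fixes X :: "real \<Rightarrow> 'v::real_normed_vector"
  assumes X: "continuous_on {0..} X"
  shows "continuous_on {0..} (running_sup X)"
  unfolding continuous_on_iff
proof (intro ballI allI impI)
  fix r e :: real assume r: "r \<in> {0..}" and e: "0 < e"
  obtain d where d: "0 < d" "\<And>u v. 0 \<le> u \<Longrightarrow> u \<le> r + 1 \<Longrightarrow> 0 \<le> v \<Longrightarrow> v \<le> r + 1 \<Longrightarrow> \<bar>u - v\<bar> < d \<Longrightarrow> norm (X u - X v) < e / 2"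
    using uniformly_continuous_initial[OF X, of "e / 2" "r + 1"] e by auto
  have le: "\<bar>running_sup X hi - running_sup X lo\<bar> < e" if "0 \<le> lo" "lo \<le> hi" "hi \<le> r + 1" "hi - lo < d" for lo hi
  proof -
    have "running_sup X lo \<le> running_sup X hi"
      using that by (intro running_sup_least running_sup_upper[OF X]) auto
    moreover have "running_sup X hi \<le> running_sup X lo + e / 2"
    proof (rule running_sup_least)
      fix u assume u: "0 \<le> u" "u \<le> hi"
      show "norm (X u) \<le> running_sup X lo + e / 2"
      proof (cases "u \<le> lo")
        case True
        then show ?thesis using running_sup_upper[OF X u(1) True] e by simp
      next
        case False
        then have "norm (X u - X lo) < e / 2" using d(2)[of u lo] u that by auto
        then show ?thesis
          using running_sup_upper[OF X that(1) order_refl] norm_triangle_ineq2[of "X u" "X lo"] by linarith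
      qed
    qed (use that in simp)
    ultimately show ?thesis using e by linarith
  qed
  show "\<exists>d>0. \<forall>x'\<in>{0..}. dist x' r < d \<longrightarrow> dist (running_sup X x') (running_sup X r) < e"
  proof (intro exI[of _ "min d 1"] conjI ballI impI)
    fix x' assume x': "x' \<in> {0..}" "dist x' r < min d 1"
    show "dist (running_sup X x') (running_sup X r) < e"
      using le[of x' r] le[of r x'] x' r by (cases "x' \<le> r") (auto simp: dist_real_def)
  qed (use d in auto)
qed

lemma grid_value_tendsto:
  fixes X :: "real \<Rightarrow> 'v::real_normed_vector"
  assumes \<delta>: "\<And>n. 0 < \<delta> n" and X: "continuous_on {0..} X"
    and near: "\<And>T e. 0 < e \<Longrightarrow> \<forall>\<^sub>F n in sequentially. \<forall>i. real i * \<delta> n \<le> T \<longrightarrow> norm (Y n i - X (real i * \<delta> n)) < e"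
    and t: "(\<lambda>n. real (l n) * \<delta> n) \<longlonglongrightarrow> t" "0 \<le> t"
  shows "(\<lambda>n. Y n (l n)) \<longlonglongrightarrow> X t"
proof -
  have pos: "0 \<le> real (l n) * \<delta> n" for n using less_imp_le[OF \<delta>[of n]] by simp
  have 1: "(\<lambda>n. X (real (l n) * \<delta> n)) \<longlonglongrightarrow> X t"
    by (rule continuous_on_tendsto_compose[OF X t(1)]) (use t pos in auto)
  have 2: "(\<lambda>n. Y n (l n) - X (real (l n) * \<delta> n)) \<longlonglongrightarrow> 0"
  proof (rule tendstoI)
    fix e :: real assume "0 < e"
    have "eventually (\<lambda>n. real (l n) * \<delta> n < t + 1) sequentially" using order_tendstoD(2)[OF t(1)] by simp
    then show "eventually (\<lambda>n. dist (Y n (l n) - X (real (l n) * \<delta> n)) 0 < e) sequentially"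
      using near[OF \<open>0 < e\<close>, of "t + 1"] by eventually_elim auto
  qed
  show ?thesis using tendsto_add[OF 1 2] by simp
qed

text \<open>The upper estimate is immediate from uniform closeness on the grid. For the lower one
  the point where the path attains its supremum is rounded down to the grid: this costs one modulus
  of continuity and keeps the index at most \<open>l n\<close>.\<close>

lemma grid_max_tendsto:
  fixes X :: "real \<Rightarrow> 'v::real_normed_vector"
  assumes \<delta>: "\<And>n. 0 < \<delta> n" "\<delta> \<longlonglongrightarrow> 0" and X: "continuous_on {0..} X"
    and near: "\<And>T e. 0 < e \<Longrightarrow> \<forall>\<^sub>F n in sequentially. \<forall>i. real i * \<delta> n \<le> T \<longrightarrow> norm (Y n i - X (real i * \<delta> n)) < e"
    and t: "(\<lambda>n. real (l n) * \<delta> n) \<longlonglongrightarrow> t" "0 \<le> t"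
  shows "(\<lambda>n. Max ((\<lambda>j. norm (Y n j)) ` {..l n})) \<longlonglongrightarrow> running_sup X t"
proof -
  define m where "m n = Max ((\<lambda>j. norm (Y n j)) ` {..l n})" for n
  have pos: "0 \<le> real i * \<delta> n" for i n using less_imp_le[OF \<delta>(1)[of n]] by simp
  have 1: "(\<lambda>n. running_sup X (real (l n) * \<delta> n)) \<longlonglongrightarrow> running_sup X t"
    by (rule continuous_on_tendsto_compose[OF continuous_running_sup[OF X] t(1)]) (use t pos in auto)
  have 2: "(\<lambda>n. m n - running_sup X (real (l n) * \<delta> n)) \<longlonglongrightarrow> 0"
  proof (rule tendstoI)
    fix e' :: real assume "0 < e'"
    define e where "e = e' / 3"
    have e: "0 < e" using \<open>0 < e'\<close> by (simp add: e_def)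
    obtain d where d: "0 < d" "\<And>u v. 0 \<le> u \<Longrightarrow> u \<le> t + 1 \<Longrightarrow> 0 \<le> v \<Longrightarrow> v \<le> t + 1 \<Longrightarrow> \<bar>u - v\<bar> < d \<Longrightarrow> norm (X u - X v) < e"
      using uniformly_continuous_initial[OF X e, of "t + 1"] by blast
    have "eventually (\<lambda>n. real (l n) * \<delta> n < t + 1) sequentially" using order_tendstoD(2)[OF t(1)] by simp
    moreover have "eventually (\<lambda>n. \<delta> n < d) sequentially" using order_tendstoD(2)[OF \<delta>(2) d(1)] .
    ultimately show "eventually (\<lambda>n. dist (m n - running_sup X (real (l n) * \<delta> n)) 0 < e') sequentially"
      using near[OF e, of "t + 1"]
    proof eventually_elim
      case (elim n)
      let ?r = "real (l n) * \<delta> n"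
      have le_r: "real j * \<delta> n \<le> ?r" if "j \<le> l n" for j using that less_imp_le[OF \<delta>(1)[of n]] by (intro mult_right_mono) auto
      have nr: "norm (Y n j - X (real j * \<delta> n)) < e" if "j \<le> l n" for j
        using elim le_r[OF that] by (meson less_imp_le order_trans)
      have "m n \<le> running_sup X ?r + e"
        unfolding m_def
      proof (rule Max.boundedI)
        fix y assume "y \<in> (\<lambda>j. norm (Y n j)) ` {..l n}"
        then obtain j where j: "j \<le> l n" "y = norm (Y n j)" by auto
        show "y \<le> running_sup X ?r + e"
          using nr[OF j(1)] running_sup_upper[OF X pos le_r[OF j(1)]] norm_triangle_ineq2[of "Y n j" "X (real j * \<delta> n)"]
          unfolding j(2) by linarith
      qed auto
      moreover have "running_sup X ?r - 2 * e \<le> m n"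
      proof -
        obtain u where u: "0 \<le> u" "u \<le> ?r" "norm (X u) = running_sup X ?r"
          using running_sup_attained[OF X pos] by blast
        define j where "j = grid_index (\<delta> n) u"
        have j: "real j * \<delta> n \<le> u" "u < real (Suc j) * \<delta> n"
          using grid_index_bounds[OF \<delta>(1) u(1)] by (auto simp: j_def)
        have "real j * \<delta> n \<le> real (l n) * \<delta> n" using j(1) u(2) by linarith
        then have jl: "j \<le> l n" using \<delta>(1)[of n] by simp
        have "\<bar>u - real j * \<delta> n\<bar> < d" using j elim by (simp add: algebra_simps)
        then have "norm (X u - X (real j * \<delta> n)) < e"
          using d(2)[of u "real j * \<delta> n"] u j pos elim by (metis less_imp_le order_trans)
        then have "running_sup X ?r - 2 * e \<le> norm (Y n j)"
          using nr[OF jl] u(3) norm_triangle_ineq2[of "X u" "X (real j * \<delta> n)"]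
            norm_triangle_ineq2[of "X (real j * \<delta> n)" "Y n j"] norm_minus_commute[of "Y n j" "X (real j * \<delta> n)"] by linarith
        also have "\<dots> \<le> m n" unfolding m_def using jl by (intro Max_ge) auto
        finally show ?thesis .
      qed
      ultimately show ?case using e by (simp add: e_def)
    qed
  qed
  show ?thesis using tendsto_add[OF 1 2] by (simp add: m_def)
qed

lemma set_integral_le_superset:
  fixes \<psi> :: "real \<Rightarrow> real"
  assumes "set_integrable M B \<psi>" "A \<in> sets M" "A \<subseteq> B" "\<And>r. 0 \<le> \<psi> r"
  shows "(LINT r:A|M. \<psi> r) \<le> (LINT r:B|M. \<psi> r)"
  unfolding set_lebesgue_integral_def
proof (rule integral_mono)
  show "integrable M (\<lambda>x. indicat_real A x *\<^sub>R \<psi> x)"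
    using set_integrable_subset[OF assms(1-3)] unfolding set_integrable_def .
  show "integrable M (\<lambda>x. indicat_real B x *\<^sub>R \<psi> x)"
    using assms(1) unfolding set_integrable_def .
qed (use assms in \<open>auto simp: indicator_def\<close>)

text \<open>Replacing \<open>\<psi>' n\<close> by \<psi> changes the sum by at most \<open>K\<close>
  times their L1 distance, as the cells are disjoint. Here the integrated density itself varies with
  \<open>n\<close>: it will be the squared norm of the approximating simple process.\<close>

lemma grid_sum_tendsto_approx:
  fixes \<psi> h' :: "real \<Rightarrow> real" and \<psi>' h :: "nat \<Rightarrow> _ \<Rightarrow> real"
  assumes \<delta>: "\<And>n. 0 < \<delta> n" "\<delta> \<longlonglongrightarrow> 0" and \<psi>: "set_integrable lebesgue {0..T} \<psi>"
    and \<psi>': "\<And>n. set_integrable lebesgue {0..T} (\<psi>' n)"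
    and lim: "(\<lambda>n. LINT r:{0..T}|lebesgue. \<bar>\<psi>' n r - \<psi> r\<bar>) \<longlonglongrightarrow> 0"
    and s: "(\<lambda>n. real (k n) * \<delta> n) \<longlonglongrightarrow> s" and t: "(\<lambda>n. real (l n) * \<delta> n) \<longlonglongrightarrow> t"
    and kl: "\<And>n. k n \<le> l n" and st: "0 \<le> s" "s \<le> t" "t < T"
    and K: "\<And>n i. \<bar>h n i\<bar> \<le> K"
    and h: "\<And>r. 0 \<le> r \<Longrightarrow> r \<le> T \<Longrightarrow> (\<lambda>n. h n (grid_index (\<delta> n) r)) \<longlonglongrightarrow> h' r"
  shows "(\<lambda>n. \<Sum>i=k n..<l n. h n i * (LINT r:cell (\<delta> n) i|lebesgue. \<psi>' n r)) \<longlonglongrightarrow>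
     (LINT r:{s..<t}|lebesgue. h' r * \<psi> r)"
proof -
  have K0: "0 \<le> K" using K[of 0 0] by linarith
  have 1: "(\<lambda>n. \<Sum>i=k n..<l n. h n i * (LINT r:cell (\<delta> n) i|lebesgue. \<psi> r)) \<longlonglongrightarrow> (LINT r:{s..<t}|lebesgue. h' r * \<psi> r)"
    using grid_sum_tendsto[OF \<delta> \<psi> s t kl st, of h K h'] K h by simp
  have ev: "eventually (\<lambda>n. real (l n) * \<delta> n < T) sequentially"
    using order_tendstoD(2)[OF t st(3)] .
  have "(\<lambda>n. (\<Sum>i=k n..<l n. h n i * (LINT r:cell (\<delta> n) i|lebesgue. \<psi>' n r)) -
      (\<Sum>i=k n..<l n. h n i * (LINT r:cell (\<delta> n) i|lebesgue. \<psi> r))) \<longlonglongrightarrow> 0"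
  proof (rule Lim_null_comparison[of _ "\<lambda>n. K * (LINT r:{0..T}|lebesgue. \<bar>\<psi>' n r - \<psi> r\<bar>)"])
    show "(\<lambda>n. K * (LINT r:{0..T}|lebesgue. \<bar>\<psi>' n r - \<psi> r\<bar>)) \<longlonglongrightarrow> 0"
      using tendsto_mult_left[OF lim, of K] by simp
    show "eventually (\<lambda>n. norm ((\<Sum>i=k n..<l n. h n i * (LINT r:cell (\<delta> n) i|lebesgue. \<psi>' n r)) -
      (\<Sum>i=k n..<l n. h n i * (LINT r:cell (\<delta> n) i|lebesgue. \<psi> r)))
       \<le> K * (LINT r:{0..T}|lebesgue. \<bar>\<psi>' n r - \<psi> r\<bar>)) sequentially"
      using ev
    proof eventually_elim
      case (elim n)
      have i: "set_integrable lebesgue {0..T} (\<lambda>r. \<bar>\<psi>' n r - \<psi> r\<bar>)"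
        using set_integrable_abs[OF set_integral_diff(1)[OF \<psi>'[of n] \<psi>]] .
      have sub: "{real (k n) * \<delta> n..<real (l n) * \<delta> n} \<subseteq> {0..T}"
        by (intro grid_interval_subset \<delta>(1) elim)
      have "norm ((\<Sum>i=k n..<l n. h n i * (LINT r:cell (\<delta> n) i|lebesgue. \<psi>' n r)) -
          (\<Sum>i=k n..<l n. h n i * (LINT r:cell (\<delta> n) i|lebesgue. \<psi> r))) =
          norm (\<Sum>i=k n..<l n. h n i * ((LINT r:cell (\<delta> n) i|lebesgue. \<psi>' n r) - (LINT r:cell (\<delta> n) i|lebesgue. \<psi> r)))"
        by (simp add: sum_subtractf right_diff_distrib)
      also have "\<dots> \<le> (\<Sum>i=k n..<l n. K * (LINT r:cell (\<delta> n) i|lebesgue. \<bar>\<psi>' n r - \<psi> r\<bar>))"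
      proof (rule order_trans[OF norm_sum], rule sum_mono)
        fix i assume "i \<in> {k n..<l n}"
        then have ss: "cell (\<delta> n) i \<subseteq> {0..T}" "cell (\<delta> n) i \<in> sets lebesgue"
          using cell_subset[OF \<delta>(1), of i "l n" n] elim by (auto simp: cell_def)
        note a = set_integrable_subset[OF \<psi>'[of n] ss(2,1)] and b = set_integrable_subset[OF \<psi> ss(2,1)]
        have "\<bar>(LINT r:cell (\<delta> n) i|lebesgue. \<psi>' n r) - (LINT r:cell (\<delta> n) i|lebesgue. \<psi> r)\<bar> =
            \<bar>LINT r:cell (\<delta> n) i|lebesgue. \<psi>' n r - \<psi> r\<bar>"
          using set_integral_diff(2)[OF a b] by simp
        also have "\<dots> \<le> (LINT r:cell (\<delta> n) i|lebesgue. \<bar>\<psi>' n r - \<psi> r\<bar>)"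
          using set_integral_norm_bound[OF set_integral_diff(1)[OF a b]] by simp
        finally show "norm (h n i * ((LINT r:cell (\<delta> n) i|lebesgue. \<psi>' n r) - (LINT r:cell (\<delta> n) i|lebesgue. \<psi> r)))
          \<le> K * (LINT r:cell (\<delta> n) i|lebesgue. \<bar>\<psi>' n r - \<psi> r\<bar>)"
          unfolding norm_mult real_norm_def abs_mult using K0 by (intro mult_mono K) auto
      qed
      also have "\<dots> = K * (LINT r:{real (k n) * \<delta> n..<real (l n) * \<delta> n}|lebesgue. \<bar>\<psi>' n r - \<psi> r\<bar>)"
        using grid_sum_eq_integral(2)[OF \<delta>(1) kl set_integrable_subset[OF i _ sub], of "\<lambda>_. 1"]
        by (simp flip: sum_distrib_left)
      also have "\<dots> \<le> K * (LINT r:{0..T}|lebesgue. \<bar>\<psi>' n r - \<psi> r\<bar>)"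
        using K0 by (intro mult_left_mono set_integral_le_superset[OF i _ sub]) auto
      finally show ?case .
    qed
  qed
  from tendsto_add[OF this 1] show ?thesis by simp
qed

section \<open>Square integrals along a path and the continuous-time cost\<close>

lemma continuous_on_set_integral:
  fixes \<psi> :: "real \<Rightarrow> real"
  assumes \<psi>: "\<And>T. set_integrable lebesgue {0..T} \<psi>"
  shows "continuous_on {0..} (\<lambda>t. LINT r:{0..<t}|lebesgue. \<psi> r)"
  unfolding continuous_on_sequentially
proof (intro allI ballI impI)
  fix x a assume "a \<in> {0::real..}" and x: "(\<forall>n. x n \<in> {0..}) \<and> x \<longlonglongrightarrow> a"
  define w where "w r = indicator {0..a + 1} r *\<^sub>R \<psi> r" for r
  have iw: "integrable lebesgue w" using \<psi>[of "a + 1"] by (simp add: w_def[abs_def] set_integrable_def)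
  have "(\<lambda>n. LINT r|lebesgue. indicator {0..<x n} r *\<^sub>R w r) \<longlonglongrightarrow> (LINT r|lebesgue. indicator {0..<a} r *\<^sub>R w r)"
  proof (rule integral_dominated_convergence[where w = "\<lambda>r. norm (w r)"])
    note AE_lebesgue_neq[of a]
    then show "AE r in lebesgue. (\<lambda>n. indicator {0..<x n} r *\<^sub>R w r) \<longlonglongrightarrow> indicator {0..<a} r *\<^sub>R w r"
    proof eventually_elim
      case (elim r)
      have "eventually (\<lambda>n. r < x n \<longleftrightarrow> r < a) sequentially"
        using x elim by (intro eventually_less_tendsto_iff) auto
      then have "eventually (\<lambda>n. indicator {0..<x n} r = (indicator {0..<a} r :: real)) sequentially"
        by eventually_elim (auto simp: indicator_def)
      then show ?case by (intro tendsto_scaleR tendsto_const tendsto_eventually)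
    qed
    show "AE r in lebesgue. norm (indicator {0..<x n} r *\<^sub>R w r) \<le> norm (w r)" for n
      by (auto simp: indicator_def)
  qed (use iw in \<open>auto intro!: borel_measurable_scaleR borel_measurable_lebesgue_indicator_atLeastLessThan\<close>)
  then have lim: "(\<lambda>n. LINT r|lebesgue. indicator {0..<x n} r *\<^sub>R w r) \<longlonglongrightarrow> (LINT r|lebesgue. indicator {0..<a} r *\<^sub>R w r)" .
  have eq: "(LINT r|lebesgue. indicator {0..<u} r *\<^sub>R w r) = (LINT r:{0..<u}|lebesgue. \<psi> r)" if "u < a + 1" for u
    unfolding set_lebesgue_integral_def using that
    by (intro Bochner_Integration.integral_cong) (auto simp: w_def indicator_def)
  have ev: "eventually (\<lambda>n. (LINT r|lebesgue. indicator {0..<x n} r *\<^sub>R w r) = (LINT r:{0..<x n}|lebesgue. \<psi> r)) sequentially"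
  proof (rule eventually_mono)
    show "eventually (\<lambda>n. x n < a + 1) sequentially"
      using order_tendstoD(2)[of x a sequentially "a + 1"] x by simp
  qed (rule eq)
  have "(\<lambda>n. LINT r:{0..<x n}|lebesgue. \<psi> r) \<longlonglongrightarrow> (LINT r|lebesgue. indicator {0..<a} r *\<^sub>R w r)"
    by (rule Lim_transform_eventually[OF lim ev])
  then show "((\<lambda>t. LINT r:{0..<t}|lebesgue. \<psi> r) \<circ> x) \<longlonglongrightarrow> (LINT r:{0..<a}|lebesgue. \<psi> r)"
    unfolding o_def using eq[of a] by simp
qed

text \<open>L2 convergence implies L1 convergence of the squared norms. Instead of the
  Cauchy-Schwarz inequality for integrals, a pointwise Young inequality with a free parameter
  \<theta> is integrated, and \<theta> is fixed only when the tolerance is given.\<close>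

lemma set_integral_tendsto_norm_power2_diff:
  fixes H :: "real \<Rightarrow> 'v::euclidean_space" and P :: "nat \<Rightarrow> real \<Rightarrow> 'v"
  assumes H: "set_integrable lebesgue A (\<lambda>r. (norm (H r))\<^sup>2)"
    and P: "\<And>n. set_integrable lebesgue A (\<lambda>r. (norm (P n r))\<^sup>2)"
    and D: "\<And>n. set_integrable lebesgue A (\<lambda>r. (norm (P n r - H r))\<^sup>2)"
    and lim: "(\<lambda>n. LINT r:A|lebesgue. (norm (P n r - H r))\<^sup>2) \<longlonglongrightarrow> 0"
  shows "(\<lambda>n. LINT r:A|lebesgue. \<bar>(norm (P n r))\<^sup>2 - (norm (H r))\<^sup>2\<bar>) \<longlonglongrightarrow> 0"
proof -
  define a where "a = (LINT r:A|lebesgue. (norm (H r))\<^sup>2)"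
  define d where "d n = (LINT r:A|lebesgue. (norm (P n r - H r))\<^sup>2)" for n
  define L where "L n = (LINT r:A|lebesgue. \<bar>(norm (P n r))\<^sup>2 - (norm (H r))\<^sup>2\<bar>)" for n
  have a0: "0 \<le> a" unfolding a_def set_lebesgue_integral_def by (intro integral_nonneg_AE) auto
  have L0: "0 \<le> L n" for n unfolding L_def set_lebesgue_integral_def by (intro integral_nonneg_AE) auto
  have pt: "\<bar>(norm p)\<^sup>2 - (norm h)\<^sup>2\<bar> \<le> (1 + 1 / \<theta>) * (norm (p - h))\<^sup>2 + \<theta> * (norm h)\<^sup>2"
    if "0 < \<theta>" for p h :: 'v and \<theta> :: real
  proof -
    let ?x = "norm (p - h)" and ?y = "norm h"
    have "(norm p)\<^sup>2 - (norm h)\<^sup>2 = ?x\<^sup>2 + 2 * ((p - h) \<bullet> h)"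
      by (simp add: power2_norm_eq_inner inner_diff_left inner_diff_right inner_commute)
    then have "\<bar>(norm p)\<^sup>2 - (norm h)\<^sup>2\<bar> \<le> ?x\<^sup>2 + 2 * (?x * ?y)"
      using Cauchy_Schwarz_ineq2[of "p - h" h] zero_le_power2[of ?x] by linarith
    also have "2 * (?x * ?y) \<le> ?x\<^sup>2 / \<theta> + \<theta> * ?y\<^sup>2"
    proof -
      have "0 \<le> (?x - \<theta> * ?y)\<^sup>2 / \<theta>" using that by simp
      also have "\<dots> = ?x\<^sup>2 / \<theta> + \<theta> * ?y\<^sup>2 - 2 * (?x * ?y)"
        using that by (simp add: power2_eq_square field_simps)
      finally show ?thesis by simp
    qed
    finally show ?thesis by (simp add: algebra_simps)
  qed
  have Lle: "L n \<le> (1 + 1 / \<theta>) * d n + \<theta> * a" if "0 < \<theta>" for \<theta> n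
  proof -
    have "L n \<le> (LINT r:A|lebesgue. (1 + 1 / \<theta>) * (norm (P n r - H r))\<^sup>2 + \<theta> * (norm (H r))\<^sup>2)"
      unfolding L_def
    proof (rule set_integral_mono)
      show "set_integrable lebesgue A (\<lambda>r. \<bar>(norm (P n r))\<^sup>2 - (norm (H r))\<^sup>2\<bar>)"
        by (intro set_integrable_abs set_integral_diff(1) P H)
      show "set_integrable lebesgue A (\<lambda>r. (1 + 1 / \<theta>) * (norm (P n r - H r))\<^sup>2 + \<theta> * (norm (H r))\<^sup>2)"
        by (intro set_integral_add(1) set_integrable_mult_right H D)
    qed (rule pt[OF that])
    also have "\<dots> = (1 + 1 / \<theta>) * d n + \<theta> * a"
      unfolding d_def a_def
      by (subst set_integral_add(2)) (intro set_integrable_mult_right H D | simp)+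
    finally show ?thesis .
  qed
  have "L \<longlonglongrightarrow> 0"
  proof (rule tendstoI)
    fix e :: real assume e: "0 < e"
    \<comment> \<open>Chosen so that \<open>\<theta> * a \<le> e / 2\<close>; the summand 1 covers
      the case \<open>a = 0\<close>. The remaining room is left to the term with
      \<open>d n\<close>.\<close>
    define \<theta> where "\<theta> = e / (2 * (a + 1))"
    have \<theta>: "0 < \<theta>" "\<theta> * a < e / 2 + e / 4" 
    proof -
      show "0 < \<theta>" using e a0 by (simp add: \<theta>_def)
      have "\<theta> * a \<le> \<theta> * (a + 1)" using \<open>0 < \<theta>\<close> by simp
      also have "\<dots> = e / 2" using a0 by (simp add: \<theta>_def field_simps)
      finally show "\<theta> * a < e / 2 + e / 4" using e by simp
    qed
    have "(\<lambda>n. (1 + 1 / \<theta>) * d n) \<longlonglongrightarrow> 0"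
      using tendsto_mult_left[OF lim, of "1 + 1 / \<theta>"] by (simp add: d_def)
    from order_tendstoD(2)[OF this, of "e / 4"] e
    have "eventually (\<lambda>n. (1 + 1 / \<theta>) * d n < e / 4) sequentially" by simp
    then show "eventually (\<lambda>n. dist (L n) 0 < e) sequentially"
    proof eventually_elim
      case (elim n)
      have "L n < e / 4 + (e / 2 + e / 4)" using Lle[OF \<theta>(1), of n] elim \<theta>(2) by linarith
      then show ?case using L0[of n] by (simp add: dist_real_def)
    qed
  qed
  then show ?thesis by (simp add: L_def[abs_def])
qed

text \<open>The steps are disjoint, so at each time at most one summand is nonzero and the squared
  norm of the sum is the sum of the squared norms. Each step then contributes the length of its part
  in \<open>[s, t)\<close>.\<close>

lemma simple_energy_eq_integral:
  fixes \<xi> :: "nat \<Rightarrow> 'a \<Rightarrow> real^'m^'d"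
  assumes \<tau>: "\<And>i. i < k \<Longrightarrow> \<tau> i < \<tau> (Suc i)" and st: "s \<le> t"
  shows "set_integrable lebesgue {s..<t} (\<lambda>r. (norm (simple_process k \<tau> \<xi> r \<omega>))\<^sup>2)"
    and "simple_energy k \<tau> \<xi> s t \<omega> = (LINT r:{s..<t}|lebesgue. (norm (simple_process k \<tau> \<xi> r \<omega>))\<^sup>2)"
proof -
  have mono: "\<tau> i \<le> \<tau> j" if "i \<le> j" "j \<le> k" for i j
    using that
  proof (induction j rule: dec_induct)
    case (step n)
    then show ?case using \<tau>[of n] by simp
  qed simp
  have sq: "(norm (simple_process k \<tau> \<xi> r \<omega>))\<^sup>2 = (\<Sum>i<k. indicator {\<tau> i<..\<tau> (Suc i)} r * (norm (\<xi> i \<omega>))\<^sup>2)" for r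
  proof (cases "\<exists>i<k. \<tau> i < r \<and> r \<le> \<tau> (Suc i)")
    case False
    then have "simple_process k \<tau> \<xi> r \<omega> = 0"
      "(\<Sum>i<k. indicator {\<tau> i<..\<tau> (Suc i)} r * (norm (\<xi> i \<omega>))\<^sup>2) = 0"
      unfolding simple_process_def by (auto intro!: sum.neutral)
    then show ?thesis by simp
  next
    case True
    then obtain i where i: "i < k" "\<tau> i < r" "r \<le> \<tau> (Suc i)" by blast
    have ne: "\<not> (\<tau> j < r \<and> r \<le> \<tau> (Suc j))" if "j < k" "j \<noteq> i" for j
      using mono[of "Suc j" i] mono[of "Suc i" j] i that by (cases "j < i") auto
    have iff: "(\<tau> j < r \<and> r \<le> \<tau> (Suc j)) = (j = i)" if "j < k" for j
      using i ne[OF that] by auto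
    have "simple_process k \<tau> \<xi> r \<omega> = (\<Sum>j<k. if j = i then \<xi> j \<omega> else 0)"
      unfolding simple_process_def by (intro sum.cong refl) (simp add: iff)
    moreover have "(\<Sum>i<k. indicator {\<tau> i<..\<tau> (Suc i)} r * (norm (\<xi> i \<omega>))\<^sup>2) =
        (\<Sum>j<k. if j = i then (norm (\<xi> j \<omega>))\<^sup>2 else 0)"
      by (intro sum.cong refl) (simp add: indicator_def iff)
    moreover note i(1)
    ultimately show ?thesis by simp
  qed
  \<comment> \<open>Steps are closed on the right, cells on the left. The intersection is therefore
    squeezed between the open and the closed interval with the projected end points, which have
    equal length.\<close>
  have L: "set_integrable lebesgue {s..<t} (indicator {a<..b} :: real \<Rightarrow> real)"
    "(LINT r:{s..<t}|lebesgue. (indicator {a<..b} r :: real)) = clip_time s t b - clip_time s t a"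
    if "a < b" for a b
  proof -
    let ?E = "{s..<t} \<inter> {a<..b}" and ?u = "clip_time s t a" and ?v = "clip_time s t b"
    have uv: "?u \<le> ?v" using clip_time_simps(3)[OF st] that by simp
    have sub: "{?u<..<?v} \<subseteq> ?E" "?E \<subseteq> {?u..?v}"
      using st that by (auto simp: clip_time_def)
    have box: "{?u..?v} \<in> fmeasurable lborel" by (auto intro!: fmeasurableI simp: emeasure_lborel_Icc_eq)
    have E: "?E \<in> fmeasurable lborel"
      using fmeasurableI2[OF box sub(2)] by simp
    have "measure lborel {?u<..<?v} \<le> measure lborel ?E"
      by (rule measure_mono_fmeasurable[OF sub(1) _ E]) simp
    moreover have "measure lborel ?E \<le> measure lborel {?u..?v}"
      by (rule measure_mono_fmeasurable[OF sub(2) _ box]) simp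
    ultimately have "measure lborel ?E = ?v - ?u" using uv by simp
    moreover have "indicator {s..<t} r *\<^sub>R indicator {a<..b} r = (indicator ?E r :: real)" for r
      by (auto simp: indicator_def)
    ultimately show "set_integrable lebesgue {s..<t} (indicator {a<..b} :: real \<Rightarrow> real)"
      "(LINT r:{s..<t}|lebesgue. (indicator {a<..b} r :: real)) = ?v - ?u"
      using E unfolding set_integrable_def set_lebesgue_integral_def by (auto simp: fmeasurable_def)
  qed
  have int: "set_integrable lebesgue {s..<t} (\<lambda>r. indicator {\<tau> i<..\<tau> (Suc i)} r * (norm (\<xi> i \<omega>))\<^sup>2)" if "i < k" for i
    using L(1)[OF \<tau>[OF that]] by (intro set_integrable_mult_left) auto
  show "set_integrable lebesgue {s..<t} (\<lambda>r. (norm (simple_process k \<tau> \<xi> r \<omega>))\<^sup>2)"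
    using int unfolding sq set_integrable_def scaleR_sum_right
    by (intro Bochner_Integration.integrable_sum) auto
  have "(LINT r:{s..<t}|lebesgue. (norm (simple_process k \<tau> \<xi> r \<omega>))\<^sup>2) =
      (\<Sum>i<k. LINT r:{s..<t}|lebesgue. indicator {\<tau> i<..\<tau> (Suc i)} r * (norm (\<xi> i \<omega>))\<^sup>2)"
    using int unfolding sq set_integrable_def set_lebesgue_integral_def scaleR_sum_right
    by (intro Bochner_Integration.integral_sum) auto
  also have "\<dots> = simple_energy k \<tau> \<xi> s t \<omega>"
    unfolding simple_energy_def by (intro sum.cong refl) (simp add: L(2) \<tau>)
  finally show "simple_energy k \<tau> \<xi> s t \<omega> = (LINT r:{s..<t}|lebesgue. (norm (simple_process k \<tau> \<xi> r \<omega>))\<^sup>2)" ..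
qed

text \<open>The limit of \<open>grid_cost\<close> as the mesh shrinks: \<phi> is the density of the
  finite variation part and \<psi> the squared norm of the stochastic integrand.\<close>

definition path_cost :: "(real \<Rightarrow> 'v::real_normed_vector) \<Rightarrow> (real \<Rightarrow> 'v) \<Rightarrow> (real \<Rightarrow> real) \<Rightarrow> real \<Rightarrow> real" where
  "path_cost X \<phi> \<psi> t =
     (LINT r:{0..<t}|lebesgue. norm (\<phi> r)) + (LINT r:{0..<t}|lebesgue. \<psi> r) + running_sup X t"

lemma path_cost_facts:
  fixes X :: "real \<Rightarrow> 'v::euclidean_space"
  assumes X: "continuous_on {0..} X" and \<phi>: "\<And>T. set_integrable lebesgue {0..T} \<phi>"
    and \<psi>: "\<And>T. set_integrable lebesgue {0..T} \<psi>" "\<And>r. 0 \<le> \<psi> r"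
  shows "continuous_on {0..} (path_cost X \<phi> \<psi>)"
    and "0 \<le> s \<Longrightarrow> s \<le> t \<Longrightarrow> path_cost X \<phi> \<psi> s \<le> path_cost X \<phi> \<psi> t"
    and "0 \<le> t \<Longrightarrow> norm (X t) \<le> path_cost X \<phi> \<psi> t"
proof -
  have n\<phi>: "set_integrable lebesgue {0..T} (\<lambda>r. norm (\<phi> r))" for T using set_integrable_norm[OF \<phi>] .
  show "continuous_on {0..} (path_cost X \<phi> \<psi>)"
    unfolding path_cost_def[abs_def]
    by (intro continuous_intros continuous_on_set_integral n\<phi> \<psi> continuous_running_sup X)
  show "path_cost X \<phi> \<psi> s \<le> path_cost X \<phi> \<psi> t" if "0 \<le> s" "s \<le> t"
    unfolding path_cost_def
  proof (intro add_mono)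
    show "running_sup X s \<le> running_sup X t"
      using that by (intro running_sup_least running_sup_upper[OF X]) auto
    show "(LINT r:{0..<s}|lebesgue. norm (\<phi> r)) \<le> (LINT r:{0..<t}|lebesgue. norm (\<phi> r))"
      "(LINT r:{0..<s}|lebesgue. \<psi> r) \<le> (LINT r:{0..<t}|lebesgue. \<psi> r)"
      using that \<psi>(2)
      by (intro set_integral_le_superset set_integrable_subset[OF n\<phi>[of t]] set_integrable_subset[OF \<psi>(1)[of t]]; force)+
  qed
  show "norm (X t) \<le> path_cost X \<phi> \<psi> t" if "0 \<le> t"
  proof -
    have "0 \<le> (LINT r:{0..<t}|lebesgue. norm (\<phi> r))" "0 \<le> (LINT r:{0..<t}|lebesgue. \<psi> r)"
      unfolding set_lebesgue_integral_def using \<psi>(2) by (auto intro!: integral_nonneg_AE)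
    then show ?thesis using running_sup_upper[OF X that order_refl] by (simp add: path_cost_def)
  qed
qed

lemma grid_cost_tendsto:
  fixes X :: "real \<Rightarrow> 'v::euclidean_space"
  assumes \<delta>: "\<And>n. 0 < \<delta> n" "\<delta> \<longlonglongrightarrow> 0" and X: "continuous_on {0..} X"
    and \<phi>: "\<And>T. set_integrable lebesgue {0..T} \<phi>"
    and \<psi>: "\<And>T. set_integrable lebesgue {0..T} \<psi>" and \<psi>': "\<And>n T. set_integrable lebesgue {0..T} (\<psi>' n)"
    and lim: "\<And>T. (\<lambda>n. LINT r:{0..T}|lebesgue. \<bar>\<psi>' n r - \<psi> r\<bar>) \<longlonglongrightarrow> 0"
    and near: "\<And>T e. 0 < e \<Longrightarrow> \<forall>\<^sub>F n in sequentially. \<forall>i. real i * \<delta> n \<le> T \<longrightarrow> norm (Y n i - X (real i * \<delta> n)) < e"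
    and A: "\<And>n i. A n (Suc i) - A n i = (LINT r:cell (\<delta> n) i|lebesgue. \<phi> r)"
    and Q: "\<And>n i. Q n i = (LINT r:cell (\<delta> n) i|lebesgue. \<psi>' n r)"
    and t: "(\<lambda>n. real (l n) * \<delta> n) \<longlonglongrightarrow> t" "0 \<le> t"
  shows "(\<lambda>n. grid_cost (Y n) (A n) (Q n) (l n)) \<longlonglongrightarrow> path_cost X \<phi> \<psi> t"
  unfolding grid_cost_def path_cost_def A Q
proof (intro tendsto_add)
  show "(\<lambda>n. Max ((\<lambda>j. norm (Y n j)) ` {..l n})) \<longlonglongrightarrow> running_sup X t"
    by (rule grid_max_tendsto[OF \<delta> X near t])
  show "(\<lambda>n. \<Sum>j<l n. norm (LINT r:cell (\<delta> n) j|lebesgue. \<phi> r)) \<longlonglongrightarrow> (LINT r:{0..<t}|lebesgue. norm (\<phi> r))"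
    by (rule grid_variation_tendsto[OF \<delta> \<phi>[of "t + 1"] t]) simp
  show "(\<lambda>n. \<Sum>j<l n. LINT r:cell (\<delta> n) j|lebesgue. \<psi>' n r) \<longlonglongrightarrow> (LINT r:{0..<t}|lebesgue. \<psi> r)"
    using grid_sum_tendsto_approx[OF \<delta> \<psi>[of "t + 1"] \<psi>' lim _ t(1) _ order_refl t(2), where k = "\<lambda>_. 0" and h = "\<lambda>_ _. 1" and K = 1 and h' = "\<lambda>_. 1"]
    by (simp add: lessThan_atLeast0)
qed

section \<open>Almost sure approximation of the integral\<close>

definition ito_deviation ::
    "nat \<Rightarrow> (nat \<Rightarrow> real) \<Rightarrow> (nat \<Rightarrow> 'a \<Rightarrow> real^'m^'d) \<Rightarrow> (real \<Rightarrow> 'a \<Rightarrow> real^'m^'d) \<Rightarrow> real \<Rightarrow> 'a \<Rightarrow> ennreal" where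
  "ito_deviation k \<tau> \<xi> H T \<omega> =
     (\<integral>\<^sup>+s\<in>{0..T}. ennreal ((norm (simple_process k \<tau> \<xi> s \<omega> - H s \<omega>))\<^sup>2) \<partial>lborel)"

lemma (in complete_measure) borel_measurable_AE_cong:
  assumes f: "f \<in> borel_measurable M" and eq: "AE x in M. f x = g x"
  shows "g \<in> borel_measurable M"
proof (rule measurableI)
  fix A :: "'b set" assume A: "A \<in> sets borel"
  show "g -` A \<inter> space M \<in> sets M"
  proof (rule in_sets_AE)
    show "f -` A \<inter> space M \<in> sets M" using measurable_sets[OF f A] .
    show "AE x in M. x \<in> f -` A \<inter> space M \<longleftrightarrow> x \<in> g -` A \<inter> space M"
      using eq by eventually_elim auto
  qed auto
qed simp

text \<open>The limit objects below are running suprema and pathwise Lebesgue integrals, and the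
  limits hold only almost surely. Completeness lets these objects inherit measurability from the
  grid approximations.\<close>

lemma (in complete_measure) borel_measurable_AE_LIMSEQ:
  fixes f :: "'a \<Rightarrow> 'b::{banach, second_countable_topology}"
  assumes u: "\<And>n. u n \<in> borel_measurable M" and lim: "AE x in M. (\<lambda>n. u n x) \<longlonglongrightarrow> f x"
  shows "f \<in> borel_measurable M"
proof (rule borel_measurable_AE_cong)
  show "(\<lambda>x. lim (\<lambda>n. u n x)) \<in> borel_measurable M" using u by measurable
  show "AE x in M. lim (\<lambda>n. u n x) = f x" using lim by eventually_elim (rule limI)
qed

context brownian_setup
begin

sublocale complete_measure M by (rule complete)

lemma continuous_simple_ito_integral:
  assumes B: "continuous_on {0..} (\<lambda>t. B t \<omega>)" and \<tau>: "\<And>i. i \<le> k \<Longrightarrow> 0 \<le> \<tau> i"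
  shows "continuous_on {0..} (\<lambda>t. simple_ito_integral B k \<tau> \<xi> t \<omega>)"
proof -
  have c: "continuous_on {0..} (\<lambda>t. B (min t u) \<omega>)" if "0 \<le> u" for u
  proof -
    have "continuous_on {0..} (\<lambda>t::real. min t u)" by (intro continuous_intros)
    moreover have "(\<lambda>t. min t u) ` {0..} \<subseteq> {0..}" using that by auto
    ultimately show ?thesis by (rule continuous_on_compose2[OF B])
  qed
  have m: "continuous_on {0..} (\<lambda>t. A *v v t)" if "continuous_on {0..} v" for v and A :: "real^'x^'y"
    using that by (rule continuous_on_compose2[OF linear_continuous_on[OF matrix_vector_mul_bounded_linear, of UNIV A]]) simp
  show ?thesis
    unfolding simple_ito_integral_def
    by (intro continuous_on_sum m continuous_on_diff c \<tau>) auto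
qed

text \<open>\<open>measure M\<close> is 0 on non-measurable sets, so the convergence in
  \<open>has_ito_integral\<close> has content only once these events are known to be measurable.
  Along continuous paths a countable dense set of times decides the event; completeness takes care
  of the other paths.\<close>

lemma sup_deviation_in_sets:
  fixes Z :: "real \<Rightarrow> 'a \<Rightarrow> 'b::{real_normed_vector, second_countable_topology}"
  assumes Z: "\<And>t. 0 \<le> t \<Longrightarrow> Z t \<in> borel_measurable M" and c: "AE \<omega> in M. continuous_on {0..} (\<lambda>t. Z t \<omega>)"
  shows "{\<omega>\<in>space M. \<exists>t\<in>{0..T}. \<epsilon> < norm (Z t \<omega>)} \<in> sets M"
proof -
  obtain D where D: "countable D" "D \<subseteq> {0..T}" "{0..T} \<subseteq> closure D"
    using separable[of "{0..T::real}"] by blast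
  show ?thesis
  proof (rule in_sets_AE)
    have "{\<omega>\<in>space M. \<exists>t\<in>D. \<epsilon> < norm (Z t \<omega>)} = (\<Union>t\<in>D. {\<omega>\<in>space M. \<epsilon> < norm (Z t \<omega>)})" by auto
    also have "\<dots> \<in> sets M"
    proof (rule sets.countable_UN''[OF D(1)])
      fix t assume "t \<in> D"
      then have [measurable]: "Z t \<in> borel_measurable M" using D(2) Z by auto
      show "{\<omega>\<in>space M. \<epsilon> < norm (Z t \<omega>)} \<in> sets M" by measurable
    qed
    finally show "{\<omega>\<in>space M. \<exists>t\<in>D. \<epsilon> < norm (Z t \<omega>)} \<in> sets M" .
    show "AE \<omega> in M. \<omega> \<in> {\<omega>\<in>space M. \<exists>t\<in>D. \<epsilon> < norm (Z t \<omega>)} \<longleftrightarrow>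
        \<omega> \<in> {\<omega>\<in>space M. \<exists>t\<in>{0..T}. \<epsilon> < norm (Z t \<omega>)}"
      using c
    proof eventually_elim
      case (elim \<omega>)
      have "\<exists>t\<in>D. \<epsilon> < norm (Z t \<omega>)" if t: "t \<in> {0..T}" "\<epsilon> < norm (Z t \<omega>)" for t
      proof -
        obtain x where x: "\<And>n. x n \<in> D" "x \<longlonglongrightarrow> t"
          using t(1) D(3) closure_sequential[of t D] by auto
        have "0 \<le> x n" for n using x(1)[of n] D(2) by auto
        then have "(\<lambda>n. norm (Z (x n) \<omega>)) \<longlonglongrightarrow> norm (Z t \<omega>)"
          by (intro tendsto_norm continuous_on_tendsto_compose[OF elim x(2)])
            (use t in auto)
        from order_tendstoD(1)[OF this t(2)] show ?thesis
          using x(1) by (auto simp: eventually_sequentially)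
      qed
      then show ?case using D(2) by auto
    qed
  qed auto
qed

lemma measurable_simple_process_pair:
  assumes si: "simple_integrand M F k \<tau> \<xi>"
  shows "(\<lambda>(s, \<omega>). simple_process k \<tau> \<xi> s \<omega>) \<in> borel_measurable (borel \<Otimes>\<^sub>M M)"
proof -
  have "\<xi> i \<in> borel_measurable M" if "i < k" for i
    using si that simple_integrand_times_nonneg[OF si, of i] measurable_F_M[of "\<xi> i" "\<tau> i"]
    by (simp add: simple_integrand_def)
  then have [measurable]: "(\<lambda>p. \<xi> i (snd p)) \<in> borel_measurable (borel \<Otimes>\<^sub>M M)" if "i < k" for i
    using that measurable_compose[OF measurable_snd] by blast
  show ?thesis
    unfolding simple_process_def split_beta' by measurable
qed

text \<open>Joint measurability is given on nonnegative times, while the integrals run over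
  \<open>lborel\<close>. Freezing time at 0 extends the integrand to the line without changing it on
  any \<open>{0..T}\<close>.\<close>

lemma ito_integrand_clamped:
  assumes "ito_integrand M F H"
  shows "(\<lambda>(s, \<omega>). H (max 0 s) \<omega>) \<in> borel_measurable (borel \<Otimes>\<^sub>M M)"
proof -
  have "(\<lambda>(s, \<omega>). H s \<omega>) \<in> borel_measurable (restrict_space borel {0..} \<Otimes>\<^sub>M M)"
    using assms by (simp add: ito_integrand_def)
  moreover have "(\<lambda>(s, \<omega>). (max 0 s, \<omega>)) \<in> (borel \<Otimes>\<^sub>M M) \<rightarrow>\<^sub>M (restrict_space borel {0::real..} \<Otimes>\<^sub>M M)"
    unfolding split_beta'
    by (intro measurable_Pair measurable_restrict_space2 measurable_snd) auto
  ultimately have "(\<lambda>(s, \<omega>). H s \<omega>) \<circ> (\<lambda>(s, \<omega>). (max 0 s, \<omega>)) \<in> borel_measurable (borel \<Otimes>\<^sub>M M)"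
    by (rule measurable_comp[rotated])
  then show ?thesis by (simp add: comp_def split_beta')
qed

lemma integral_deviation_in_sets:
  assumes si: "simple_integrand M F k \<tau> \<xi>" and H: "ito_integrand M F H"
  shows "{\<omega>\<in>space M. ennreal \<epsilon> < ito_deviation k \<tau> \<xi> H T \<omega>} \<in> sets M"
proof -
  note [measurable] = measurable_simple_process_pair[OF si] ito_integrand_clamped[OF H]
  have eq: "ito_deviation k \<tau> \<xi> H T \<omega> =
     (\<integral>\<^sup>+s. ennreal ((norm (simple_process k \<tau> \<xi> s \<omega> - H (max 0 s) \<omega>))\<^sup>2) * indicator {0..T} s \<partial>lborel)" for \<omega>
    unfolding ito_deviation_def by (intro nn_integral_cong) (auto simp: indicator_def)
  have "(\<lambda>(\<omega>, s). ennreal ((norm (simple_process k \<tau> \<xi> s \<omega> - H (max 0 s) \<omega>))\<^sup>2) * indicator {0..T} s)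
      \<in> borel_measurable (M \<Otimes>\<^sub>M lborel)"
  proof -
    have "(\<lambda>(s, \<omega>). ennreal ((norm (simple_process k \<tau> \<xi> s \<omega> - H (max 0 s) \<omega>))\<^sup>2) * indicator {0..T} s)
      \<in> borel_measurable (lborel \<Otimes>\<^sub>M M)"
      using measurable_simple_process_pair[OF si] ito_integrand_clamped[OF H]
      unfolding split_beta' by measurable
    from measurable_pair_swap[OF this] show ?thesis by simp
  qed
  then have [measurable]: "(\<lambda>\<omega>. \<integral>\<^sup>+s. ennreal ((norm (simple_process k \<tau> \<xi> s \<omega> - H (max 0 s) \<omega>))\<^sup>2) * indicator {0..T} s \<partial>lborel)
      \<in> borel_measurable M"
    by (rule lborel.borel_measurable_nn_integral)
  show ?thesis unfolding eq by measurable
qed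

definition ito_approximates ::
    "(nat \<Rightarrow> nat) \<Rightarrow> (nat \<Rightarrow> nat \<Rightarrow> real) \<Rightarrow> (nat \<Rightarrow> nat \<Rightarrow> 'a \<Rightarrow> real^'m^'d) \<Rightarrow>
     (real \<Rightarrow> 'a \<Rightarrow> real^'m^'d) \<Rightarrow> (real \<Rightarrow> 'a \<Rightarrow> real^'d) \<Rightarrow> 'a \<Rightarrow> bool" where
  "ito_approximates k \<tau> \<xi> H I \<omega> \<longleftrightarrow> (\<forall>T\<ge>0. \<forall>\<epsilon>>0. \<forall>\<^sub>F n in sequentially.
      ito_deviation (k n) (\<tau> n) (\<xi> n) H T \<omega> \<le> ennreal \<epsilon> \<and>
      (\<forall>t\<in>{0..T}. norm (simple_ito_integral B (k n) (\<tau> n) (\<xi> n) t \<omega> - I t \<omega>) \<le> \<epsilon>))"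

text \<open>Level \<open>n\<close> of the subsequence governs the horizon \<open>n\<close> and the
  tolerance \<open>(1/2) ^ n\<close> at once, with exceptional probability below
  \<open>(1/2) ^ n\<close> for each of the two deviations. By Borel-Cantelli almost every path is
  eventually good at all levels, so one subsequence serves every \<open>T\<close> and every
  \<epsilon>.\<close>

lemma ito_approximation:
  assumes ito: "has_ito_integral M F B H I"
  obtains k \<tau> \<xi> where "\<And>n::nat. simple_integrand M F (k n) (\<tau> n) (\<xi> n)"
    and "AE \<omega> in M. ito_approximates k \<tau> \<xi> H I \<omega>"
proof -
  have H: "ito_integrand M F H" and I: "adapted F I" "continuous_process M I"
    using ito by (auto simp: has_ito_integral_def)
  from ito obtain k \<tau> \<xi> where si: "\<And>n::nat. simple_integrand M F (k n) (\<tau> n) (\<xi> n)"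
    and conv: "\<And>T \<epsilon>. 0 \<le> T \<Longrightarrow> 0 < \<epsilon> \<Longrightarrow> (\<lambda>n. measure M {\<omega>\<in>space M.
              ito_deviation (k n) (\<tau> n) (\<xi> n) H T \<omega> > ennreal \<epsilon>}) \<longlonglongrightarrow> 0"
     "\<And>T \<epsilon>. 0 \<le> T \<Longrightarrow> 0 < \<epsilon> \<Longrightarrow> (\<lambda>n. measure M {\<omega>\<in>space M.
              \<exists>t\<in>{0..T}. norm (simple_ito_integral B (k n) (\<tau> n) (\<xi> n) t \<omega> - I t \<omega>) > \<epsilon>}) \<longlonglongrightarrow> 0"
    unfolding has_ito_integral_def ito_deviation_def by blast
  define e :: "nat \<Rightarrow> real" where "e n = (1/2) ^ n" for n
  have e0: "0 < e n" for n by (simp add: e_def)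
  define S1 where "S1 n N = {\<omega>\<in>space M. ennreal (e n) <
      ito_deviation (k N) (\<tau> N) (\<xi> N) H (real n) \<omega>}" for n N
  define S2 where "S2 n N = {\<omega>\<in>space M.
      \<exists>t\<in>{0..real n}. e n < norm (simple_ito_integral B (k N) (\<tau> N) (\<xi> N) t \<omega> - I t \<omega>)}" for n N
  have S1: "S1 n N \<in> sets M" for n N
    unfolding S1_def by (rule integral_deviation_in_sets[OF si H])
  have S2: "S2 n N \<in> sets M" for n N
    unfolding S2_def
  proof (rule sup_deviation_in_sets)
    show "(\<lambda>\<omega>. simple_ito_integral B (k N) (\<tau> N) (\<xi> N) t \<omega> - I t \<omega>) \<in> borel_measurable M" if "0 \<le> t" for t
      using measurable_F_M[OF measurable_simple_ito_integral[OF si that] that] I(1) that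
        measurable_F_M[of "I t" t] by (auto simp: adapted_def)
    have "AE \<omega> in M. continuous_on {0..} (\<lambda>t. B t \<omega>)" "AE \<omega> in M. continuous_on {0..} (\<lambda>t. I t \<omega>)"
      using brownian I by (auto simp: brownian_motion_def continuous_process_def)
    then show "AE \<omega> in M. continuous_on {0..} (\<lambda>t. simple_ito_integral B (k N) (\<tau> N) (\<xi> N) t \<omega> - I t \<omega>)"
      by eventually_elim
        (intro continuous_on_diff continuous_simple_ito_integral simple_integrand_times_nonneg[OF si])
  qed
  have "\<exists>N. measure M (S1 n N) < e n \<and> measure M (S2 n N) < e n" for n
  proof -
    have "eventually (\<lambda>N. measure M (S1 n N) < e n) sequentially"
      using order_tendstoD(2)[OF conv(1)[of "real n" "e n"] e0] e0 by (simp add: S1_def)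
    moreover have "eventually (\<lambda>N. measure M (S2 n N) < e n) sequentially"
      using order_tendstoD(2)[OF conv(2)[of "real n" "e n"] e0] e0 by (simp add: S2_def)
    ultimately have "eventually (\<lambda>N. measure M (S1 n N) < e n \<and> measure M (S2 n N) < e n) sequentially"
      by (rule eventually_conj)
    then show ?thesis by (auto simp: eventually_sequentially)
  qed
  then obtain N where N: "\<And>n. measure M (S1 n (N n)) < e n" "\<And>n. measure M (S2 n (N n)) < e n" by metis
  have "AE \<omega> in M. eventually (\<lambda>n. \<omega> \<in> space M - (S1 n (N n) \<union> S2 n (N n))) sequentially"
  proof (rule borel_cantelli_AE1)
    show "summable (\<lambda>n. measure M (S1 n (N n) \<union> S2 n (N n)))"
    proof (rule summable_comparison_test')
      show "summable (\<lambda>n. 2 * e n)"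
        unfolding e_def by (intro summable_mult summable_geometric) simp
      show "norm (measure M (S1 n (N n) \<union> S2 n (N n))) \<le> 2 * e n" for n
        using measure_Un_le[OF S1[of n "N n"] S2[of n "N n"]] N[of n] by simp
    qed
  qed (use S1 S2 in \<open>auto simp: less_top[symmetric]\<close>)
  then have "AE \<omega> in M. ito_approximates (\<lambda>n. k (N n)) (\<lambda>n. \<tau> (N n)) (\<lambda>n. \<xi> (N n)) H I \<omega>"
  proof eventually_elim
    case (elim \<omega>)
    show ?case
      unfolding ito_approximates_def
    proof (intro allI impI)
      fix T \<epsilon> :: real assume T: "0 \<le> T" and \<epsilon>: "0 < \<epsilon>"
      have "e \<longlonglongrightarrow> 0" unfolding e_def by (intro LIMSEQ_power_zero) simp
      from order_tendstoD(2)[OF this \<epsilon>]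
      have "eventually (\<lambda>n. e n < \<epsilon>) sequentially" .
      moreover have "eventually (\<lambda>n. T \<le> real n) sequentially"
        using eventually_ge_at_top[of "nat \<lceil>T\<rceil>"] by eventually_elim linarith
      ultimately show "\<forall>\<^sub>F n in sequentially.
        ito_deviation (k (N n)) (\<tau> (N n)) (\<xi> (N n)) H T \<omega> \<le> ennreal \<epsilon> \<and>
        (\<forall>t\<in>{0..T}. norm (simple_ito_integral B (k (N n)) (\<tau> (N n)) (\<xi> (N n)) t \<omega> - I t \<omega>) \<le> \<epsilon>)"
        using elim
      proof eventually_elim
        case (elim n)
        have "ito_deviation (k (N n)) (\<tau> (N n)) (\<xi> (N n)) H T \<omega>
          \<le> ito_deviation (k (N n)) (\<tau> (N n)) (\<xi> (N n)) H (real n) \<omega>"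
          unfolding ito_deviation_def using elim(2) by (intro nn_integral_mono) (auto simp: indicator_def)
        also have "\<dots> \<le> ennreal (e n)" using elim(3) by (auto simp: S1_def)
        also have "\<dots> \<le> ennreal \<epsilon>" using elim(1) by (intro ennreal_leI) simp
        finally have 1: "ito_deviation (k (N n)) (\<tau> (N n)) (\<xi> (N n)) H T \<omega> \<le> ennreal \<epsilon>" .
        have "norm (simple_ito_integral B (k (N n)) (\<tau> (N n)) (\<xi> (N n)) t \<omega> - I t \<omega>) \<le> \<epsilon>" if "t \<in> {0..T}" for t
        proof -
          have "t \<in> {0..real n}" using that elim(2) by auto
          then have "norm (simple_ito_integral B (k (N n)) (\<tau> (N n)) (\<xi> (N n)) t \<omega> - I t \<omega>) \<le> e n"
            using elim(3) unfolding S2_def by (auto simp: not_less)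
          then show ?thesis using elim(1) by simp
        qed
        with 1 show ?case by blast
      qed
    qed
  qed
  then show thesis by (intro that[of "\<lambda>n. k (N n)" "\<lambda>n. \<tau> (N n)" "\<lambda>n. \<xi> (N n)"] si)
qed

end

section \<open>Passage to the limit\<close>

lemma set_integral_Icc_diff:
  fixes f :: "real \<Rightarrow> 'v::euclidean_space"
  assumes f: "set_integrable lebesgue {0..v} f" and uv: "0 \<le> u" "u \<le> v"
  shows "(LINT r:{0..v}|lebesgue. f r) - (LINT r:{0..u}|lebesgue. f r) = (LINT r:{u..<v}|lebesgue. f r)"
proof -
  have i: "set_integrable lebesgue A f" if "A \<subseteq> {0..v}" "A \<in> sets lebesgue" for A
    by (rule set_integrable_subset[OF f that(2,1)])
  have "(LINT r:{0..v}|lebesgue. f r) = (LINT r:{0..u} \<union> {u<..v}|lebesgue. f r)"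
    using uv by (intro arg_cong[where f = "\<lambda>A. LINT r:A|lebesgue. f r"]) auto
  also have "\<dots> = (LINT r:{0..u}|lebesgue. f r) + (LINT r:{u<..v}|lebesgue. f r)"
    using uv by (intro set_integral_Un i) auto
  also have "(LINT r:{u<..v}|lebesgue. f r) = (LINT r:{u..<v}|lebesgue. f r)"
    unfolding set_lebesgue_integral_def
  proof (rule integral_cong_AE)
    show "(\<lambda>r. indicator {u<..v} r *\<^sub>R f r) \<in> borel_measurable lebesgue"
      "(\<lambda>r. indicator {u..<v} r *\<^sub>R f r) \<in> borel_measurable lebesgue"
      by (intro borel_measurable_integrable i[unfolded set_integrable_def]; use uv in auto)+
    note AE_lebesgue_neq[of u] AE_lebesgue_neq[of v]
    then show "AE r in lebesgue. indicator {u<..v} r *\<^sub>R f r = indicator {u..<v} r *\<^sub>R f r"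
      by eventually_elim (auto simp: indicator_def)
  qed
  finally show ?thesis by simp
qed

lemma set_integrable_lebesgue_of_nn_integral:
  fixes f :: "real \<Rightarrow> real"
  assumes m: "(\<lambda>s. f (max 0 s)) \<in> borel_measurable borel" and f0: "\<And>s. 0 \<le> f s"
    and fin: "(\<integral>\<^sup>+s\<in>{0..T}. ennreal (f s) \<partial>lborel) < \<infinity>"
  shows "set_integrable lebesgue {0..T} f"
    and "(LINT s:{0..T}|lebesgue. f s) = enn2real (\<integral>\<^sup>+s\<in>{0..T}. ennreal (f s) \<partial>lborel)"
proof -
  define g where "g s = indicator {0..T} s *\<^sub>R f s" for s
  have "g = (\<lambda>s. indicator {0..T} s *\<^sub>R f (max 0 s))" by (auto simp: g_def indicator_def)
  with m have g: "g \<in> borel_measurable lborel" by simp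
  have nn: "(\<integral>\<^sup>+s. ennreal (g s) \<partial>lborel) = (\<integral>\<^sup>+s\<in>{0..T}. ennreal (f s) \<partial>lborel)"
    by (intro nn_integral_cong) (auto simp: g_def indicator_def)
  have "integrable lborel g"
    using fin f0 by (intro integrableI_nonneg[OF g]) (auto simp: nn, auto simp: g_def)
  then show "set_integrable lebesgue {0..T} f"
    using integrable_completion[OF g] unfolding set_integrable_def g_def by simp
  have "integral\<^sup>L lborel g = enn2real (\<integral>\<^sup>+s. ennreal (g s) \<partial>lborel)"
    using f0 by (intro integral_eq_nn_integral[OF g]) (auto simp: g_def)
  then show "(LINT s:{0..T}|lebesgue. f s) = enn2real (\<integral>\<^sup>+s\<in>{0..T}. ennreal (f s) \<partial>lborel)"
    using integral_completion[OF g] unfolding nn unfolding set_lebesgue_integral_def g_def by simp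
qed

text \<open>A discrete stopping argument: at the last index with nonzero weight the cost is at most
  \<open>R\<close>, hence so is the partial sum it dominates. In the second form the weight at
  \<open>i\<close> sees only the terms before \<open>i\<close>, so one more term, of size at most 1,
  may slip through.\<close>

lemma cutoff_sum_le:
  fixes a C :: "nat \<Rightarrow> real"
  assumes R: "0 < R" and a: "\<And>i. 0 \<le> a i" and C: "\<And>i. (\<Sum>j<i. a j) \<le> C i"
  shows "(\<Sum>i<l. cutoff R (C (Suc i)) * a i) \<le> R"
    and "(\<And>i. a i \<le> 1) \<Longrightarrow> (\<Sum>i<l. cutoff R (C i) * a i) \<le> R + 1"
proof -
  have C0: "0 \<le> C i" for i using C[of i] sum_nonneg[of "{..<i}" a] a by fastforce
  have le: "cutoff R (C j) * a i \<le> a i" for i j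
    using cutoff_le_one[OF R C0[of j]] a[of i] by (simp add: mult_left_le_one_le cutoff_nonneg)
  show "(\<Sum>i<l. cutoff R (C (Suc i)) * a i) \<le> R"
  proof (induction l)
    case (Suc l)
    show ?case
    proof (cases "C (Suc l) \<le> R")
      case True
      have "(\<Sum>i<Suc l. cutoff R (C (Suc i)) * a i) \<le> (\<Sum>i<Suc l. a i)" by (intro sum_mono le)
      then show ?thesis using C[of "Suc l"] True by linarith
    next
      case False
      then show ?thesis using Suc cutoff_eq_0[OF R, of "C (Suc l)"] by simp
    qed
  qed (use R in simp)
  show "(\<Sum>i<l. cutoff R (C i) * a i) \<le> R + 1" if a1: "\<And>i. a i \<le> 1"
  proof (induction l)
    case (Suc l)
    show ?case
    proof (cases "C l \<le> R")
      case True
      have "(\<Sum>i<l. cutoff R (C i) * a i) \<le> (\<Sum>i<l. a i)" by (intro sum_mono le)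
      then show ?thesis using C[of l] True le[of l l] a1[of l] by simp
    next
      case False
      then show ?thesis using Suc cutoff_eq_0[OF R, of "C l"] by simp
    qed
  qed (use R in simp)
qed

definition energy_increment ::
    "real \<Rightarrow> (nat \<Rightarrow> 'v::real_inner) \<Rightarrow> (nat \<Rightarrow> 'v) \<Rightarrow> (nat \<Rightarrow> real) \<Rightarrow> nat \<Rightarrow> nat \<Rightarrow> real" where
  "energy_increment R Y A Q k l =
     (\<Sum>i=k..<l. cutoff R (grid_cost Y A Q (Suc i)) * (2 * (Y (Suc i) \<bullet> (A (Suc i) - A i)))) +
     (\<Sum>i=k..<l. cutoff R (grid_cost Y A Q i) * Q i)"

text \<open>The dominating constant for the passage to the limit: it is free of the mesh, of the
  simple process and of \<open>k\<close> and \<open>l\<close>. In the drift sum one factor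
  \<open>R\<close> bounds the values and the other the variation; \<open>R + 1\<close> bounds the
  energy.\<close>

lemma energy_increment_bounded:
  assumes R: "0 < R" and Q: "\<And>i. 0 \<le> Q i" "\<And>i. Q i \<le> 1"
  shows "\<bar>energy_increment R Y A Q k l\<bar> \<le> 2 * R * R + (R + 1)"
proof -
  note C = grid_cost_ge[where Q = Q, OF Q(1)]
  have "\<bar>\<Sum>i=k..<l. cutoff R (grid_cost Y A Q (Suc i)) * (2 * (Y (Suc i) \<bullet> (A (Suc i) - A i)))\<bar> \<le>
      (\<Sum>i=k..<l. 2 * R * (cutoff R (grid_cost Y A Q (Suc i)) * norm (A (Suc i) - A i)))"
  proof (rule order_trans[OF sum_abs], rule sum_mono)
    fix i
    have "cutoff R (grid_cost Y A Q (Suc i)) * \<bar>Y (Suc i) \<bullet> (A (Suc i) - A i)\<bar> \<le>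
        cutoff R (grid_cost Y A Q (Suc i)) * (R * norm (A (Suc i) - A i))"
    proof (cases "grid_cost Y A Q (Suc i) \<le> R")
      case True
      then have "norm (Y (Suc i)) \<le> R" using C(1)[of Y "Suc i" A] by linarith
      then have "norm (Y (Suc i)) * norm (A (Suc i) - A i) \<le> R * norm (A (Suc i) - A i)"
        by (intro mult_right_mono) auto
      then show ?thesis
        using Cauchy_Schwarz_ineq2[of "Y (Suc i)" "A (Suc i) - A i"]
        by (intro mult_left_mono cutoff_nonneg) linarith
    next
      case False
      then show ?thesis using cutoff_eq_0[OF R, of "grid_cost Y A Q (Suc i)"] by simp
    qed
    then show "\<bar>cutoff R (grid_cost Y A Q (Suc i)) * (2 * (Y (Suc i) \<bullet> (A (Suc i) - A i)))\<bar> \<le>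
      2 * R * (cutoff R (grid_cost Y A Q (Suc i)) * norm (A (Suc i) - A i))"
      unfolding abs_mult abs_of_nonneg[OF cutoff_nonneg] by (simp add: mult.assoc mult.left_commute)
  qed
  also have "\<dots> \<le> (\<Sum>i<l. 2 * R * (cutoff R (grid_cost Y A Q (Suc i)) * norm (A (Suc i) - A i)))"
    using R by (intro sum_mono2) (auto intro!: mult_nonneg_nonneg cutoff_nonneg)
  also have "\<dots> \<le> 2 * R * R"
  proof -
    have "(\<Sum>i<l. cutoff R (grid_cost Y A Q (Suc i)) * norm (A (Suc i) - A i)) \<le> R"
      by (rule cutoff_sum_le(1)[OF R norm_ge_zero C(2)])
    then show ?thesis using R by (simp flip: sum_distrib_left)
  qed
  finally have 1: "\<bar>\<Sum>i=k..<l. cutoff R (grid_cost Y A Q (Suc i)) * (2 * (Y (Suc i) \<bullet> (A (Suc i) - A i)))\<bar> \<le> 2 * R * R" .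
  have "\<bar>\<Sum>i=k..<l. cutoff R (grid_cost Y A Q i) * Q i\<bar> = (\<Sum>i=k..<l. cutoff R (grid_cost Y A Q i) * Q i)"
    using Q by (intro abs_of_nonneg sum_nonneg mult_nonneg_nonneg cutoff_nonneg)
  also have "\<dots> \<le> (\<Sum>i<l. cutoff R (grid_cost Y A Q i) * Q i)"
    using Q by (intro sum_mono2) (auto intro!: mult_nonneg_nonneg cutoff_nonneg)
  also have "\<dots> \<le> R + 1"
    using Q C(3) by (intro cutoff_sum_le(2)[OF R]) auto
  finally show ?thesis using 1 unfolding energy_increment_def by linarith
qed

text \<open>The drift sum is weighted at right ends of cells, the energy sum at left ends. Both ends
  of the cell containing \<open>r\<close> tend to \<open>r\<close>, so the shift is invisible in the
  limit.\<close>

lemma grid_energy_tendsto: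
  fixes X \<phi> :: "real \<Rightarrow> 'v::euclidean_space"
  assumes \<delta>: "\<And>n. 0 < \<delta> n" "\<delta> \<longlonglongrightarrow> 0" and X: "continuous_on {0..} X"
    and \<phi>: "\<And>T. set_integrable lebesgue {0..T} \<phi>"
    and \<psi>: "\<And>T. set_integrable lebesgue {0..T} \<psi>" and \<psi>': "\<And>n T. set_integrable lebesgue {0..T} (\<psi>' n)"
    and lim: "\<And>T. (\<lambda>n. LINT r:{0..T}|lebesgue. \<bar>\<psi>' n r - \<psi> r\<bar>) \<longlonglongrightarrow> 0"
    and near: "\<And>T e. 0 < e \<Longrightarrow> \<forall>\<^sub>F n in sequentially. \<forall>i. real i * \<delta> n \<le> T \<longrightarrow> norm (Y n i - X (real i * \<delta> n)) < e"
    and A: "\<And>n i. A n (Suc i) - A n i = (LINT r:cell (\<delta> n) i|lebesgue. \<phi> r)"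
    and Q: "\<And>n i. Q n i = (LINT r:cell (\<delta> n) i|lebesgue. \<psi>' n r)" "\<And>n i. 0 \<le> Q n i"
    and st: "0 \<le> s" "s \<le> t" and R: "0 < R"
  shows "(\<lambda>n. cutoff R (grid_cost (Y n) (A n) (Q n) (grid_index (\<delta> n) t))) \<longlonglongrightarrow> cutoff R (path_cost X \<phi> \<psi> t)"
    and "(\<lambda>n. Y n (grid_index (\<delta> n) t)) \<longlonglongrightarrow> X t"
    and "(\<lambda>n. energy_increment R (Y n) (A n) (Q n) (grid_index (\<delta> n) s) (grid_index (\<delta> n) t)) \<longlonglongrightarrow>
      (LINT r:{s..<t}|lebesgue. cutoff R (path_cost X \<phi> \<psi> r) * (2 * (X r \<bullet> \<phi> r))) +
      (LINT r:{s..<t}|lebesgue. cutoff R (path_cost X \<phi> \<psi> r) * \<psi> r)"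
proof -
  define \<rho> where "\<rho> n i = cutoff R (grid_cost (Y n) (A n) (Q n) i)" for n i
  define p where "p r = cutoff R (path_cost X \<phi> \<psi> r)" for r
  have t: "0 \<le> t" using st by simp
  note gi = tendsto_grid_index[OF \<delta>]
  have \<rho>lim: "(\<lambda>n. \<rho> n (l n)) \<longlonglongrightarrow> p r" if "(\<lambda>n. real (l n) * \<delta> n) \<longlonglongrightarrow> r" "0 \<le> r" for l r
    unfolding \<rho>_def p_def
    by (intro tendsto_cutoff grid_cost_tendsto[OF \<delta> X \<phi> \<psi> \<psi>' lim near A Q(1) that])
  show "(\<lambda>n. cutoff R (grid_cost (Y n) (A n) (Q n) (grid_index (\<delta> n) t))) \<longlonglongrightarrow> cutoff R (path_cost X \<phi> \<psi> t)"
    using \<rho>lim[OF gi(1)[OF t] t] by (simp add: \<rho>_def p_def)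
  show "(\<lambda>n. Y n (grid_index (\<delta> n) t)) \<longlonglongrightarrow> X t"
    by (rule grid_value_tendsto[OF \<delta>(1) X near gi(1)[OF t] t])
  have kl: "grid_index (\<delta> n) s \<le> grid_index (\<delta> n) t" for n
    by (rule grid_index_mono[OF \<delta>(1) st(2)])
  have C: "norm (Y n i) \<le> grid_cost (Y n) (A n) (Q n) i" "0 \<le> grid_cost (Y n) (A n) (Q n) i" for n i
    using grid_cost_ge(1,4)[where Q = "Q n", OF Q(2)] by auto
  have "(\<lambda>n. \<Sum>i=grid_index (\<delta> n) s..<grid_index (\<delta> n) t.
      (\<rho> n (Suc i) * 2) *\<^sub>R Y n (Suc i) \<bullet> (LINT r:cell (\<delta> n) i|lebesgue. \<phi> r)) \<longlonglongrightarrow>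
      (LINT r:{s..<t}|lebesgue. (p r * 2) *\<^sub>R X r \<bullet> \<phi> r)"
  proof (rule grid_sum_tendsto[OF \<delta> \<phi>[of "t + 1"] gi(1) gi(1) kl st])
    show "norm ((\<rho> n (Suc i) * 2) *\<^sub>R Y n (Suc i)) \<le> 2 * R" for n i
    proof -
      have "\<rho> n (Suc i) * norm (Y n (Suc i)) \<le> R"
        unfolding \<rho>_def using R C[of n "Suc i"] by (intro cutoff_times_le) auto
      then show ?thesis by (simp add: \<rho>_def abs_mult abs_of_nonneg[OF cutoff_nonneg])
    qed
    fix r :: real assume r: "0 \<le> r"
    show "(\<lambda>n. (\<rho> n (Suc (grid_index (\<delta> n) r)) * 2) *\<^sub>R Y n (Suc (grid_index (\<delta> n) r))) \<longlonglongrightarrow> (p r * 2) *\<^sub>R X r"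
      by (intro tendsto_scaleR tendsto_mult tendsto_const \<rho>lim[OF gi(2)[OF r] r]
          grid_value_tendsto[OF \<delta>(1) X near gi(2)[OF r] r])
  qed (use st in auto)
  moreover have "(\<lambda>n. \<Sum>i=grid_index (\<delta> n) s..<grid_index (\<delta> n) t. \<rho> n i * (LINT r:cell (\<delta> n) i|lebesgue. \<psi>' n r)) \<longlonglongrightarrow>
      (LINT r:{s..<t}|lebesgue. p r * \<psi> r)"
  proof (rule grid_sum_tendsto_approx[OF \<delta> \<psi>[of "t + 1"] \<psi>' lim gi(1) gi(1) kl st])
    show "\<bar>\<rho> n i\<bar> \<le> 1" for n i
      using cutoff_nonneg[of R] cutoff_le_one[OF R C(2)] by (simp add: \<rho>_def)
    fix r :: real assume r: "0 \<le> r"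
    show "(\<lambda>n. \<rho> n (grid_index (\<delta> n) r)) \<longlonglongrightarrow> p r" using \<rho>lim[OF gi(1)[OF r] r] .
  qed (use st in auto)
  ultimately have "(\<lambda>n. (\<Sum>i=grid_index (\<delta> n) s..<grid_index (\<delta> n) t.
      (\<rho> n (Suc i) * 2) *\<^sub>R Y n (Suc i) \<bullet> (LINT r:cell (\<delta> n) i|lebesgue. \<phi> r)) +
      (\<Sum>i=grid_index (\<delta> n) s..<grid_index (\<delta> n) t. \<rho> n i * (LINT r:cell (\<delta> n) i|lebesgue. \<psi>' n r))) \<longlonglongrightarrow>
      (LINT r:{s..<t}|lebesgue. (p r * 2) *\<^sub>R X r \<bullet> \<phi> r) + (LINT r:{s..<t}|lebesgue. p r * \<psi> r)"
    by (rule tendsto_add)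
  then show "(\<lambda>n. energy_increment R (Y n) (A n) (Q n) (grid_index (\<delta> n) s) (grid_index (\<delta> n) t)) \<longlonglongrightarrow>
      (LINT r:{s..<t}|lebesgue. cutoff R (path_cost X \<phi> \<psi> r) * (2 * (X r \<bullet> \<phi> r))) +
      (LINT r:{s..<t}|lebesgue. cutoff R (path_cost X \<phi> \<psi> r) * \<psi> r)"
    unfolding energy_increment_def by (simp add: A Q(1)[symmetric] \<rho>_def p_def mult.assoc)
qed

context brownian_setup
begin

lemma simple_integrand_bounded:
  assumes "simple_integrand M F k \<tau> \<xi>"
  obtains K where "0 \<le> K" "\<And>i \<omega>. i < k \<Longrightarrow> \<omega> \<in> space M \<Longrightarrow> (norm (\<xi> i \<omega>))\<^sup>2 \<le> K"
proof -
  have "\<exists>K. \<forall>i<k. \<forall>\<omega>\<in>space M. norm (\<xi> i \<omega>) \<le> K i"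
    using assms unfolding simple_integrand_def by metis
  then obtain K where K: "\<And>i \<omega>. i < k \<Longrightarrow> \<omega> \<in> space M \<Longrightarrow> norm (\<xi> i \<omega>) \<le> K i" by blast
  show thesis
  proof (rule that[of "\<Sum>i<k. (K i)\<^sup>2"])
    fix i \<omega> assume i: "i < k" and \<omega>: "\<omega> \<in> space M"
    have "(norm (\<xi> i \<omega>))\<^sup>2 \<le> (K i)\<^sup>2" using K[OF i \<omega>] by (intro power_mono) auto
    also have "\<dots> \<le> (\<Sum>i<k. (K i)\<^sup>2)" using i by (intro member_le_sum) auto
    finally show "(norm (\<xi> i \<omega>))\<^sup>2 \<le> (\<Sum>i<k. (K i)\<^sup>2)" .
  qed (auto intro: sum_nonneg)
qed

text \<open>The projected step lengths telescope to at most \<open>t - s\<close>. That the bound is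
  linear in the length makes short cells carry little energy.\<close>

lemma simple_energy_le:
  assumes si: "simple_integrand M F k \<tau> \<xi>" and st: "s \<le> t"
    and K: "0 \<le> K" "\<And>i. i < k \<Longrightarrow> (norm (\<xi> i \<omega>))\<^sup>2 \<le> K"
  shows "simple_energy k \<tau> \<xi> s t \<omega> \<le> K * (t - s)"
proof -
  have "simple_energy k \<tau> \<xi> s t \<omega> \<le> (\<Sum>i<k. K * (clip_time s t (\<tau> (Suc i)) - clip_time s t (\<tau> i)))"
    unfolding simple_energy_def
    using si clip_time_simps(3)[OF st]
    by (intro sum_mono mult_right_mono K) (auto simp: simple_integrand_def less_imp_le)
  also have "\<dots> = K * (clip_time s t (\<tau> k) - clip_time s t (\<tau> 0))"
    using sum_lessThan_telescope[of "\<lambda>i. clip_time s t (\<tau> i)" k] by (simp flip: sum_distrib_left)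
  also have "\<dots> \<le> K * (t - s)"
    using clip_time_simps(1,2)[OF st] K(1) by (intro mult_left_mono) (simp_all add: diff_mono)
  finally show ?thesis .
qed

text \<open>Translates the extended nonnegative integrals over \<open>lborel\<close> into Lebesgue
  integrability along one fixed path, and the deviation bounds into L1 convergence of the energy
  densities.\<close>

lemma ito_approximation_path:
  fixes H :: "real \<Rightarrow> 'a \<Rightarrow> real^'m^'d"
  assumes si: "\<And>n::nat. simple_integrand M F (k n) (\<tau> n) (\<xi> n)"
    and H: "ito_integrand M F H" and \<omega>: "\<omega> \<in> space M"
    and fin: "\<And>T. 0 \<le> T \<Longrightarrow> (\<integral>\<^sup>+s\<in>{0..T}. ennreal ((norm (H s \<omega>))\<^sup>2) \<partial>lborel) < \<infinity>"
    and conv: "\<And>T \<epsilon>. 0 \<le> T \<Longrightarrow> 0 < \<epsilon> \<Longrightarrow> \<forall>\<^sub>F n in sequentially.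
      ito_deviation (k n) (\<tau> n) (\<xi> n) H T \<omega> \<le> ennreal \<epsilon>"
  shows "set_integrable lebesgue {0..T} (\<lambda>r. (norm (H r \<omega>))\<^sup>2)"
    and "set_integrable lebesgue {0..T} (\<lambda>r. (norm (simple_process (k n) (\<tau> n) (\<xi> n) r \<omega>))\<^sup>2)"
    and "(\<lambda>n. LINT r:{0..T}|lebesgue. \<bar>(norm (simple_process (k n) (\<tau> n) (\<xi> n) r \<omega>))\<^sup>2 - (norm (H r \<omega>))\<^sup>2\<bar>) \<longlonglongrightarrow> 0"
proof -
  let ?P = "\<lambda>n r. simple_process (k n) (\<tau> n) (\<xi> n) r \<omega>"
  have mH: "(\<lambda>s. H (max 0 s) \<omega>) \<in> borel_measurable borel"
    using measurable_compose[OF measurable_Pair2'[OF \<omega>, of borel] ito_integrand_clamped[OF H]] by simp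
  have mP: "?P n \<in> borel_measurable borel" for n
    using measurable_compose[OF measurable_Pair2'[OF \<omega>, of borel] measurable_simple_process_pair[OF si[of n]]] by simp
  have mP': "(\<lambda>s. ?P n (max 0 s)) \<in> borel_measurable borel" for n
    by (rule measurable_compose[OF _ mP]) measurable
  show Hi: "set_integrable lebesgue {0..T} (\<lambda>r. (norm (H r \<omega>))\<^sup>2)" for T
  proof (cases "0 \<le> T")
    case True
    show ?thesis
      by (rule set_integrable_lebesgue_of_nn_integral(1)[OF _ _ fin[OF True]]) (use mH in auto)
  qed simp
  show Pi: "set_integrable lebesgue {0..T} (\<lambda>r. (norm (?P n r))\<^sup>2)" for T n
  proof (cases "0 \<le> T")
    case True
    have "set_integrable lebesgue {0..<T + 1} (\<lambda>r. (norm (?P n r))\<^sup>2)"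
      using si[of n] True by (intro simple_energy_eq_integral(1)) (auto simp: simple_integrand_def)
    then show ?thesis by (rule set_integrable_subset) auto
  qed simp
  show "(\<lambda>n. LINT r:{0..T}|lebesgue. \<bar>(norm (?P n r))\<^sup>2 - (norm (H r \<omega>))\<^sup>2\<bar>) \<longlonglongrightarrow> 0"
  proof (cases "0 \<le> T")
    case True
    define D where "D n = (\<integral>\<^sup>+s\<in>{0..T}. ennreal ((norm (?P n s - H s \<omega>))\<^sup>2) \<partial>lborel)" for n
    have mD: "(\<lambda>s. (norm (?P n (max 0 s) - H (max 0 s) \<omega>))\<^sup>2) \<in> borel_measurable borel" for n
      using mH mP'[of n] by measurable
    \<comment> \<open>\<open>conv\<close> bounds the deviation only for large \<open>n\<close>,
      whereas integrability of the difference is wanted for every \<open>n\<close>. It is derived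
      from that of the two squares.\<close>
    have Dfin: "D n < \<infinity>" for n
    proof -
      have "set_integrable lebesgue {0..T} (\<lambda>s. 2 * (norm (?P n s))\<^sup>2 + 2 * (norm (H s \<omega>))\<^sup>2)"
        using Hi[of T] Pi[of T n] by (intro set_integral_add(1)) auto
      then have fin: "(\<integral>\<^sup>+s. ennreal (indicator {0..T} s *\<^sub>R (2 * (norm (?P n s))\<^sup>2 + 2 * (norm (H s \<omega>))\<^sup>2)) \<partial>lebesgue) < \<infinity>"
        unfolding set_integrable_def
        by (subst (asm) integrable_iff_bounded) (auto simp: abs_mult)
      have "D n \<le> (\<integral>\<^sup>+s. ennreal (indicator {0..T} s *\<^sub>R (2 * (norm (?P n s))\<^sup>2 + 2 * (norm (H s \<omega>))\<^sup>2)) \<partial>lborel)"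
        unfolding D_def
      proof (rule nn_integral_mono)
        fix s
        have "(norm (?P n s - H s \<omega>))\<^sup>2 \<le> (norm (?P n s) + norm (H s \<omega>))\<^sup>2"
          by (intro power_mono norm_triangle_ineq4) auto
        also have "\<dots> \<le> 2 * (norm (?P n s))\<^sup>2 + 2 * (norm (H s \<omega>))\<^sup>2"
          using sum_squares_bound[of "norm (?P n s)" "norm (H s \<omega>)"] by (simp add: power2_sum)
        finally show "ennreal ((norm (?P n s - H s \<omega>))\<^sup>2) * indicator {0..T} s \<le>
          ennreal (indicator {0..T} s *\<^sub>R (2 * (norm (?P n s))\<^sup>2 + 2 * (norm (H s \<omega>))\<^sup>2))"
          by (auto simp: indicator_def intro!: ennreal_leI simp flip: ennreal_plus)
      qed
      then show ?thesis using fin by (simp add: nn_integral_completion)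
    qed
    note Dl = set_integrable_lebesgue_of_nn_integral[OF mD _ Dfin[unfolded D_def]]
    have "(\<lambda>n. enn2real (D n)) \<longlonglongrightarrow> 0"
    proof (rule tendstoI)
      fix e :: real assume "0 < e"
      then have "eventually (\<lambda>n. D n \<le> ennreal (e / 2)) sequentially"
        unfolding D_def ito_deviation_def[symmetric] by (intro conv True) simp
      then show "eventually (\<lambda>n. dist (enn2real (D n)) 0 < e) sequentially"
      proof eventually_elim
        case (elim n)
        have "enn2real (D n) \<le> e / 2" using elim \<open>0 < e\<close> by (intro enn2real_leI) auto
        then show ?case using \<open>0 < e\<close> by simp
      qed
    qed
    then show ?thesis
      using Dl by (intro set_integral_tendsto_norm_power2_diff Hi Pi) (auto simp: D_def)
  qed (simp add: set_lebesgue_integral_def)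
qed


text \<open>The energy estimate sees the equation only through the drift along the path and the
  integrand, so the coefficients are forgotten here. The drift takes \<omega> first because it is
  handled path by path, as a Lebesgue integrable function of time.\<close>

definition ito_process ::
    "(real \<Rightarrow> 'a \<Rightarrow> real^'d) \<Rightarrow> ('a \<Rightarrow> real^'d) \<Rightarrow> ('a \<Rightarrow> real \<Rightarrow> real^'d) \<Rightarrow>
     (real \<Rightarrow> 'a \<Rightarrow> real^'m^'d) \<Rightarrow> (real \<Rightarrow> 'a \<Rightarrow> real^'d) \<Rightarrow> bool" where
  "ito_process X x0 \<phi> H I \<longleftrightarrow>
     has_ito_integral M F B H I \<and> adapted F X \<and> continuous_process M X \<and>
     (AE \<omega> in M. \<forall>t\<ge>0. set_integrable lebesgue {0..t} (\<phi> \<omega>) \<and>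
       X t \<omega> = x0 \<omega> + (LINT s:{0..t}|lebesgue. \<phi> \<omega> s) + I t \<omega>)"

lemma ito_processD:
  assumes "ito_process X x0 \<phi> H I"
  shows "has_ito_integral M F B H I" "adapted F X" "continuous_process M X"
    and "AE \<omega> in M. \<forall>t\<ge>0. set_integrable lebesgue {0..t} (\<phi> \<omega>) \<and>
       X t \<omega> = x0 \<omega> + (LINT s:{0..t}|lebesgue. \<phi> \<omega> s) + I t \<omega>"
    and "0 \<le> t \<Longrightarrow> X t \<in> borel_measurable M"
  using assms measurable_F_M[of "X t" t] by (auto simp: ito_process_def adapted_def)

text \<open>The last claim is what Ito's formula for \<rho> times the squared norm would give after
  dropping the nonpositive contribution of the decreasing weight. Measurability of the weight is a
  conclusion: it is an almost sure limit of the adapted grid weights.\<close>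

lemma energy_limit:
  fixes X I :: "real \<Rightarrow> 'a \<Rightarrow> real^'d" and H :: "real \<Rightarrow> 'a \<Rightarrow> real^'m^'d" and \<phi> :: "'a \<Rightarrow> real \<Rightarrow> real^'d"
  assumes X: "ito_process X x0 \<phi> H I"
    and R: "0 < R"
  defines "\<rho> \<equiv> \<lambda>r \<omega>. cutoff R (path_cost (\<lambda>r. X r \<omega>) (\<phi> \<omega>) (\<lambda>r. (norm (H r \<omega>))\<^sup>2) r)"
  shows "AE \<omega> in M. continuous_on {0..} (\<lambda>r. X r \<omega>) \<and> (\<forall>T. set_integrable lebesgue {0..T} (\<phi> \<omega>)) \<and>
      (\<forall>T. set_integrable lebesgue {0..T} (\<lambda>r. (norm (H r \<omega>))\<^sup>2))"
    and "0 \<le> t \<Longrightarrow> \<rho> t \<in> borel_measurable M"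
    and "0 \<le> s \<Longrightarrow> s \<le> t \<Longrightarrow>
      integrable M (\<lambda>\<omega>. (LINT r:{s..<t}|lebesgue. \<rho> r \<omega> * (2 * (X r \<omega> \<bullet> \<phi> \<omega> r))) +
          (LINT r:{s..<t}|lebesgue. \<rho> r \<omega> * (norm (H r \<omega>))\<^sup>2)) \<and>
      expectation (\<lambda>\<omega>. \<rho> t \<omega> * (norm (X t \<omega>))\<^sup>2) \<le> expectation (\<lambda>\<omega>. \<rho> s \<omega> * (norm (X s \<omega>))\<^sup>2) +
      expectation (\<lambda>\<omega>. (LINT r:{s..<t}|lebesgue. \<rho> r \<omega> * (2 * (X r \<omega> \<bullet> \<phi> \<omega> r))) +
          (LINT r:{s..<t}|lebesgue. \<rho> r \<omega> * (norm (H r \<omega>))\<^sup>2))"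
proof -
  have H: "ito_integrand M F H" and I: "adapted F I"
    using ito_processD(1)[OF X] by (auto simp: has_ito_integral_def)
  obtain k \<tau> \<xi> where si: "\<And>n::nat. simple_integrand M F (k n) (\<tau> n) (\<xi> n)"
    and conv: "AE \<omega> in M. ito_approximates k \<tau> \<xi> H I \<omega>"
    using ito_approximation[OF ito_processD(1)[OF X]] by blast
  have "\<forall>n. \<exists>K\<ge>0. \<forall>i<k n. \<forall>\<omega>\<in>space M. (norm (\<xi> n i \<omega>))\<^sup>2 \<le> K"
    using simple_integrand_bounded[OF si] by metis
  then obtain K where K: "\<And>n. 0 \<le> K n" "\<And>n i \<omega>. i < k n \<Longrightarrow> \<omega> \<in> space M \<Longrightarrow> (norm (\<xi> n i \<omega>))\<^sup>2 \<le> K n"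
    by metis
  \<comment> \<open>The weight on a cell only sees the energy up to its left end point, so the mesh is chosen such
    that a single cell carries energy at most 1.\<close>
  define \<delta> where "\<delta> n = 1 / (real (Suc n) * (K n + 1))" for n
  have \<delta>0: "0 < \<delta> n" for n using K(1)[of n] by (simp add: \<delta>_def)
  have K\<delta>: "K n * \<delta> n \<le> 1" for n
  proof -
    have "K n \<le> real (Suc n) * (K n + 1)" using K(1)[of n] by (simp add: algebra_simps)
    then show ?thesis using K(1)[of n] by (simp add: \<delta>_def divide_simps)
  qed
  have \<delta>lim: "\<delta> \<longlonglongrightarrow> 0"
  proof (rule tendsto_sandwich[OF _ _ tendsto_const lim_1_over_n[THEN LIMSEQ_Suc]])
    show "eventually (\<lambda>n. \<delta> n \<le> 1 / real (Suc n)) sequentially"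
    proof (rule always_eventually, rule allI)
      fix n
      have "real (Suc n) * 1 \<le> real (Suc n) * (K n + 1)" using K(1)[of n] by (intro mult_left_mono) auto
      then show "\<delta> n \<le> 1 / real (Suc n)"
        unfolding \<delta>_def using K(1)[of n] by (intro divide_left_mono) auto
    qed
  qed (use less_imp_le[OF \<delta>0] in auto)
  \<comment> \<open>Almost surely this is \<open>x0\<close> plus the drift integral. Written as a
    difference of two adapted processes it is adapted outright, without any argument about the drift
    integral.\<close>
  define A where "A n i \<omega> = X (real i * \<delta> n) \<omega> - I (real i * \<delta> n) \<omega>" for n i \<omega>
  define Y where "Y n i \<omega> = A n i \<omega> + simple_ito_integral B (k n) (\<tau> n) (\<xi> n) (real i * \<delta> n) \<omega>" for n i \<omega>
  define Q where "Q n i \<omega> = simple_energy (k n) (\<tau> n) (\<xi> n) (real i * \<delta> n) (real (Suc i) * \<delta> n) \<omega>" for n i \<omega>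
  define \<rho>' where "\<rho>' n i \<omega> = cutoff R (grid_cost (\<lambda>j. Y n j \<omega>) (\<lambda>j. A n j \<omega>) (\<lambda>j. Q n j \<omega>) i)" for n i \<omega>
  have grid0: "0 \<le> real i * \<delta> n" for i n using less_imp_le[OF \<delta>0[of n]] by simp
  have mA: "A n i \<in> borel_measurable (F (real i * \<delta> n))" for n i
    using ito_processD(2)[OF X] I grid0 unfolding adapted_def A_def by (intro borel_measurable_diff) auto
  have stepl: "real i * \<delta> n \<le> real (Suc i) * \<delta> n" for i n using less_imp_le[OF \<delta>0[of n]] by (simp add: algebra_simps)
  have Q0: "0 \<le> Q n i \<omega>" for n i \<omega>
    unfolding Q_def using si[of n] stepl by (intro simple_energy_nonneg) (auto simp: simple_integrand_def)
  have Q1: "Q n i \<omega> \<le> 1" if "\<omega> \<in> space M" for n i \<omega>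
  proof -
    have "Q n i \<omega> \<le> K n * (real (Suc i) * \<delta> n - real i * \<delta> n)"
      unfolding Q_def by (intro simple_energy_le[OF si] stepl K that)
    then show ?thesis using K\<delta>[of n] by (simp add: algebra_simps)
  qed
  have mY: "Y n i \<in> borel_measurable M" for n i
    using measurable_F_M[OF measurable_discrete_energy(1)[OF si \<delta>0 mA] grid0] unfolding Y_def .
  have mQ: "Q n i \<in> borel_measurable M" for n i
    using measurable_F_M[OF measurable_discrete_energy(2)[OF si \<delta>0 mA] grid0] unfolding Q_def .
  have m\<rho>': "\<rho>' n i \<in> borel_measurable M" for n i
    using measurable_F_M[OF measurable_discrete_energy(3)[where R = R, OF si \<delta>0 mA] grid0]
    unfolding \<rho>'_def Y_def Q_def .
  note mA' = measurable_F_M[OF mA grid0]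
  \<comment> \<open>All almost sure properties are gathered in one predicate, so that the limits
    below are statements about a single path.\<close>
  define good where "good \<omega> \<longleftrightarrow> \<omega> \<in> space M \<and> continuous_on {0..} (\<lambda>r. X r \<omega>) \<and>
    (\<forall>T\<ge>0. (\<integral>\<^sup>+s\<in>{0..T}. ennreal ((norm (H s \<omega>))\<^sup>2) \<partial>lborel) < \<infinity>) \<and>
    (\<forall>t\<ge>0. set_integrable lebesgue {0..t} (\<phi> \<omega>) \<and>
       X t \<omega> = x0 \<omega> + (LINT s:{0..t}|lebesgue. \<phi> \<omega> s) + I t \<omega>) \<and>
    ito_approximates k \<tau> \<xi> H I \<omega>" for \<omega>
  have AE_good: "AE \<omega> in M. good \<omega>"
  proof -
    have "AE \<omega> in M. continuous_on {0..} (\<lambda>r. X r \<omega>)" using ito_processD(3)[OF X] by (simp add: continuous_process_def)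
    moreover have "AE \<omega> in M. \<forall>T\<ge>0. (\<integral>\<^sup>+s\<in>{0..T}. ennreal ((norm (H s \<omega>))\<^sup>2) \<partial>lborel) < \<infinity>"
      using H by (simp add: ito_integrand_def)
    ultimately show ?thesis using ito_processD(4)[OF X] conv AE_space by eventually_elim (simp only: good_def)
  qed
  have good_nn: "(\<integral>\<^sup>+s\<in>{0..T}. ennreal ((norm (H s \<omega>))\<^sup>2) \<partial>lborel) < \<infinity>" if "good \<omega>" "0 \<le> T" for \<omega> T
    using that unfolding good_def by blast
  have good_conv: "\<forall>\<^sub>F n in sequentially.
      ito_deviation (k n) (\<tau> n) (\<xi> n) H T \<omega> \<le> ennreal \<epsilon>"
    if "good \<omega>" "0 \<le> T" "0 < \<epsilon>" for \<omega> T \<epsilon>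
    using that unfolding good_def ito_approximates_def by (blast intro: eventually_mono)
  have good_space: "\<omega> \<in> space M" if "good \<omega>" for \<omega> using that by (simp add: good_def)
  note good_path = ito_approximation_path[where k = k and \<tau> = \<tau> and \<xi> = \<xi>, OF si H good_space good_nn good_conv]
  have good_facts: "continuous_on {0..} (\<lambda>r. X r \<omega>)" "set_integrable lebesgue {0..T} (\<phi> \<omega>)"
    "set_integrable lebesgue {0..T} (\<lambda>r. (norm (H r \<omega>))\<^sup>2)" if "good \<omega>" for \<omega> T
  proof -
    show "continuous_on {0..} (\<lambda>r. X r \<omega>)" using that by (simp add: good_def)
    show "set_integrable lebesgue {0..T} (\<phi> \<omega>)"
      using that by (cases "0 \<le> T") (auto simp: good_def)
    show "set_integrable lebesgue {0..T} (\<lambda>r. (norm (H r \<omega>))\<^sup>2)"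
      by (rule good_path(1)) (use that in auto)
  qed
  show "AE \<omega> in M. continuous_on {0..} (\<lambda>r. X r \<omega>) \<and> (\<forall>T. set_integrable lebesgue {0..T} (\<phi> \<omega>)) \<and>
      (\<forall>T. set_integrable lebesgue {0..T} (\<lambda>r. (norm (H r \<omega>))\<^sup>2))"
    using AE_good by eventually_elim (use good_facts in blast)
  have lims: "(\<lambda>n. \<rho>' n (grid_index (\<delta> n) t) \<omega>) \<longlonglongrightarrow> \<rho> t \<omega>"
    "(\<lambda>n. Y n (grid_index (\<delta> n) t) \<omega>) \<longlonglongrightarrow> X t \<omega>"
    "(\<lambda>n. energy_increment R (\<lambda>j. Y n j \<omega>) (\<lambda>j. A n j \<omega>) (\<lambda>j. Q n j \<omega>) (grid_index (\<delta> n) s) (grid_index (\<delta> n) t)) \<longlonglongrightarrow>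
      (LINT r:{s..<t}|lebesgue. \<rho> r \<omega> * (2 * (X r \<omega> \<bullet> \<phi> \<omega> r))) +
          (LINT r:{s..<t}|lebesgue. \<rho> r \<omega> * (norm (H r \<omega>))\<^sup>2)"
    if good: "good \<omega>" and st: "0 \<le> s" "s \<le> t" for \<omega> s t
  proof -
    let ?P = "\<lambda>n r. (norm (simple_process (k n) (\<tau> n) (\<xi> n) r \<omega>))\<^sup>2"
    have path: "set_integrable lebesgue {0..T} (?P n)"
      "(\<lambda>n. LINT r:{0..T}|lebesgue. \<bar>?P n r - (norm (H r \<omega>))\<^sup>2\<bar>) \<longlonglongrightarrow> 0" for n T
      by (rule good_path(2,3); use good in auto)+
    have near: "\<forall>\<^sub>F n in sequentially. \<forall>i. real i * \<delta> n \<le> T \<longrightarrow> norm (Y n i \<omega> - X (real i * \<delta> n) \<omega>) < e"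
      if "0 < e" for T e
    proof -
      have "\<forall>\<^sub>F n in sequentially. \<forall>t\<in>{0..max 0 T}. norm (simple_ito_integral B (k n) (\<tau> n) (\<xi> n) t \<omega> - I t \<omega>) \<le> e / 2"
      proof -
        have "0 \<le> max 0 T" "0 < e / 2" using that by auto
        then show ?thesis using good unfolding good_def ito_approximates_def by (blast intro: eventually_mono)
      qed
      then show ?thesis
      proof eventually_elim
        case (elim n)
        show ?case
        proof (intro allI impI)
          fix i assume "real i * \<delta> n \<le> T"
          then have "real i * \<delta> n \<in> {0..max 0 T}" using grid0[of i n] by auto
          then have "norm (simple_ito_integral B (k n) (\<tau> n) (\<xi> n) (real i * \<delta> n) \<omega> - I (real i * \<delta> n) \<omega>) \<le> e / 2"
            using elim by blast
          then show "norm (Y n i \<omega> - X (real i * \<delta> n) \<omega>) < e"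
            using that by (simp add: Y_def A_def algebra_simps)
        qed
      qed
    qed
    have Ainc: "A n (Suc i) \<omega> - A n i \<omega> = (LINT r:cell (\<delta> n) i|lebesgue. \<phi> \<omega> r)" for n i
    proof -
      have "X t \<omega> = x0 \<omega> + (LINT s:{0..t}|lebesgue. \<phi> \<omega> s) + I t \<omega>" if "0 \<le> t" for t
        using good that by (simp add: good_def)
      then have "A n (Suc i) \<omega> - A n i \<omega> = (LINT r:{0..real (Suc i) * \<delta> n}|lebesgue. \<phi> \<omega> r) - (LINT r:{0..real i * \<delta> n}|lebesgue. \<phi> \<omega> r)"
        unfolding A_def using grid0[of i n] grid0[of "Suc i" n] by simp
      also have "\<dots> = (LINT r:cell (\<delta> n) i|lebesgue. \<phi> \<omega> r)"
        unfolding cell_def by (rule set_integral_Icc_diff[OF good_facts(2)[OF good] grid0 stepl])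
      finally show ?thesis .
    qed
    have Qint: "Q n i \<omega> = (LINT r:cell (\<delta> n) i|lebesgue. ?P n r)" for n i
      unfolding Q_def cell_def using si[of n] stepl
      by (intro simple_energy_eq_integral(2)) (auto simp: simple_integrand_def)
    note G = grid_energy_tendsto[OF \<delta>0 \<delta>lim good_facts[OF good] path near Ainc Qint Q0 st R]
    show "(\<lambda>n. \<rho>' n (grid_index (\<delta> n) t) \<omega>) \<longlonglongrightarrow> \<rho> t \<omega>"
      using G(1) unfolding \<rho>'_def \<rho>_def .
    show "(\<lambda>n. Y n (grid_index (\<delta> n) t) \<omega>) \<longlonglongrightarrow> X t \<omega>" using G(2) .
    show "(\<lambda>n. energy_increment R (\<lambda>j. Y n j \<omega>) (\<lambda>j. A n j \<omega>) (\<lambda>j. Q n j \<omega>) (grid_index (\<delta> n) s) (grid_index (\<delta> n) t)) \<longlonglongrightarrow>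
      (LINT r:{s..<t}|lebesgue. \<rho> r \<omega> * (2 * (X r \<omega> \<bullet> \<phi> \<omega> r))) +
          (LINT r:{s..<t}|lebesgue. \<rho> r \<omega> * (norm (H r \<omega>))\<^sup>2)"
      using G(3) unfolding \<rho>_def .
  qed
  show m\<rho>: "\<rho> t \<in> borel_measurable M" if "0 \<le> t" for t
  proof (rule borel_measurable_AE_LIMSEQ)
    show "AE \<omega> in M. (\<lambda>n. \<rho>' n (grid_index (\<delta> n) t) \<omega>) \<longlonglongrightarrow> \<rho> t \<omega>"
      using AE_good by eventually_elim (rule lims(1)[OF _ order_refl that])
  qed (rule m\<rho>')
  have elim: "(\<lambda>n. expectation (\<lambda>\<omega>. \<rho>' n (grid_index (\<delta> n) t) \<omega> * (norm (Y n (grid_index (\<delta> n) t) \<omega>))\<^sup>2)) \<longlonglongrightarrow>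
      expectation (\<lambda>\<omega>. \<rho> t \<omega> * (norm (X t \<omega>))\<^sup>2)" if t: "0 \<le> t" for t
  proof (rule integral_dominated_convergence[where w = "\<lambda>_. R\<^sup>2"])
    show "AE \<omega> in M. (\<lambda>n. \<rho>' n (grid_index (\<delta> n) t) \<omega> * (norm (Y n (grid_index (\<delta> n) t) \<omega>))\<^sup>2)
        \<longlonglongrightarrow> \<rho> t \<omega> * (norm (X t \<omega>))\<^sup>2"
      using AE_good
      by eventually_elim (intro tendsto_mult tendsto_power tendsto_norm lims(1,2)[OF _ order_refl t])
    show "AE \<omega> in M. norm (\<rho>' n (grid_index (\<delta> n) t) \<omega> * (norm (Y n (grid_index (\<delta> n) t) \<omega>))\<^sup>2) \<le> R\<^sup>2" for n
    proof (rule AE_I2)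
      fix \<omega>
      let ?i = "grid_index (\<delta> n) t"
      note C = grid_cost_ge(1,4)[of "\<lambda>j. Q n j \<omega>", OF Q0]
      have "\<rho>' n ?i \<omega> * (norm (Y n ?i \<omega>))\<^sup>2 \<le> R\<^sup>2"
        unfolding \<rho>'_def using R C(1)[of "\<lambda>j. Y n j \<omega>" ?i "\<lambda>j. A n j \<omega>"] C(2)[of "\<lambda>j. Y n j \<omega>" "\<lambda>j. A n j \<omega>" ?i]
        by (intro cutoff_times_le) (auto intro!: power_mono)
      then show "norm (\<rho>' n ?i \<omega> * (norm (Y n ?i \<omega>))\<^sup>2) \<le> R\<^sup>2"
        by (simp add: \<rho>'_def abs_mult abs_of_nonneg[OF cutoff_nonneg])
    qed
  qed (use m\<rho>[OF t] ito_processD(5)[OF X t] m\<rho>' mY in auto)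
  assume st: "0 \<le> s" "s \<le> t"
  then have t: "0 \<le> t" by simp
  let ?Z = "\<lambda>\<omega>. (LINT r:{s..<t}|lebesgue. \<rho> r \<omega> * (2 * (X r \<omega> \<bullet> \<phi> \<omega> r))) +
          (LINT r:{s..<t}|lebesgue. \<rho> r \<omega> * (norm (H r \<omega>))\<^sup>2)"
  let ?E = "\<lambda>n \<omega>. energy_increment R (\<lambda>j. Y n j \<omega>) (\<lambda>j. A n j \<omega>) (\<lambda>j. Q n j \<omega>) (grid_index (\<delta> n) s) (grid_index (\<delta> n) t)"
  have mE: "?E n \<in> borel_measurable M" for n
    unfolding energy_increment_def \<rho>'_def[symmetric] using m\<rho>' mY mA' mQ by measurable
  have limE: "AE \<omega> in M. (\<lambda>n. ?E n \<omega>) \<longlonglongrightarrow> ?Z \<omega>"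
    using AE_good by eventually_elim (rule lims(3)[OF _ st])
  have mZ: "?Z \<in> borel_measurable M"
    by (rule borel_measurable_AE_LIMSEQ[OF mE limE])
  have bE: "AE \<omega> in M. norm (?E n \<omega>) \<le> 2 * R * R + (R + 1)" for n
    by (rule AE_I2) (use energy_increment_bounded[OF R Q0 Q1] in auto)
  have iZ: "integrable M ?Z"
    by (rule integrable_dominated_convergence[OF mZ mE _ limE bE]) simp
  have limZ: "(\<lambda>n. expectation (?E n)) \<longlonglongrightarrow> expectation ?Z"
    by (rule integral_dominated_convergence[OF mZ mE _ limE bE]) simp
  have kl: "grid_index (\<delta> n) s \<le> grid_index (\<delta> n) t" for n
    by (rule grid_index_mono[OF \<delta>0 st(2)])
  have "expectation (\<lambda>\<omega>. \<rho>' n (grid_index (\<delta> n) t) \<omega> * (norm (Y n (grid_index (\<delta> n) t) \<omega>))\<^sup>2) \<le>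
      expectation (\<lambda>\<omega>. \<rho>' n (grid_index (\<delta> n) s) \<omega> * (norm (Y n (grid_index (\<delta> n) s) \<omega>))\<^sup>2) + expectation (?E n)" for n
    using discrete_energy_inequality[OF si \<delta>0 R kl mA]
    unfolding energy_increment_def \<rho>'_def Y_def Q_def .
  from LIMSEQ_le[OF elim[OF t] tendsto_add[OF elim[OF st(1)] limZ]] this iZ
  show "integrable M ?Z \<and> expectation (\<lambda>\<omega>. \<rho> t \<omega> * (norm (X t \<omega>))\<^sup>2) \<le>
      expectation (\<lambda>\<omega>. \<rho> s \<omega> * (norm (X s \<omega>))\<^sup>2) + expectation ?Z"
    by blast
qed

end

section \<open>Truncated second moments\<close>

lemma set_integrable_inner_continuous:
  fixes g \<phi> :: "real \<Rightarrow> 'v::euclidean_space"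
  assumes g: "continuous_on {0..} g" and \<phi>: "\<And>T. set_integrable lebesgue {0..T} \<phi>" and st: "0 \<le> s"
  shows "set_integrable lebesgue {s..<t} (\<lambda>r. g r \<bullet> \<phi> r)"
proof -
  have "bounded (g ` {s..t})"
    using st by (intro compact_imp_bounded compact_continuous_image continuous_on_subset[OF g]) auto
  then obtain C where C: "\<And>r. s \<le> r \<Longrightarrow> r \<le> t \<Longrightarrow> norm (g r) \<le> C"
    unfolding bounded_iff by (meson atLeastAtMost_iff imageI)
  have \<phi>': "integrable lebesgue (\<lambda>r. indicator {s..<t} r *\<^sub>R \<phi> r)"
    unfolding set_integrable_def[symmetric]
    by (rule set_integrable_subset[OF \<phi>[of t]]) (use st in auto)
  have "continuous_on {s..<t} g" using st by (intro continuous_on_subset[OF g]) auto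
  then have "(\<lambda>r. indicator {s..<t} r *\<^sub>R g r) \<in> borel_measurable borel"
    by (intro borel_measurable_continuous_on_indicator) auto
  then have mg: "(\<lambda>r. indicator {s..<t} r *\<^sub>R g r) \<in> borel_measurable lebesgue"
    by (intro measurable_completion) simp
  have eq: "indicator {s..<t} r *\<^sub>R (g r \<bullet> \<phi> r) = (indicator {s..<t} r *\<^sub>R g r) \<bullet> (indicator {s..<t} r *\<^sub>R \<phi> r)" for r
    by (auto simp: indicator_def)
  show ?thesis
    unfolding set_integrable_def eq
  proof (rule Bochner_Integration.integrable_bound[OF integrable_scaleR_right[OF \<phi>', of C]])
    show "(\<lambda>r. (indicator {s..<t} r *\<^sub>R g r) \<bullet> (indicator {s..<t} r *\<^sub>R \<phi> r)) \<in> borel_measurable lebesgue"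
      using \<phi>' mg by (intro borel_measurable_inner) auto
    show "AE r in lebesgue. norm ((indicator {s..<t} r *\<^sub>R g r) \<bullet> (indicator {s..<t} r *\<^sub>R \<phi> r)) \<le>
        norm (C *\<^sub>R (indicator {s..<t} r *\<^sub>R \<phi> r))"
    proof (rule AE_I2)
      fix r
      show "norm ((indicator {s..<t} r *\<^sub>R g r) \<bullet> (indicator {s..<t} r *\<^sub>R \<phi> r)) \<le>
        norm (C *\<^sub>R (indicator {s..<t} r *\<^sub>R \<phi> r))"
      proof (cases "r \<in> {s..<t}")
        case True
        then have "norm (g r) \<le> \<bar>C\<bar>" using C[of r] by auto
        then have "norm (g r) * norm (\<phi> r) \<le> \<bar>C\<bar> * norm (\<phi> r)" by (intro mult_right_mono) auto
        then show ?thesis using True Cauchy_Schwarz_ineq2[of "g r" "\<phi> r"] by simp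
      qed simp
    qed
  qed
qed

lemma set_integrable_const_Icc: "set_integrable lebesgue {0..T::real} (\<lambda>_. c :: real)"
  by (intro absolutely_integrable_on_const) simp

context brownian_setup
begin

lemma continuous_expectation:
  fixes h :: "real \<Rightarrow> 'a \<Rightarrow> real"
  assumes m: "\<And>r. 0 \<le> r \<Longrightarrow> h r \<in> borel_measurable M"
    and c: "AE \<omega> in M. continuous_on {0..} (\<lambda>r. h r \<omega>) \<and> (\<forall>r\<ge>0. \<bar>h r \<omega>\<bar> \<le> K)"
  shows "continuous_on {0..} (\<lambda>r. expectation (h r))"
  unfolding continuous_on_sequentially o_def
proof (intro allI ballI impI)
  fix x a assume a: "a \<in> {0::real..}" and x: "(\<forall>n. x n \<in> {0..}) \<and> x \<longlonglongrightarrow> a"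
  show "(\<lambda>n. expectation (h (x n))) \<longlonglongrightarrow> expectation (h a)"
  proof (rule integral_dominated_convergence[where w = "\<lambda>_. K"])
    show "AE \<omega> in M. (\<lambda>n. h (x n) \<omega>) \<longlonglongrightarrow> h a \<omega>"
      using c
    proof eventually_elim
      case (elim \<omega>)
      then show ?case
        using continuous_on_tendsto_compose[of "{0..}" "\<lambda>r. h r \<omega>" x a sequentially] a x by auto
    qed
    show "AE \<omega> in M. norm (h (x n) \<omega>) \<le> K" for n
    proof -
      have "0 \<le> x n" using x by auto
      then show ?thesis using c by auto
    qed
  qed (use m a x in auto)
qed

lemma expectation_bounded:
  fixes h :: "'a \<Rightarrow> real"
  assumes "h \<in> borel_measurable M" "AE \<omega> in M. \<bar>h \<omega>\<bar> \<le> K"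
  shows "integrable M h" "\<bar>expectation h\<bar> \<le> K"
proof -
  show i: "integrable M h"
    by (rule integrable_const_bound[where B = K]) (use assms in auto)
  have "expectation (\<lambda>\<omega>. \<bar>h \<omega>\<bar>) \<le> K"
    by (rule integral_le_const) (use i assms in auto)
  then show "\<bar>expectation h\<bar> \<le> K" using integral_abs_bound[of M h] by linarith
qed

text \<open>Riemann sums replace Fubini's theorem, so that joint measurability is not needed.\<close>

lemma expectation_set_integral:
  fixes h :: "real \<Rightarrow> 'a \<Rightarrow> real"
  assumes m: "\<And>r. 0 \<le> r \<Longrightarrow> h r \<in> borel_measurable M"
    and c: "AE \<omega> in M. continuous_on {0..} (\<lambda>r. h r \<omega>) \<and> (\<forall>r\<ge>0. \<bar>h r \<omega>\<bar> \<le> K)"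
    and st: "0 \<le> s" "s \<le> t"
  shows "integrable M (\<lambda>\<omega>. LINT r:{s..<t}|lebesgue. h r \<omega>)"
    and "expectation (\<lambda>\<omega>. LINT r:{s..<t}|lebesgue. h r \<omega>) = (LINT r:{s..<t}|lebesgue. expectation (h r))"
proof -
  define \<delta> where "\<delta> n = 1 / real (Suc n)" for n
  have \<delta>: "0 < \<delta> n" "\<delta> \<longlonglongrightarrow> 0" for n
    unfolding \<delta>_def[abs_def] using lim_1_over_n[THEN LIMSEQ_Suc] by simp_all
  let ?k = "\<lambda>n. grid_index (\<delta> n) s" and ?l = "\<lambda>n. grid_index (\<delta> n) t"
  have t: "0 \<le> t" using st by simp
  have kl: "?k n \<le> ?l n" for n
    by (rule grid_index_mono[OF \<delta>(1) st(2)])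
  have grid0: "0 \<le> real i * \<delta> n" for i n using less_imp_le[OF \<delta>(1)[of n]] by simp
  \<comment> \<open>With constant density 1 the increments of the indefinite integral are the cell
    lengths, and \<open>grid_sum_tendsto\<close> becomes convergence of ordinary Riemann
    sums.\<close>
  have cell1: "(LINT r:cell (\<delta> n) i|lebesgue. (1::real)) = \<delta> n" for n i
  proof -
    have "(LINT r:cell (\<delta> n) i|lebesgue. (1::real)) = measure lebesgue (cell (\<delta> n) i)"
      unfolding set_lebesgue_integral_def by simp
    also have "\<dots> = \<delta> n" using \<delta>(1)[of n] by (simp add: cell_def algebra_simps)
    finally show ?thesis .
  qed
  have riemann: "(\<lambda>n. \<Sum>i=?k n..<?l n. u (real i * \<delta> n) * \<delta> n) \<longlonglongrightarrow> (LINT r:{s..<t}|lebesgue. u r)"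
    if u: "continuous_on {0..} u" "\<And>r. 0 \<le> r \<Longrightarrow> \<bar>u r\<bar> \<le> K" for u :: "real \<Rightarrow> real"
  proof -
    have "(\<lambda>n. \<Sum>i=?k n..<?l n. u (real i * \<delta> n) \<bullet> (LINT r:cell (\<delta> n) i|lebesgue. (1::real))) \<longlonglongrightarrow>
        (LINT r:{s..<t}|lebesgue. u r \<bullet> 1)"
    proof (rule grid_sum_tendsto[OF \<delta> set_integrable_const_Icc[of "t + 1"] tendsto_grid_index(1)[OF \<delta> st(1)] tendsto_grid_index(1)[OF \<delta> t] kl st])
      show "norm (u (real i * \<delta> n)) \<le> K" for n i using u(2)[OF grid0] by simp
      fix r :: real assume r: "0 \<le> r"
      show "(\<lambda>n. u (real (grid_index (\<delta> n) r) * \<delta> n)) \<longlonglongrightarrow> u r"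
        by (rule continuous_on_tendsto_compose[OF u(1) tendsto_grid_index(1)[OF \<delta> r]]) (use r grid0 in auto)
    qed simp
    then show ?thesis by (simp add: cell1)
  qed
  define S where "S n \<omega> = (\<Sum>i=?k n..<?l n. h (real i * \<delta> n) \<omega> * \<delta> n)" for n \<omega>
  have mS: "S n \<in> borel_measurable M" for n
    unfolding S_def using m[OF grid0] by measurable
  have limS: "AE \<omega> in M. (\<lambda>n. S n \<omega>) \<longlonglongrightarrow> (LINT r:{s..<t}|lebesgue. h r \<omega>)"
    using c unfolding S_def by eventually_elim (rule riemann, auto)
  have bS: "AE \<omega> in M. norm (S n \<omega>) \<le> \<bar>K\<bar> * t" for n
    using c
  proof eventually_elim
    case (elim \<omega>)
    have "norm (S n \<omega>) \<le> (\<Sum>i=?k n..<?l n. \<bar>K\<bar> * \<delta> n)"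
      unfolding S_def
    proof (rule order_trans[OF norm_sum], rule sum_mono)
      fix i
      have "\<bar>h (real i * \<delta> n) \<omega>\<bar> \<le> \<bar>K\<bar>" using elim grid0[of i n] by fastforce
      then show "norm (h (real i * \<delta> n) \<omega> * \<delta> n) \<le> \<bar>K\<bar> * \<delta> n"
        using \<delta>(1)[of n] by (simp add: abs_mult mult_right_mono)
    qed
    also have "\<dots> = \<bar>K\<bar> * (real (?l n - ?k n) * \<delta> n)" by simp
    also have "\<dots> \<le> \<bar>K\<bar> * t"
    proof (intro mult_left_mono)
      have "real (?l n - ?k n) * \<delta> n \<le> real (?l n) * \<delta> n" using \<delta>(1)[of n] by (intro mult_right_mono) auto
      then show "real (?l n - ?k n) * \<delta> n \<le> t" using grid_index_bounds(1)[OF \<delta>(1) t, of n] by linarith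
    qed simp
    finally show ?case .
  qed
  have mL: "(\<lambda>\<omega>. LINT r:{s..<t}|lebesgue. h r \<omega>) \<in> borel_measurable M"
    by (rule borel_measurable_AE_LIMSEQ[OF mS limS])
  show "integrable M (\<lambda>\<omega>. LINT r:{s..<t}|lebesgue. h r \<omega>)"
    by (rule integrable_dominated_convergence[OF mL mS _ limS bS]) simp
  have "(\<lambda>n. expectation (S n)) \<longlonglongrightarrow> expectation (\<lambda>\<omega>. LINT r:{s..<t}|lebesgue. h r \<omega>)"
    by (rule integral_dominated_convergence[OF mL mS _ limS bS]) simp
  moreover have b: "integrable M (h r)" "\<bar>expectation (h r)\<bar> \<le> K" if "0 \<le> r" for r
  proof -
    have "AE \<omega> in M. \<bar>h r \<omega>\<bar> \<le> K" using c that by auto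
    from expectation_bounded[OF m[OF that] this] show "integrable M (h r)" "\<bar>expectation (h r)\<bar> \<le> K" .
  qed
  then have "expectation (S n) = (\<Sum>i=?k n..<?l n. expectation (h (real i * \<delta> n)) * \<delta> n)" for n
    unfolding S_def using grid0 by (subst Bochner_Integration.integral_sum) auto
  moreover have "(\<lambda>n. \<Sum>i=?k n..<?l n. expectation (h (real i * \<delta> n)) * \<delta> n) \<longlonglongrightarrow>
      (LINT r:{s..<t}|lebesgue. expectation (h r))"
    by (intro riemann continuous_expectation[OF m c] b)
  ultimately show "expectation (\<lambda>\<omega>. LINT r:{s..<t}|lebesgue. h r \<omega>) = (LINT r:{s..<t}|lebesgue. expectation (h r))"
    using LIMSEQ_unique by simp
qed

text \<open>The coefficients enter only through \<open>diss\<close>, an inequality between path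
  values that can be multiplied by the weight. The result for \<open>m\<close> stays in integrated
  form because \<open>m\<close> is known to be continuous but not differentiable.\<close>

lemma truncated_moment_inequality:
  fixes X I :: "real \<Rightarrow> 'a \<Rightarrow> real^'d" and H :: "real \<Rightarrow> 'a \<Rightarrow> real^'m^'d" and \<phi> :: "'a \<Rightarrow> real \<Rightarrow> real^'d"
  assumes X: "ito_process X x0 \<phi> H I"
    and R: "0 < R" and q: "0 < q" "q < 1" and \<mu>: "0 \<le> \<mu>"
    and diss: "\<forall>r\<ge>0. \<forall>\<omega>.
      2 * (X r \<omega> \<bullet> \<phi> \<omega> r) + (norm (H r \<omega>))\<^sup>2 \<le> - \<kappa> * (norm (X r \<omega>))\<^sup>2 + \<mu> * (norm (X (q * r) \<omega>))\<^sup>2"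
  defines "\<rho> \<equiv> \<lambda>r \<omega>. cutoff R (path_cost (\<lambda>r. X r \<omega>) (\<phi> \<omega>) (\<lambda>r. (norm (H r \<omega>))\<^sup>2) r)"
  defines "m \<equiv> \<lambda>r. expectation (\<lambda>\<omega>. \<rho> r \<omega> * (norm (X r \<omega>))\<^sup>2)"
  shows "0 \<le> r \<Longrightarrow> \<rho> r \<in> borel_measurable M"
    and "AE \<omega> in M. \<forall>r\<ge>0. 0 \<le> \<rho> r \<omega> \<and> \<rho> r \<omega> \<le> 1"
    and "0 \<le> r \<Longrightarrow> integrable M (\<lambda>\<omega>. \<rho> r \<omega> * (norm (X r \<omega>))\<^sup>2)"
    and "continuous_on {0..} m"
    and "0 \<le> s \<Longrightarrow> s \<le> t \<Longrightarrow> m t \<le> m s + (LINT r:{s..<t}|lebesgue. - \<kappa> * m r + \<mu> * m (q * r))"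
proof -
  show m\<rho>: "\<rho> r \<in> borel_measurable M" if "0 \<le> r" for r
    unfolding \<rho>_def by (rule energy_limit(2)[OF X R that])
  note mX = ito_processD(5)[OF X]
  define p where "p r \<omega> = \<rho> r \<omega> * (norm (X r \<omega>))\<^sup>2" for r \<omega>
  have mp: "p r \<in> borel_measurable M" if "0 \<le> r" for r
    unfolding p_def using m\<rho>[OF that] mX[OF that] by measurable
  define C where "C \<omega> = path_cost (\<lambda>r. X r \<omega>) (\<phi> \<omega>) (\<lambda>r. (norm (H r \<omega>))\<^sup>2)" for \<omega>
  define good where "good \<omega> \<longleftrightarrow> continuous_on {0..} (\<lambda>r. X r \<omega>) \<and> (\<forall>T. set_integrable lebesgue {0..T} (\<phi> \<omega>)) \<and>
      (\<forall>T. set_integrable lebesgue {0..T} (\<lambda>r. (norm (H r \<omega>))\<^sup>2))" for \<omega>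
  have AE_good: "AE \<omega> in M. good \<omega>"
    unfolding good_def by (rule energy_limit(1)[OF X R])
  have goodD: "continuous_on {0..} (\<lambda>r. X r \<omega>)" "set_integrable lebesgue {0..T} (\<phi> \<omega>)"
      "set_integrable lebesgue {0..T} (\<lambda>r. (norm (H r \<omega>))\<^sup>2)" if "good \<omega>" for \<omega> T
    using that by (auto simp: good_def)
  have \<rho>C: "\<rho> r \<omega> = cutoff R (C \<omega> r)" for r \<omega> by (simp add: \<rho>_def C_def)
  have Cf: "continuous_on {0..} (C \<omega>)" "0 \<le> s \<Longrightarrow> s \<le> t \<Longrightarrow> C \<omega> s \<le> C \<omega> t" "0 \<le> t \<Longrightarrow> norm (X t \<omega>) \<le> C \<omega> t"
    if "good \<omega>" for \<omega> s t
    unfolding C_def using path_cost_facts(1)[OF goodD[OF that]] path_cost_facts(2)[OF goodD[OF that], of s t]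
      path_cost_facts(3)[OF goodD[OF that], of t] by auto
  have c\<rho>: "continuous_on {0..} (\<lambda>r. \<rho> r \<omega>)" if "good \<omega>" for \<omega>
    unfolding \<rho>C by (rule continuous_on_compose2[OF continuous_cutoff Cf(1)[OF that]]) simp
  have cp: "continuous_on {0..} (\<lambda>r. p r \<omega>)" if "good \<omega>" for \<omega>
    unfolding p_def by (intro continuous_intros c\<rho> goodD that)
  have \<rho>01: "0 \<le> \<rho> r \<omega> \<and> \<rho> r \<omega> \<le> 1" if "good \<omega>" "0 \<le> r" for r \<omega>
    using cutoff_nonneg[of R "C \<omega> r"] cutoff_le_one[OF R, of "C \<omega> r"] order_trans[OF norm_ge_zero Cf(3)[OF that]]
    by (simp add: \<rho>C)
  show "AE \<omega> in M. \<forall>r\<ge>0. 0 \<le> \<rho> r \<omega> \<and> \<rho> r \<omega> \<le> 1"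
    using AE_good by eventually_elim (use \<rho>01 in blast)
  have pb: "0 \<le> p r \<omega> \<and> p r \<omega> \<le> R\<^sup>2" if "good \<omega>" "0 \<le> r" for r \<omega>
  proof -
    have "\<rho> r \<omega> * (norm (X r \<omega>))\<^sup>2 \<le> R\<^sup>2"
      unfolding \<rho>C using R Cf(3)[OF that] order_trans[OF norm_ge_zero Cf(3)[OF that]]
      by (intro cutoff_times_le) (auto intro!: power_mono)
    then show ?thesis using \<rho>01[OF that] by (simp add: p_def)
  qed
  have AEp: "AE \<omega> in M. continuous_on {0..} (\<lambda>r. p r \<omega>) \<and> (\<forall>r\<ge>0. \<bar>p r \<omega>\<bar> \<le> R\<^sup>2)"
    using AE_good by eventually_elim (use cp pb in auto)
  have ip: "integrable M (p r)" if "0 \<le> r" for r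
  proof -
    have "AE \<omega> in M. \<bar>p r \<omega>\<bar> \<le> R\<^sup>2" using AEp that by auto
    then show ?thesis by (rule expectation_bounded(1)[OF mp[OF that]])
  qed
  show "0 \<le> r \<Longrightarrow> integrable M (\<lambda>\<omega>. \<rho> r \<omega> * (norm (X r \<omega>))\<^sup>2)" using ip[of r] by (simp add: p_def[abs_def])
  have mp_eq: "m r = expectation (p r)" for r by (simp add: m_def p_def[abs_def])
  show "continuous_on {0..} m"
    unfolding mp_eq[abs_def] by (rule continuous_expectation[OF mp AEp])
  assume st: "0 \<le> s" "s \<le> t"
  let ?Z = "\<lambda>\<omega>. (LINT r:{s..<t}|lebesgue. \<rho> r \<omega> * (2 * (X r \<omega> \<bullet> \<phi> \<omega> r))) +
          (LINT r:{s..<t}|lebesgue. \<rho> r \<omega> * (norm (H r \<omega>))\<^sup>2)"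
  have Z: "integrable M ?Z" "m t \<le> m s + expectation ?Z"
    using energy_limit(3)[OF X R st] unfolding m_def \<rho>_def by blast+
  \<comment> \<open>The truncated drift and energy terms are merely integrable in time;
    \<open>h\<close> dominates their sum and is continuous and bounded. So the comparison is made
    along each path first, and only for \<open>h\<close> are expectation and time integral
    exchanged.\<close>
  define h where "h r \<omega> = - \<kappa> * p r \<omega> + \<mu> * p (q * r) \<omega>" for r \<omega>
  have qr: "0 \<le> q * r" "q * r \<le> r" if "0 \<le> r" for r
    using q that by (auto simp: mult_left_le_one_le)
  have mh: "h r \<in> borel_measurable M" if "0 \<le> r" for r
    unfolding h_def using mp[OF that] mp[OF qr(1)[OF that]] by measurable
  have ch: "continuous_on {0..} (\<lambda>r. h r \<omega>)" if "good \<omega>" for \<omega>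
  proof -
    have "continuous_on {0..} (\<lambda>r. p (q * r) \<omega>)"
      by (rule continuous_on_compose2[OF cp[OF that]]) (use q in \<open>auto intro!: continuous_intros\<close>)
    then show ?thesis unfolding h_def by (intro continuous_intros cp that)
  qed
  have AEh: "AE \<omega> in M. continuous_on {0..} (\<lambda>r. h r \<omega>) \<and> (\<forall>r\<ge>0. \<bar>h r \<omega>\<bar> \<le> \<bar>\<kappa>\<bar> * R\<^sup>2 + \<mu> * R\<^sup>2)"
    using AE_good
  proof eventually_elim
    case (elim \<omega>)
    have "\<bar>h r \<omega>\<bar> \<le> \<bar>\<kappa>\<bar> * R\<^sup>2 + \<mu> * R\<^sup>2" if r: "0 \<le> r" for r
    proof -
      have "\<bar>h r \<omega>\<bar> \<le> \<bar>\<kappa>\<bar> * \<bar>p r \<omega>\<bar> + \<mu> * \<bar>p (q * r) \<omega>\<bar>"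
        unfolding h_def using abs_triangle_ineq[of "- \<kappa> * p r \<omega>" "\<mu> * p (q * r) \<omega>"] \<mu> by (simp add: abs_mult)
      also have "\<dots> \<le> \<bar>\<kappa>\<bar> * R\<^sup>2 + \<mu> * R\<^sup>2"
        using pb[OF elim r] pb[OF elim qr(1)[OF r]] \<mu> by (intro add_mono mult_left_mono) auto
      finally show ?thesis .
    qed
    then show ?case using ch[OF elim] by blast
  qed
  note Eh = expectation_set_integral[OF mh AEh st]
  have "expectation ?Z \<le> expectation (\<lambda>\<omega>. LINT r:{s..<t}|lebesgue. h r \<omega>)"
  proof (rule integral_mono_AE[OF Z(1) Eh(1)])
    show "AE \<omega> in M. ?Z \<omega> \<le> (LINT r:{s..<t}|lebesgue. h r \<omega>)"
      using AE_good
    proof eventually_elim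
      case (elim \<omega>)
      have "set_integrable lebesgue {s..<t} (\<lambda>r. ((\<rho> r \<omega> * 2) *\<^sub>R X r \<omega>) \<bullet> \<phi> \<omega> r)"
        by (intro set_integrable_inner_continuous goodD st elim continuous_intros c\<rho>)
      then have i1: "set_integrable lebesgue {s..<t} (\<lambda>r. \<rho> r \<omega> * (2 * (X r \<omega> \<bullet> \<phi> \<omega> r)))"
        by (simp add: mult.assoc)
      have "set_integrable lebesgue {s..<t} (\<lambda>r. \<rho> r \<omega> \<bullet> (norm (H r \<omega>))\<^sup>2)"
        by (intro set_integrable_inner_continuous goodD st elim c\<rho>)
      then have i2: "set_integrable lebesgue {s..<t} (\<lambda>r. \<rho> r \<omega> * (norm (H r \<omega>))\<^sup>2)" by simp
      have "set_integrable lebesgue {s..<t} (\<lambda>r. h r \<omega> \<bullet> 1)"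
        by (intro set_integrable_inner_continuous ch elim st set_integrable_const_Icc)
      then have i3: "set_integrable lebesgue {s..<t} (\<lambda>r. h r \<omega>)" by simp
      have "?Z \<omega> = (LINT r:{s..<t}|lebesgue. \<rho> r \<omega> * (2 * (X r \<omega> \<bullet> \<phi> \<omega> r)) + \<rho> r \<omega> * (norm (H r \<omega>))\<^sup>2)"
        using set_integral_add(2)[OF i1 i2] by simp
      also have "\<dots> \<le> (LINT r:{s..<t}|lebesgue. h r \<omega>)"
      proof (rule set_integral_mono[OF set_integral_add(1)[OF i1 i2] i3])
        fix r assume "r \<in> {s..<t}"
        then have r: "0 \<le> r" using st by simp
        have "\<rho> r \<omega> * (2 * (X r \<omega> \<bullet> \<phi> \<omega> r)) + \<rho> r \<omega> * (norm (H r \<omega>))\<^sup>2 =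
            \<rho> r \<omega> * (2 * (X r \<omega> \<bullet> \<phi> \<omega> r) + (norm (H r \<omega>))\<^sup>2)" by (simp add: algebra_simps)
        also have "\<dots> \<le> \<rho> r \<omega> * (- \<kappa> * (norm (X r \<omega>))\<^sup>2 + \<mu> * (norm (X (q * r) \<omega>))\<^sup>2)"
          using \<rho>01[OF elim r] by (intro mult_left_mono diss[rule_format, OF r]) simp
        also have "\<dots> = - \<kappa> * p r \<omega> + \<mu> * (\<rho> r \<omega> * (norm (X (q * r) \<omega>))\<^sup>2)"
          by (simp add: p_def algebra_simps)
        also have "\<dots> \<le> h r \<omega>"
        proof -
          have "\<rho> r \<omega> \<le> \<rho> (q * r) \<omega>"
            unfolding \<rho>C by (intro cutoff_antimono R Cf(2)[OF elim] qr r)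
          then have "\<rho> r \<omega> * (norm (X (q * r) \<omega>))\<^sup>2 \<le> p (q * r) \<omega>"
            unfolding p_def by (intro mult_right_mono) auto
          then show ?thesis using \<mu> by (simp add: h_def mult_left_mono)
        qed
        finally show "\<rho> r \<omega> * (2 * (X r \<omega> \<bullet> \<phi> \<omega> r)) + \<rho> r \<omega> * (norm (H r \<omega>))\<^sup>2 \<le> h r \<omega>" .
      qed
      finally show ?case .
    qed
  qed
  also have "\<dots> = (LINT r:{s..<t}|lebesgue. expectation (h r))" by (rule Eh(2))
  also have "\<dots> = (LINT r:{s..<t}|lebesgue. - \<kappa> * m r + \<mu> * m (q * r))"
  proof (rule set_lebesgue_integral_cong)
    show "\<forall>r. r \<in> {s..<t} \<longrightarrow> expectation (h r) = - \<kappa> * m r + \<mu> * m (q * r)"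
    proof (intro allI impI)
      fix r assume "r \<in> {s..<t}"
      then have r: "0 \<le> r" using st by simp
      have "expectation (h r) = expectation (\<lambda>\<omega>. - \<kappa> * p r \<omega>) + expectation (\<lambda>\<omega>. \<mu> * p (q * r) \<omega>)"
        unfolding h_def by (intro Bochner_Integration.integral_add integrable_mult_right ip r qr)
      then show "expectation (h r) = - \<kappa> * m r + \<mu> * m (q * r)" by (simp add: mp_eq)
    qed
  qed simp
  finally show "m t \<le> m s + (LINT r:{s..<t}|lebesgue. - \<kappa> * m r + \<mu> * m (q * r))" using Z(2) by linarith
qed

end

section \<open>Comparison and decay\<close>

text \<open>A first crossing argument. At the first time \<open>T\<close> at which \<open>m\<close>
  reaches the barrier \<open>v\<close>, all delayed values still lie below \<open>v\<close>, so the
  growth rate of \<open>m\<close> is strictly below the slope of \<open>v\<close>. Just before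
  \<open>T\<close> the function \<open>m\<close> was below \<open>v\<close> and gained less than
  \<open>v\<close> did, so it cannot have caught up.\<close>

lemma pantograph_comparison:
  fixes m :: "real \<Rightarrow> real"
  assumes m: "continuous_on {0..} m"
    and ineq: "\<And>s t. 0 \<le> s \<Longrightarrow> s \<le> t \<Longrightarrow> m t \<le> m s + (LINT r:{s..<t}|lebesgue. - \<kappa> * m r + \<mu> * m (q * r))"
    and q: "0 < q" "q < 1" and \<mu>: "0 \<le> \<mu>" and \<alpha>: "\<alpha> < 0" "- \<kappa> + \<mu> * q powr \<alpha> < \<alpha>"
    and K: "0 < K" "m 0 < K" and t: "0 \<le> t"
  shows "m t \<le> K * (1 + t) powr \<alpha>"
proof (rule ccontr)
  define v where "v t = K * (1 + t) powr \<alpha>" for t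
  define g where "g r = - \<kappa> * m r + \<mu> * m (q * r)" for r
  assume "\<not> m t \<le> K * (1 + t) powr \<alpha>"
  then have mt: "v t < m t" by (simp add: v_def)
  have cv: "continuous_on {0..} v"
    unfolding v_def by (intro continuous_intros) auto
  have cmq: "continuous_on {0..} (\<lambda>r. m (q * r))"
    by (rule continuous_on_compose2[OF m]) (use q in \<open>auto intro!: continuous_intros\<close>)
  have cg: "continuous_on {0..} g"
    unfolding g_def by (intro continuous_intros m cmq)
  define S where "S = {r\<in>{0..t}. v r \<le> m r}"
  have tS: "t \<in> S" using t mt by (simp add: S_def)
  have clS: "closed S"
  proof -
    have "continuous_on {0..t} (\<lambda>r. m r - v r)"
      by (intro continuous_intros continuous_on_subset[OF cv] continuous_on_subset[OF m]) auto
    then have "closed ({0..t} \<inter> (\<lambda>r. m r - v r) -` {0..})"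
      by (rule continuous_closed_preimage) auto
    moreover have "S = {0..t} \<inter> (\<lambda>r. m r - v r) -` {0..}" by (auto simp: S_def)
    ultimately show ?thesis by simp
  qed
  have bS: "bdd_below S" by (intro bdd_belowI[of _ 0]) (auto simp: S_def)
  define T where "T = Inf S"
  have TS: "T \<in> S" unfolding T_def using closed_contains_Inf[OF _ bS clS] tS by blast
  then have T0: "0 \<le> T" and vT: "v T \<le> m T" by (auto simp: S_def)
  have less: "m r < v r" if "0 \<le> r" "r < T" for r
  proof (rule ccontr)
    assume "\<not> m r < v r"
    moreover have "r \<le> t" using that TS by (simp add: S_def)
    ultimately have "r \<in> S" using that by (simp add: S_def)
    then have "T \<le> r" unfolding T_def by (rule cInf_lower[OF _ bS])
    then show False using that by simp
  qed
  have "T \<noteq> 0" using vT K by (auto simp: v_def)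
  with T0 have Tpos: "0 < T" by simp
  have vpos: "0 < v r" if "0 \<le> r" for r using K that by (simp add: v_def)
  define d where "d = \<alpha> * v T / (1 + T)"
  have der: "(v has_real_derivative d) (at T)"
  proof -
    have "(v has_real_derivative K * (\<alpha> * (1 + T) powr (\<alpha> - 1))) (at T)"
      unfolding v_def[abs_def] using Tpos by (auto intro!: derivative_eq_intros)
    moreover have "K * (\<alpha> * (1 + T) powr (\<alpha> - 1)) = d"
      using Tpos by (simp add: d_def v_def powr_diff)
    ultimately show ?thesis by simp
  qed
  have gT: "g T < d"
  proof -
    have qT: "0 \<le> q * T" "q * T < T" using q Tpos by auto
    have mT: "m T = v T"
    proof -
      have 1: "(\<lambda>n. T - T / real (Suc n)) \<longlonglongrightarrow> T"
        using tendsto_diff[OF tendsto_const tendsto_mult[OF tendsto_const lim_1_over_n[THEN LIMSEQ_Suc]], of T T] by simp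
      have pos: "0 \<le> T - T / real (Suc n)" "T - T / real (Suc n) < T" for n
        using Tpos by (simp_all add: divide_simps)
      have "(\<lambda>n. m (T - T / real (Suc n))) \<longlonglongrightarrow> m T"
        by (rule continuous_on_tendsto_compose[OF m 1]) (use T0 pos in auto)
      moreover have "(\<lambda>n. v (T - T / real (Suc n))) \<longlonglongrightarrow> v T"
        by (rule continuous_on_tendsto_compose[OF cv 1]) (use T0 pos in auto)
      ultimately have "m T \<le> v T"
        by (rule LIMSEQ_le) (use less[OF pos] in \<open>auto intro: less_imp_le\<close>)
      then show ?thesis using vT by simp
    qed
    \<comment> \<open>For a negative exponent, \<open>q * (1 + T) \<le> 1 + q * T\<close> bounds the
      barrier at the delayed time by \<open>q powr \<alpha>\<close> times its present value. This is
      the origin of the factor in the condition on \<alpha>.\<close>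
    have "v (q * T) \<le> q powr \<alpha> * v T"
    proof -
      have "q * (1 + T) \<le> 1 + q * T" using q by (simp add: algebra_simps)
      then have "(1 + q * T) powr \<alpha> \<le> (q * (1 + T)) powr \<alpha>"
        using \<alpha> q Tpos by (intro powr_mono2') auto
      also have "\<dots> = q powr \<alpha> * (1 + T) powr \<alpha>" using q Tpos by (simp add: powr_mult)
      finally show ?thesis using K by (simp add: v_def mult.left_commute)
    qed
    then have "\<mu> * m (q * T) \<le> \<mu> * (q powr \<alpha> * v T)"
      using less[OF qT] \<mu> by (intro mult_left_mono) auto
    then have "g T \<le> (- \<kappa> + \<mu> * q powr \<alpha>) * v T" by (simp add: g_def mT algebra_simps)
    also have "\<dots> < \<alpha> * v T" using \<alpha>(2) vpos[OF T0] by simp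
    \<comment> \<open>The logarithmic slope of the barrier is \<open>\<alpha> / (1 + T)\<close>,
      which is no steeper than \<alpha>.\<close>
    also have "\<dots> \<le> d"
    proof -
      have "v T / (1 + T) \<le> v T" using vpos[OF T0] Tpos by (simp add: divide_simps)
      then show ?thesis using \<alpha>(1) unfolding d_def times_divide_eq_right[symmetric] by (intro mult_left_mono_neg) auto
    qed
    finally show ?thesis .
  qed
  \<comment> \<open>A slope strictly between the rate at \<open>T\<close> and the slope of the
    barrier: near \<open>T\<close> the rate stays below \<open>e\<close> by continuity, while the
    secants of \<open>v\<close> ending at \<open>T\<close> are steeper than
    \<open>e\<close>.\<close>
  define e where "e = (g T + d) / 2"
  have e: "g T < e" "e < d" using gT by (simp_all add: e_def)
  have "((\<lambda>r. v r - e * r) has_real_derivative d - e) (at T)"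
    by (auto intro!: derivative_eq_intros der)
  from DERIV_pos_inc_left[OF this] e obtain \<eta>1 where
    \<eta>1: "0 < \<eta>1" "\<And>h. 0 < h \<Longrightarrow> h < \<eta>1 \<Longrightarrow> v (T - h) - e * (T - h) < v T - e * T" by auto
  obtain \<eta>2 where \<eta>2: "0 < \<eta>2" "\<And>r. 0 \<le> r \<Longrightarrow> dist r T < \<eta>2 \<Longrightarrow> dist (g r) (g T) < e - g T"
  proof -
    have "0 < e - g T" using e(1) by simp
    with cg T0 obtain \<eta> where "0 < \<eta>" "\<forall>r\<in>{0..}. dist r T < \<eta> \<longrightarrow> dist (g r) (g T) < e - g T"
      unfolding continuous_on_iff by (meson atLeast_iff)
    then show thesis using that by auto
  qed
  define h where "h = min (min \<eta>1 \<eta>2) T / 2"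
  have h: "0 < h" "h < \<eta>1" "h < \<eta>2" "h < T" using \<eta>1(1) \<eta>2(1) Tpos by (auto simp: h_def min_def)
  have s: "0 \<le> T - h" "T - h \<le> T" "T - h < T" using h by auto
  have "set_integrable lebesgue {T - h..<T} (\<lambda>r. g r \<bullet> 1)"
    by (intro set_integrable_inner_continuous cg set_integrable_const_Icc s)
  then have ig: "set_integrable lebesgue {T - h..<T} g" by simp
  have "(LINT r:{T - h..<T}|lebesgue. g r) \<le> (LINT r:{T - h..<T}|lebesgue. e)"
  proof (rule set_integral_mono[OF ig])
    show "set_integrable lebesgue {T - h..<T} (\<lambda>r. e)"
      by (rule set_integrable_subset[OF set_integrable_const_Icc[of T]]) (use s in auto)
    fix r assume "r \<in> {T - h..<T}"
    then have "dist (g r) (g T) < e - g T" using s h by (intro \<eta>2(2)) (auto simp: dist_real_def)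
    then show "g r \<le> e" by (simp add: dist_real_def)
  qed
  also have "\<dots> = e * h" using h by (simp add: set_lebesgue_integral_def)
  finally have "m T \<le> m (T - h) + e * h" using ineq[OF s(1,2)] by (simp add: g_def)
  moreover have "v (T - h) < v T - e * h" using \<eta>1(2)[OF h(1,2)] by (simp add: algebra_simps)
  moreover have "m (T - h) < v (T - h)" by (rule less[OF s(1,3)])
  ultimately show False using vT by linarith
qed

text \<open>At exponent 0 the condition reads \<open>\<mu> < \<kappa>\<close>. Being strict, it
  persists by continuity for slightly negative exponents.\<close>

lemma decay_exponent_exists:
  fixes \<kappa> \<mu> q :: real
  assumes "\<mu> < \<kappa>" "0 < q"
  obtains \<alpha> where "\<alpha> < 0" "- \<kappa> + \<mu> * q powr \<alpha> < \<alpha>"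
proof -
  have "isCont (\<lambda>\<alpha>. \<alpha> - (- \<kappa> + \<mu> * q powr \<alpha>)) 0"
    using assms by (intro continuous_intros) auto
  then have "((\<lambda>\<alpha>. \<alpha> - (- \<kappa> + \<mu> * q powr \<alpha>)) \<longlongrightarrow> \<kappa> - \<mu>) (at_left 0)"
    using assms(2) by (auto simp: isCont_def intro: tendsto_within_subset)
  from order_tendstoD(1)[OF this, of 0] assms(1)
  have "eventually (\<lambda>\<alpha>. 0 < \<alpha> - (- \<kappa> + \<mu> * q powr \<alpha>)) (at_left 0)" by simp
  moreover have "eventually (\<lambda>\<alpha>::real. \<alpha> < 0) (at_left 0)" by (simp add: eventually_at_filter)
  ultimately have "eventually (\<lambda>\<alpha>. \<alpha> < 0 \<and> - \<kappa> + \<mu> * q powr \<alpha> < \<alpha>) (at_left 0)"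
    by eventually_elim simp
  then obtain \<alpha> where "\<alpha> < 0 \<and> - \<kappa> + \<mu> * q powr \<alpha> < \<alpha>"
    using eventually_happens[of _ "at_left (0::real)"] by auto
  then show thesis using that by blast
qed

text \<open>For a negative exponent \<open>1 + t\<close> may be replaced by \<open>t\<close> under
  the logarithm, and \<open>t > 1\<close> makes the division by \<open>ln t\<close> monotone. A
  vanishing moment gives the value minus infinity and is treated apart.\<close>

lemma ln_ext_powr_le:
  assumes u: "u \<le> ennreal (K * (1 + t) powr \<alpha>)" and K: "0 < K" and t: "1 < t" and \<alpha>: "\<alpha> < 0"
  shows "ln_ext u / ereal (ln t) \<le> ereal (ln K / ln t + \<alpha>)"
proof -
  have lt: "0 < ln t" using t by simp
  have fin: "u \<noteq> \<infinity>" using u by (auto simp: top_unique)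
  show ?thesis
  proof (cases "u = 0")
    case True
    then show ?thesis using lt by (simp add: ln_ext_def divide_ereal_def)
  next
    case False
    define x where "x = enn2real u"
    have x: "u = ennreal x" using fin by (simp add: x_def less_top)
    have x0: "0 < x" using False fin by (auto simp: x_def enn2real_positive_iff less_top zero_less_iff_neq_zero)
    have xle: "x \<le> K * (1 + t) powr \<alpha>" using u K x0 unfolding x by (simp add: ennreal_le_iff)
    have "ln x \<le> ln (K * (1 + t) powr \<alpha>)" using xle x0 by simp
    also have "\<dots> = ln K + \<alpha> * ln (1 + t)" using K t by (simp add: ln_mult ln_powr)
    also have "\<dots> \<le> ln K + \<alpha> * ln t" using t \<alpha> by (intro add_left_mono mult_left_mono_neg) auto
    finally have "ln x / ln t \<le> (ln K + \<alpha> * ln t) / ln t" using lt by (intro divide_right_mono) auto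
    also have "\<dots> = ln K / ln t + \<alpha>" using lt by (simp add: add_divide_distrib)
    finally show ?thesis using False fin lt by (simp add: ln_ext_def x_def)
  qed
qed

text \<open>The prefactor contributes \<open>ln K / ln t\<close>, which tends to 0. So a prefactor
  that depends on the initial value does not affect the exponent.\<close>

lemma Limsup_ln_ext_le:
  fixes u :: "real \<Rightarrow> ennreal"
  assumes u: "\<And>t. 0 \<le> t \<Longrightarrow> u t \<le> ennreal (K * (1 + t) powr \<alpha>)" and K: "0 < K" and \<alpha>: "\<alpha> < 0"
  shows "Limsup at_top (\<lambda>t. ln_ext (u t) / ereal (ln t)) \<le> ereal \<alpha>"
proof -
  have "Limsup at_top (\<lambda>t. ln_ext (u t) / ereal (ln t)) \<le> Limsup at_top (\<lambda>t. ereal (ln K / ln t + \<alpha>))"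
  proof (rule Limsup_mono)
    show "eventually (\<lambda>t. ln_ext (u t) / ereal (ln t) \<le> ereal (ln K / ln t + \<alpha>)) at_top"
      using eventually_gt_at_top[of 1]
    proof eventually_elim
      case (elim t)
      then show ?case by (intro ln_ext_powr_le u K \<alpha>) auto
    qed
  qed
  also have "\<dots> = ereal \<alpha>"
  proof (rule lim_imp_Limsup)
    have "((\<lambda>t. ln K / ln t) \<longlongrightarrow> 0) at_top"
      by (intro tendsto_divide_0[OF tendsto_const] filterlim_at_top_imp_at_infinity ln_at_top)
    from tendsto_add[OF this tendsto_const[of \<alpha>]]
    show "((\<lambda>t. ereal (ln K / ln t + \<alpha>)) \<longlongrightarrow> ereal \<alpha>) at_top" by simp
  qed simp
  finally show ?thesis .
qed

section \<open>Decay of the full second moment\<close>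

context brownian_setup
begin

text \<open>Every simple integral vanishes at time 0 and \<open>I\<close> is their limit there. This
  identifies \<open>X 0\<close> with \<open>x0\<close> almost surely.\<close>

lemma ito_integral_0:
  assumes "has_ito_integral M F B H I"
  shows "AE \<omega> in M. I 0 \<omega> = 0"
proof -
  obtain k \<tau> \<xi> where si: "\<And>n::nat. simple_integrand M F (k n) (\<tau> n) (\<xi> n)"
    and conv: "AE \<omega> in M. ito_approximates k \<tau> \<xi> H I \<omega>"
    using ito_approximation[OF assms] by blast
  show ?thesis
    using conv
  proof eventually_elim
    case (elim \<omega>)
    have "norm (I 0 \<omega>) \<le> 0 + \<epsilon>" if "0 < \<epsilon>" for \<epsilon>
    proof -
      have "\<forall>\<^sub>F n in sequentially. norm (simple_ito_integral B (k n) (\<tau> n) (\<xi> n) 0 \<omega> - I 0 \<omega>) \<le> \<epsilon>"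
        using elim[unfolded ito_approximates_def, rule_format, of 0 \<epsilon>] that by (auto elim: eventually_mono)
      then obtain n where "norm (simple_ito_integral B (k n) (\<tau> n) (\<xi> n) 0 \<omega> - I 0 \<omega>) \<le> \<epsilon>"
        by (auto simp: eventually_sequentially)
      then show ?thesis
        by (subst (asm) simple_ito_integral_0) (simp_all add: simple_integrand_times_nonneg[OF si])
    qed
    then have "norm (I 0 \<omega>) \<le> 0" by (rule field_le_epsilon)
    then show ?case by simp
  qed
qed

text \<open>The truncation levels are \<open>R = n + 1\<close>. The comparison uses the same
  \<alpha> and the same prefactor at every level, since a weight of at most 1 only lowers the
  initial moment.\<close>

lemma second_moment_decay:
  fixes X I :: "real \<Rightarrow> 'a \<Rightarrow> real^'d" and H :: "real \<Rightarrow> 'a \<Rightarrow> real^'m^'d" and \<phi> :: "'a \<Rightarrow> real \<Rightarrow> real^'d"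
  assumes X: "ito_process X x0 \<phi> H I"
    and x0: "x0 \<in> borel_measurable (F 0)" "(\<integral>\<^sup>+\<omega>. ennreal ((norm (x0 \<omega>))\<^sup>2) \<partial>M) < \<infinity>"
    and q: "0 < q" "q < 1" and \<mu>: "0 \<le> \<mu>"
    and diss: "\<forall>r\<ge>0. \<forall>\<omega>.
      2 * (X r \<omega> \<bullet> \<phi> \<omega> r) + (norm (H r \<omega>))\<^sup>2 \<le> - \<kappa> * (norm (X r \<omega>))\<^sup>2 + \<mu> * (norm (X (q * r) \<omega>))\<^sup>2"
    and \<alpha>: "\<alpha> < 0" "- \<kappa> + \<mu> * q powr \<alpha> < \<alpha>" and t: "0 \<le> t"
  shows "(\<integral>\<^sup>+\<omega>. ennreal ((norm (X t \<omega>))\<^sup>2) \<partial>M) \<le> ennreal ((expectation (\<lambda>\<omega>. (norm (x0 \<omega>))\<^sup>2) + 1) * (1 + t) powr \<alpha>)"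
proof -
  define c where "c r \<omega> = path_cost (\<lambda>r. X r \<omega>) (\<phi> \<omega>) (\<lambda>r. (norm (H r \<omega>))\<^sup>2) r" for r \<omega>
  define \<rho> where "\<rho> n r \<omega> = cutoff (real (Suc n)) (c r \<omega>)" for n r \<omega>
  \<comment> \<open>The added 1 makes the inequality at time 0 strict, as the crossing argument
    demands, and keeps \<open>K\<close> positive also for \<open>x0 = 0\<close>.\<close>
  define K where "K = expectation (\<lambda>\<omega>. (norm (x0 \<omega>))\<^sup>2) + 1"
  have K: "0 < K" unfolding K_def by (intro add_nonneg_pos integral_nonneg_AE) auto
  have m\<rho>: "\<rho> n r \<in> borel_measurable M" if "0 \<le> r" for n r
    using truncated_moment_inequality(1)[OF X _ q \<mu> diss that, of "real (Suc n)"]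
    unfolding \<rho>_def c_def by simp
  note mX = ito_processD(5)[OF X]
  have bound: "(\<integral>\<^sup>+\<omega>. ennreal (\<rho> n t \<omega> * (norm (X t \<omega>))\<^sup>2) \<partial>M) \<le> ennreal (K * (1 + t) powr \<alpha>)" for n
  proof -
    have R: "0 < real (Suc n)" by simp
    note mom = truncated_moment_inequality[OF X R q \<mu> diss]
    have \<rho>01: "AE \<omega> in M. \<forall>r\<ge>0. 0 \<le> \<rho> n r \<omega> \<and> \<rho> n r \<omega> \<le> 1"
      using mom(2) unfolding \<rho>_def c_def .
    have int: "integrable M (\<lambda>\<omega>. \<rho> n r \<omega> * (norm (X r \<omega>))\<^sup>2)" if "0 \<le> r" for r
      using mom(3)[OF that] unfolding \<rho>_def c_def .
    define m where "m r = expectation (\<lambda>\<omega>. \<rho> n r \<omega> * (norm (X r \<omega>))\<^sup>2)" for r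
    have m0: "m 0 < K"
    proof -
      have X0: "AE \<omega> in M. X 0 \<omega> = x0 \<omega>"
        using ito_processD(4)[OF X] ito_integral_0[OF ito_processD(1)[OF X]]
      proof eventually_elim
        case (elim \<omega>)
        have "(LINT s:{0..0}|lebesgue. \<phi> \<omega> s) = 0"
          unfolding set_lebesgue_integral_def
        proof (rule integral_eq_zero_AE)
          note AE_lebesgue_neq[of 0]
          then show "AE r in lebesgue. indicator {0..0} r *\<^sub>R \<phi> \<omega> r = 0" by eventually_elim auto
        qed
        then show ?case using elim by auto
      qed
      have mx0: "x0 \<in> borel_measurable M" using measurable_F_M[OF x0(1)] by simp
      have ix0: "integrable M (\<lambda>\<omega>. (norm (x0 \<omega>))\<^sup>2)"
        by (rule integrableI_nonneg) (use mx0 x0(2) in auto)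
      have "m 0 \<le> expectation (\<lambda>\<omega>. (norm (x0 \<omega>))\<^sup>2)"
        unfolding m_def
      proof (rule integral_mono_AE[OF int ix0])
        show "AE \<omega> in M. \<rho> n 0 \<omega> * (norm (X 0 \<omega>))\<^sup>2 \<le> (norm (x0 \<omega>))\<^sup>2"
          using X0 \<rho>01 by eventually_elim (simp add: mult_left_le_one_le)
      qed simp
      then show ?thesis by (simp add: K_def)
    qed
    have "m t \<le> K * (1 + t) powr \<alpha>"
    proof (rule pantograph_comparison[where m = m, OF _ _ q \<mu> \<alpha> K m0 t])
      show "continuous_on {0..} m"
        using mom(4) unfolding m_def[abs_def] \<rho>_def c_def .
      show "m t \<le> m s + (LINT r:{s..<t}|lebesgue. - \<kappa> * m r + \<mu> * m (q * r))" if "0 \<le> s" "s \<le> t" for s t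
        using mom(5)[OF that] unfolding m_def \<rho>_def c_def .
    qed
    moreover have "(\<integral>\<^sup>+\<omega>. ennreal (\<rho> n t \<omega> * (norm (X t \<omega>))\<^sup>2) \<partial>M) = ennreal (m t)"
      unfolding m_def
      by (rule nn_integral_eq_integral[OF int[OF t]]) (use \<rho>01 t in auto)
    ultimately show ?thesis by (simp add: ennreal_leI)
  qed
  \<comment> \<open>The cost \<open>c t \<omega>\<close> is some real number on every path, the
    exceptional ones included, so the weight tends to 1 everywhere.\<close>
  have lim: "(\<lambda>n. ennreal (\<rho> n t \<omega> * (norm (X t \<omega>))\<^sup>2)) \<longlonglongrightarrow> ennreal ((norm (X t \<omega>))\<^sup>2)" for \<omega>
  proof (rule tendsto_ennrealI)
    have "(\<lambda>n. max 0 (1 - c t \<omega> * (1 / real (Suc n)))) \<longlonglongrightarrow> max 0 (1 - c t \<omega> * 0)"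
      by (intro tendsto_intros lim_1_over_n[THEN LIMSEQ_Suc])
    then have "(\<lambda>n. \<rho> n t \<omega>) \<longlonglongrightarrow> 1" by (simp add: \<rho>_def cutoff_def)
    from tendsto_mult[OF this tendsto_const[of "(norm (X t \<omega>))\<^sup>2"]]
    show "(\<lambda>n. \<rho> n t \<omega> * (norm (X t \<omega>))\<^sup>2) \<longlonglongrightarrow> (norm (X t \<omega>))\<^sup>2" by simp
  qed
  have "(\<integral>\<^sup>+\<omega>. ennreal ((norm (X t \<omega>))\<^sup>2) \<partial>M) =
      (\<integral>\<^sup>+\<omega>. liminf (\<lambda>n. ennreal (\<rho> n t \<omega> * (norm (X t \<omega>))\<^sup>2)) \<partial>M)"
    using lim_imp_Liminf[OF _ lim] by (intro nn_integral_cong) auto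
  also have "\<dots> \<le> liminf (\<lambda>n. \<integral>\<^sup>+\<omega>. ennreal (\<rho> n t \<omega> * (norm (X t \<omega>))\<^sup>2) \<partial>M)"
  proof (rule nn_integral_liminf)
    note [measurable] = m\<rho>[OF t] mX[OF t]
    show "(\<lambda>\<omega>. ennreal (\<rho> n t \<omega> * (norm (X t \<omega>))\<^sup>2)) \<in> borel_measurable M" for n by measurable
  qed
  also have "\<dots> \<le> ennreal (K * (1 + t) powr \<alpha>)"
    using Liminf_mono[OF always_eventually[rule_format, OF bound], of sequentially] by (simp add: Liminf_const)
  finally show ?thesis by (simp add: K_def)
qed

end

text \<open>Both coefficients are compared with their zero value at the origin by changing one
  argument at a time. The mixed term \<open>norm x * norm y\<close> is split evenly, which puts
  \<open>b\<close> on both sides; squaring the sum in the bound for \<open>g\<close> produces the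
  factors 2. The double negation matches \<open>- \<kappa>\<close> in the energy estimate.\<close>

lemma pantograph_dissipativity:
  fixes f :: "real^'d \<Rightarrow> real^'d \<Rightarrow> real^'d" and g :: "real^'d \<Rightarrow> real^'d \<Rightarrow> real^'m^'d"
  assumes f0: "f 0 0 = 0" and g0: "g 0 0 = 0" and pos: "0 < b" "0 < c" "0 < d"
    and f1: "\<And>x\<^sub>1 x\<^sub>2 y. (x\<^sub>1 - x\<^sub>2) \<bullet> (f x\<^sub>1 y - f x\<^sub>2 y) \<le> a * (norm (x\<^sub>1 - x\<^sub>2))\<^sup>2"
    and f2: "\<And>x y\<^sub>1 y\<^sub>2. norm (f x y\<^sub>1 - f x y\<^sub>2) \<le> b * norm (y\<^sub>1 - y\<^sub>2)"
    and g1: "\<And>x\<^sub>1 x\<^sub>2 y. norm (g x\<^sub>1 y - g x\<^sub>2 y) \<le> c * norm (x\<^sub>1 - x\<^sub>2)"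
    and g2: "\<And>x y\<^sub>1 y\<^sub>2. norm (g x y\<^sub>1 - g x y\<^sub>2) \<le> d * norm (y\<^sub>1 - y\<^sub>2)"
  shows "2 * (x \<bullet> f x y) + (norm (g x y))\<^sup>2 \<le>
    - (- (2 * a + b + 2 * c\<^sup>2)) * (norm x)\<^sup>2 + (b + 2 * d\<^sup>2) * (norm y)\<^sup>2"
proof -
  let ?X = "norm x" and ?Y = "norm y"
  have "x \<bullet> f x y = (x - 0) \<bullet> (f x y - f 0 y) + x \<bullet> (f 0 y - f 0 0)"
    by (simp add: f0 inner_diff_right)
  moreover have "x \<bullet> (f 0 y - f 0 0) \<le> ?X * (b * ?Y)"
    using norm_cauchy_schwarz[of x "f 0 y - f 0 0"] mult_left_mono[OF f2[of 0 y 0], of ?X] by simp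
  ultimately have xf: "x \<bullet> f x y \<le> a * ?X\<^sup>2 + b * (?X * ?Y)"
    using f1[of x 0 y] by (simp add: mult.left_commute)
  have xy: "2 * (?X * ?Y) \<le> ?X\<^sup>2 + ?Y\<^sup>2" using sum_squares_bound[of ?X ?Y] by simp
  have "norm (g x y) \<le> norm (g x y - g 0 y) + norm (g 0 y - g 0 0)"
    using norm_triangle_ineq[of "g x y - g 0 y" "g 0 y - g 0 0"] by (simp add: g0)
  then have "norm (g x y) \<le> c * ?X + d * ?Y" using g1[of x y 0] g2[of 0 y 0] by simp
  then have "(norm (g x y))\<^sup>2 \<le> (c * ?X + d * ?Y)\<^sup>2" by (intro power_mono) auto
  also have "\<dots> \<le> 2 * (c * ?X)\<^sup>2 + 2 * (d * ?Y)\<^sup>2"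
    using sum_squares_bound[of "c * ?X" "d * ?Y"] by (simp add: power2_sum)
  finally have "(norm (g x y))\<^sup>2 \<le> 2 * c\<^sup>2 * ?X\<^sup>2 + 2 * d\<^sup>2 * ?Y\<^sup>2" by (simp add: power_mult_distrib)
  moreover have "2 * (x \<bullet> f x y) \<le> 2 * a * ?X\<^sup>2 + b * (?X\<^sup>2 + ?Y\<^sup>2)"
    using xf mult_left_mono[OF xy, of b] pos by (simp add: algebra_simps)
  ultimately show ?thesis by (simp add: algebra_simps)
qed

theorem theorem3p1:
  fixes M :: "'a measure"
    and F :: "real \<Rightarrow> 'a measure"
    and B :: "real \<Rightarrow> 'a \<Rightarrow> real^'m"
    and q a b c d\<^sub>0 :: real
    and f :: "real \<Rightarrow> real^'d \<Rightarrow> real^'d \<Rightarrow> real^'d"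
    and g :: "real \<Rightarrow> real^'d \<Rightarrow> real^'d \<Rightarrow> real^'m^'d"
  assumes "prob_space M"
    and "complete_measure M"
    and "usual_filtration M F"
    and "brownian_motion M F B"
    and "0 < q" and "q < 1"
    and "\<And>t. t \<ge> 0 \<Longrightarrow> f t 0 0 = 0"
    and "\<And>t. t \<ge> 0 \<Longrightarrow> g t 0 0 = 0"
    and "b > 0" and "c > 0" and "d\<^sub>0 > 0"
    and "\<And>t x\<^sub>1 x\<^sub>2 y. t \<ge> 0 \<Longrightarrow> (x\<^sub>1 - x\<^sub>2) \<bullet> (f t x\<^sub>1 y - f t x\<^sub>2 y) \<le> a * (norm (x\<^sub>1 - x\<^sub>2))\<^sup>2"
    and "\<And>t x y\<^sub>1 y\<^sub>2. t \<ge> 0 \<Longrightarrow> norm (f t x y\<^sub>1 - f t x y\<^sub>2) \<le> b * norm (y\<^sub>1 - y\<^sub>2)"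
    and "\<And>t x\<^sub>1 x\<^sub>2 y. t \<ge> 0 \<Longrightarrow> norm (g t x\<^sub>1 y - g t x\<^sub>2 y) \<le> c * norm (x\<^sub>1 - x\<^sub>2)"
    and "\<And>t x y\<^sub>1 y\<^sub>2. t \<ge> 0 \<Longrightarrow> norm (g t x y\<^sub>1 - g t x y\<^sub>2) \<le> d\<^sub>0 * norm (y\<^sub>1 - y\<^sub>2)"
    and "a + b + c\<^sup>2 + d\<^sub>0\<^sup>2 < 0"
  shows "mean_square_polynomially_stable M F B q f g"
proof -
  interpret prob_space M by fact
  interpret brownian_setup M F B by (intro brownian_setup.intro brownian_setup_axioms.intro) fact+
  define \<kappa> where "\<kappa> = - (2 * a + b + 2 * c\<^sup>2)"
  define \<mu> where "\<mu> = b + 2 * d\<^sub>0\<^sup>2"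
  \<comment> \<open>The difference \<open>\<kappa> - \<mu>\<close> is \<open>- 2\<close> times the
    left-hand side of the stability condition.\<close>
  have "\<mu> < \<kappa>" using assms(16) by (simp add: \<kappa>_def \<mu>_def)
  then obtain \<alpha> where \<alpha>: "\<alpha> < 0" "- \<kappa> + \<mu> * q powr \<alpha> < \<alpha>"
    using decay_exponent_exists assms(5) by blast
  have \<mu>: "0 \<le> \<mu>" using assms(9) by (simp add: \<mu>_def)
  show ?thesis
    unfolding mean_square_polynomially_stable_def
  proof (intro exI[of _ \<alpha>] conjI allI impI)
    fix x0 :: "'a \<Rightarrow> real^'d" and x :: "real \<Rightarrow> 'a \<Rightarrow> real^'d"
    assume x0: "x0 \<in> borel_measurable (F 0)" "(\<integral>\<^sup>+\<omega>. ennreal ((norm (x0 \<omega>))\<^sup>2) \<partial>M) < \<infinity>"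
      and sol: "spde_solution M F B q f g x0 x"
    from sol obtain I where X: "ito_process x x0 (\<lambda>\<omega> s. f s (x s \<omega>) (x (q * s) \<omega>)) (\<lambda>s \<omega>. g s (x s \<omega>) (x (q * s) \<omega>)) I"
      by (auto simp: spde_solution_def ito_process_def)
    have diss: "\<forall>r\<ge>0. \<forall>\<omega>. 2 * (x r \<omega> \<bullet> f r (x r \<omega>) (x (q * r) \<omega>)) + (norm (g r (x r \<omega>) (x (q * r) \<omega>)))\<^sup>2 \<le>
        - \<kappa> * (norm (x r \<omega>))\<^sup>2 + \<mu> * (norm (x (q * r) \<omega>))\<^sup>2"
      unfolding \<kappa>_def \<mu>_def
    proof (intro allI impI)
      fix r :: real and \<omega> assume "0 \<le> r"
      show "2 * (x r \<omega> \<bullet> f r (x r \<omega>) (x (q * r) \<omega>)) + (norm (g r (x r \<omega>) (x (q * r) \<omega>)))\<^sup>2 \<le>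
          - (- (2 * a + b + 2 * c\<^sup>2)) * (norm (x r \<omega>))\<^sup>2 + (b + 2 * d\<^sub>0\<^sup>2) * (norm (x (q * r) \<omega>))\<^sup>2"
        by (rule pantograph_dissipativity[where f = "f r" and g = "g r"]) (fact assms(9-11) assms(7,8,12-15)[OF \<open>0 \<le> r\<close>])+
    qed
    have K: "0 < expectation (\<lambda>\<omega>. (norm (x0 \<omega>))\<^sup>2) + 1"
      by (intro add_nonneg_pos integral_nonneg_AE) auto
    show "Limsup at_top (\<lambda>t. ln_ext (\<integral>\<^sup>+\<omega>. ennreal ((norm (x t \<omega>))\<^sup>2) \<partial>M) / ereal (ln t)) \<le> ereal \<alpha>"
      by (rule Limsup_ln_ext_le[OF second_moment_decay[OF X x0 assms(5,6) \<mu> diss \<alpha>] K \<alpha>(1)])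
  qed (rule \<alpha>(1))
qed

end
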